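(* Let $G$ be a connected cubic graph of order $n$. Then $\gamma(G) \leq \frac{5}{12}n + \frac{1}{2}$, with equality if and only if $G$ is isomorphic to the complete bipartite graph $K_{3,3}$.
   Context: All graphs are finite, undirected and simple. A graph is cubic if it is $3$-regular. A matching is a set of pairwise non-adjacent edges; a maximal matching is a matching not contained in any larger matching. For a graph $G$, $\gamma(G)$ denotes the minimum size of a maximal matching of $G$. *)

theory Defs
  imports Complex_Main "Graph_Theory.Graph_Theory"
begin

text \<open>
  A finite simple undirected graph is a \<^locale>\<open>pair_graph\<close>, which stores each undirected
  edge as the two opposite arcs. Matchings are sets of undirected edges, so every edge is
  counted once.
\<close>

definition uedges :: "'a pair_pre_digraph \<Rightarrow> 'a set set" where
  "uedges G = {{u, v} |u v. (u, v) \<in> parcs G}"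

text \<open>In a symmetric loopfree digraph the out-degree is the number of incident undirected edges.\<close>

definition regular_graph :: "nat \<Rightarrow> 'a pair_pre_digraph \<Rightarrow> bool" where
  "regular_graph k G \<longleftrightarrow> (\<forall>v \<in> pverts G. out_degree (with_proj G) v = k)"

abbreviation cubic_graph :: "'a pair_pre_digraph \<Rightarrow> bool" where
  "cubic_graph \<equiv> regular_graph 3"

definition matching :: "'a pair_pre_digraph \<Rightarrow> 'a set set \<Rightarrow> bool" where
  "matching G M \<longleftrightarrow> M \<subseteq> uedges G \<and> (\<forall>e \<in> M. \<forall>f \<in> M. e \<noteq> f \<longrightarrow> e \<inter> f = {})"

definition maximal_matching :: "'a pair_pre_digraph \<Rightarrow> 'a set set \<Rightarrow> bool" where
  "maximal_matching G M \<longleftrightarrow> matching G M \<and> \<not> (\<exists>M'. matching G M' \<and> M \<subset> M')"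

definition min_maximal_matching :: "'a pair_pre_digraph \<Rightarrow> nat" where
  "min_maximal_matching G = Min (card ` {M. maximal_matching G M})"

definition complete_bipartite_graph :: "nat \<Rightarrow> nat \<Rightarrow> (nat + nat) pair_pre_digraph" where
  "complete_bipartite_graph m n =
    (let U = Inl ` {..<m}; V = Inr ` {..<n}
     in \<lparr> pverts = U \<union> V, parcs = U \<times> V \<union> V \<times> U \<rparr>)"

lemma pair_graph_complete_bipartite_graph: "pair_graph (complete_bipartite_graph m n)"
  by unfold_locales
    (auto simp: complete_bipartite_graph_def Let_def symmetric_def sym_def)

lemma complete_bipartite_graph_is_complete_bipartite_digraph:
  "K\<^bsub>m,n\<^esub> (with_proj (complete_bipartite_graph m n))"
proof -
  interpret pair_graph "complete_bipartite_graph m n"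
    by (rule pair_graph_complete_bipartite_graph)
  have "graph (with_proj (complete_bipartite_graph m n))" by unfold_locales
  then show ?thesis
    unfolding complete_bipartite_digraph_def
    by (intro conjI exI[of _ "Inl ` {..<m}"] exI[of _ "Inr ` {..<n}"])
      (auto simp: complete_bipartite_graph_def Let_def card_image)
qed

lemma (in pair_fin_digraph) finite_uedges: "finite (uedges G)"
proof -
  have "uedges G = (\<lambda>(u, v). {u, v}) ` parcs G"
    by (auto simp: uedges_def)
  then show ?thesis using pair_finite_arcs by simp
qed

lemma (in pair_fin_digraph) finite_maximal_matchings: "finite {M. maximal_matching G M}"
  by (rule finite_subset[of _ "Pow (uedges G)"])
    (auto simp: maximal_matching_def matching_def finite_uedges)

lemma (in pair_fin_digraph) ex_maximal_matching: "\<exists>M. maximal_matching G M"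
proof -
  have "finite {M. matching G M}"
    by (rule finite_subset[of _ "Pow (uedges G)"]) (auto simp: matching_def finite_uedges)
  moreover have "{} \<in> {M. matching G M}" by (simp add: matching_def)
  ultimately obtain M where "M \<in> {M. matching G M}"
    and "\<forall>M' \<in> {M. matching G M}. M \<subseteq> M' \<longrightarrow> M = M'"
    using finite_has_maximal[of "{M. matching G M}"] by blast
  then have "maximal_matching G M" by (auto simp: maximal_matching_def)
  then show ?thesis ..
qed

end

theory Submission
  imports Defs "HOL-Library.Disjoint_Sets"
begin

text \<open>
  The bound is proved in the form \<open>6 \<gamma> \<le> 4 n - m\<close> for every graph of maximum degree at most 3 with
  \<open>n\<close> vertices and \<open>m\<close> edges that has no cubic component. In a minimal counterexample one removes
  the endpoints \<open>S\<close> of \<open>k\<close> matching edges together with \<open>i\<close> vertices all of whose neighbours lie in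
  \<open>S\<close>. This works if \<open>4 k\<close> is at most \<open>4 i\<close> plus the number of edges inside \<open>S\<close> plus the degree
  deficiency of \<open>S\<close>. If \<open>st\<close> is a matching edge on a path \<open>p s t q\<close>, one unit more is gained by
  adding the edge \<open>pq\<close> to the remaining graph: if \<open>pq\<close> is used there, it is exchanged for
  \<open>ps\<close> and \<open>tq\<close>, which replace \<open>st\<close>. The new edge may create a cubic component, which is then
  bounded by the two edges \<open>ps\<close> and \<open>tq\<close>; two different such two-edge cuts yield a bridge, and
  bridges are excluded by comparing \<open>4 n - m\<close> modulo 6 on both sides. A vertex of degree 2
  and its surroundings then always admit such a reduction.

  In a connected cubic graph, one step of this kind with \<open>k = 1\<close> and \<open>i = 0\<close> gives
  \<open>6 \<gamma> \<le> 4 n - m + 2\<close>, which is below the claimed bound. It is available unless every path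
  \<open>p s t q\<close> closes to a cycle and every triangle lies in a \<open>K\<^sub>4\<close>, that is, unless the graph is
  \<open>K\<^bsub>3,3\<^esub>\<close> or \<open>K\<^sub>4\<close>; and \<open>K\<^sub>4\<close> satisfies the inequality as well.
\<close>

section \<open>Graphs as edge sets\<close>

text \<open>In a cubic graph 4n - m = 5n/2. K_{3,3} violates the inequality, with 6 \<gamma> = 18
  against 15, so cubic components must be excluded; the remaining class is closed under deletion,
  and only added edges can leave it. The four-cycle has 6 \<gamma> = 12 = 4n - m, so reductions
  cannot be wasteful.

  This budget shapes the case analysis. Let x have just the neighbours a and b. Matching a and b to
  further neighbours and leaving x free requires 8 units and collects 4 from x and 1 from each
  matching edge. Each side of x must thus find one more unit: a vertex of degree 2 or an edge that
  can be added. Short cycles through x disturb this and are ruled out beforehand. A side that finds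
  neither contains K_{3,3} minus an edge; removing that block along with x leaves a single unit to
  be found on the other side. If both sides offer only added edges, the two additions may be blocked
  jointly by a set with four boundary edges; several such sets together produce a bridge.\<close>

definition nbrs :: "'a set set \<Rightarrow> 'a \<Rightarrow> 'a set" where
  "nbrs E v = {w. {v, w} \<in> E}"

definition sgraph :: "'a set \<Rightarrow> 'a set set \<Rightarrow> bool" where
  "sgraph V E \<longleftrightarrow> finite V \<and> (\<forall>e\<in>E. e \<subseteq> V \<and> card e = 2)"

definition subcubic :: "'a set set \<Rightarrow> bool" where
  "subcubic E \<longleftrightarrow> (\<forall>v. card (nbrs E v) \<le> 3)"

text \<open>When degrees are at most 3, a nonempty \<open>K\<close> whose vertices all have three
  neighbours in \<open>K\<close> is closed under adjacency, hence a union of cubic components.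
  Quantifying over vertex sets dispenses with paths and components.\<close>

definition cubic_free :: "'a set set \<Rightarrow> bool" where
  "cubic_free E \<longleftrightarrow> (\<forall>K. K \<noteq> {} \<longrightarrow> (\<exists>v\<in>K. card (nbrs E v \<inter> K) \<noteq> 3))"

definition del :: "'a set set \<Rightarrow> 'a set \<Rightarrow> 'a set set" where
  "del E W = {e \<in> E. e \<inter> W = {}}"

text \<open>Maximality of a matching in the form of domination, which can be checked edge by edge
  when matchings are glued together.\<close>

definition dominating_matching :: "'a set set \<Rightarrow> 'a set set \<Rightarrow> bool" where
  "dominating_matching E M \<longleftrightarrow> M \<subseteq> E \<and> disjoint M \<and> (\<forall>e\<in>E. e \<inter> \<Union>M \<noteq> {})"

definition meets_bound :: "'a set \<Rightarrow> 'a set set \<Rightarrow> bool" where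
  "meets_bound V E \<longleftrightarrow> (\<exists>M. dominating_matching E M \<and> 6 * card M + card E \<le> 4 * card V)"

lemma nbrs_sym: "w \<in> nbrs E v \<longleftrightarrow> v \<in> nbrs E w"
  by (simp add: nbrs_def insert_commute)

lemma nbrs_mono: "E \<subseteq> E' \<Longrightarrow> nbrs E v \<subseteq> nbrs E' v"
  by (auto simp: nbrs_def)

lemma sgraph_finite_edges: "sgraph V E \<Longrightarrow> finite E"
  unfolding sgraph_def by (meson Pow_iff finite_Pow_iff finite_subset subsetI)

lemma sgraph_edge_cases:
  assumes "sgraph V E" "e \<in> E"
  obtains u v where "e = {u, v}" "u \<noteq> v" "u \<in> V" "v \<in> V" "v \<in> nbrs E u"
proof -
  have "card e = 2" "e \<subseteq> V" using assms by (auto simp: sgraph_def)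
  then obtain u v where "e = {u, v}" "u \<noteq> v" by (auto simp: card_2_iff)
  with \<open>e \<subseteq> V\<close> assms(2) that show ?thesis by (auto simp: nbrs_def)
qed

lemma sgraph_nbrs:
  assumes "sgraph V E"
  shows "nbrs E v \<subseteq> V" "v \<notin> nbrs E v" "finite (nbrs E v)" "w \<in> nbrs E v \<Longrightarrow> v \<in> V"
proof -
  have *: "{v, w} \<in> E \<Longrightarrow> v \<in> V \<and> w \<in> V \<and> v \<noteq> w" for w
    using assms unfolding sgraph_def by fastforce
  show "nbrs E v \<subseteq> V" "v \<notin> nbrs E v" "w \<in> nbrs E v \<Longrightarrow> v \<in> V"
    using * *[of v] by (auto simp: nbrs_def)
  then show "finite (nbrs E v)" using assms by (auto simp: sgraph_def intro: finite_subset)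
qed

lemma subcubic_mono:
  assumes "sgraph V E" "subcubic E" "E' \<subseteq> E" shows "subcubic E'"
  unfolding subcubic_def
proof
  fix v
  have "card (nbrs E' v) \<le> card (nbrs E v)"
    by (rule card_mono[OF sgraph_nbrs(3)[OF assms(1)] nbrs_mono[OF assms(3)]])
  then show "card (nbrs E' v) \<le> 3" using assms(2) by (meson le_trans subcubic_def)
qed

text \<open>Fewer edges can only lower the number of neighbours in \<open>K\<close>, and this number
  never exceeds 3; a vertex that misses the value 3 keeps missing it.\<close>

lemma cubic_free_mono:
  assumes "sgraph V E" "subcubic E" "cubic_free E" "E' \<subseteq> E"
  shows "cubic_free E'"
  unfolding cubic_free_def
proof (intro allI impI)
  fix K :: "'a set" assume "K \<noteq> {}"
  then obtain v where v: "v \<in> K" "card (nbrs E v \<inter> K) \<noteq> 3"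
    using assms(3) by (auto simp: cubic_free_def)
  have fin: "finite (nbrs E v)" by (rule sgraph_nbrs(3)[OF assms(1)])
  have "card (nbrs E' v \<inter> K) \<le> card (nbrs E v \<inter> K)"
    by (rule card_mono) (use fin nbrs_mono[OF assms(4)] in auto)
  moreover have "card (nbrs E v \<inter> K) \<le> card (nbrs E v)"
    by (rule card_mono) (use fin in auto)
  moreover have "card (nbrs E v) \<le> 3" using assms(2) by (simp add: subcubic_def)
  ultimately show "\<exists>v\<in>K. card (nbrs E' v \<inter> K) \<noteq> 3"
    using v by (intro bexI[of _ v]) auto
qed

lemma sgraph_del: "sgraph V E \<Longrightarrow> sgraph (V - W) (del E W)"
  by (auto simp: sgraph_def del_def)

lemma del_subset: "del E W \<subseteq> E"
  by (auto simp: del_def)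

lemma nbrs_del: "nbrs (del E W) v = (if v \<in> W then {} else nbrs E v - W)"
  by (auto simp: nbrs_def del_def)

lemma nbrs_Un: "nbrs (E \<union> L) v = nbrs E v \<union> nbrs L v"
  by (auto simp: nbrs_def)

lemma nbrs_insert:
  "p \<noteq> q \<Longrightarrow> nbrs (insert {p, q} E) v = (if v = p then {q} else if v = q then {p} else {}) \<union> nbrs E v"
  by (auto simp: nbrs_def doubleton_eq_iff)

text \<open>The matching of the reduced graph may use some of the added edges \<open>L\<close>; the hypothesis says
  that each used edge can be exchanged for one additional matching edge at the removed set \<open>W\<close>.\<close>

lemma extend_matching:
  assumes sg: "sgraph V E"
    and M': "dominating_matching (del E W \<union> L) M'"
    and LE: "L \<inter> E = {}" and fin: "finite L"
    and ext: "\<And>X. X \<subseteq> L \<Longrightarrow> disjoint X \<Longrightarrow>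
      \<exists>Y. Y \<subseteq> E \<and> disjoint Y \<and> \<Union>X \<subseteq> \<Union>Y \<and> \<Union>Y \<subseteq> W \<union> \<Union>X \<and> card Y \<le> k + card X \<and>
        (\<forall>e\<in>E. e \<inter> W \<noteq> {} \<longrightarrow> e \<inter> \<Union>Y \<noteq> {})"
  shows "\<exists>M. dominating_matching E M \<and> card M \<le> card M' + k"
proof -
  define X where "X = M' \<inter> L"
  have dM': "disjoint M'" and sM': "M' \<subseteq> del E W \<union> L"
    using M' by (auto simp: dominating_matching_def)
  have "disjoint X" using dM' unfolding X_def by (rule pairwise_subset) auto
  then obtain Y where Y: "Y \<subseteq> E" "disjoint Y" "\<Union>X \<subseteq> \<Union>Y" "\<Union>Y \<subseteq> W \<union> \<Union>X"
      "card Y \<le> k + card X" "\<forall>e\<in>E. e \<inter> W \<noteq> {} \<longrightarrow> e \<inter> \<Union>Y \<noteq> {}"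
    using ext[of X] by (auto simp: X_def)
  define R where "R = M' - L"
  have R: "R \<subseteq> del E W" using sM' by (auto simp: R_def)
  have M'_eq: "M' = R \<union> X" and RX: "R \<inter> X = {}" by (auto simp: R_def X_def)
  have finE: "finite E" by (rule sgraph_finite_edges[OF sg])
  have finM': "finite M'" using sM' finE fin del_subset[of E W] by (meson finite_Un finite_subset)
  \<comment> \<open>A kept edge avoids \<open>W\<close> because it survived the deletion, and avoids
    the ends of \<open>X\<close> because it shares the matching \<open>M'\<close> with them;
    \<open>Y\<close> covers nothing else.\<close>
  have RY: "e \<inter> f = {}" if "e \<in> R" "f \<in> Y" for e f
  proof -
    have "e \<inter> W = {}" using that R by (auto simp: del_def)
    moreover have "e \<inter> \<Union>X = {}"
    proof (rule ccontr)
      assume "e \<inter> \<Union>X \<noteq> {}"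
      then obtain g where "g \<in> X" "e \<inter> g \<noteq> {}" by auto
      moreover have "e \<noteq> g" "e \<in> M'" "g \<in> M'" using that \<open>g \<in> X\<close> by (auto simp: R_def X_def)
      ultimately show False using dM' by (auto simp: pairwise_def disjnt_def)
    qed
    ultimately show ?thesis using Y(4) that by blast
  qed
  have "disjoint (R \<union> Y)"
    unfolding pairwise_def disjnt_def
  proof (intro ballI impI)
    fix e f assume ef: "e \<in> R \<union> Y" "f \<in> R \<union> Y" "e \<noteq> f"
    have R': "e \<inter> f = {}" if "e \<in> R" "f \<in> R" "e \<noteq> f" for e f
      using dM' that by (auto simp: pairwise_def disjnt_def R_def)
    have Y': "e \<inter> f = {}" if "e \<in> Y" "f \<in> Y" "e \<noteq> f" for e f
      using Y(2) that by (auto simp: pairwise_def disjnt_def)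
    show "e \<inter> f = {}" using ef R' Y' RY by (metis Un_iff inf_commute)
  qed
  moreover have "e \<inter> \<Union>(R \<union> Y) \<noteq> {}" if "e \<in> E" for e
  proof (cases "e \<inter> W = {}")
    case True
    then have "e \<in> del E W" using that by (auto simp: del_def)
    then have "e \<inter> \<Union>M' \<noteq> {}" using M' by (auto simp: dominating_matching_def)
    then show ?thesis using Y(3) unfolding M'_eq by auto
  next
    case False
    then show ?thesis using Y(6) that by auto
  qed
  ultimately have "dominating_matching E (R \<union> Y)"
    using R Y(1) by (auto simp: dominating_matching_def del_def)
  moreover have "card (R \<union> Y) \<le> card M' + k"
  proof -
    have "card M' = card R + card X"
      unfolding M'_eq using RX finM' M'_eq by (intro card_Un_disjoint) auto
    then show ?thesis using card_Un_le[of R Y] Y(5) by linarith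
  qed
  ultimately show ?thesis by blast
qed

section \<open>Counting the edges at a removed vertex set\<close>

lemma degree_sum:
  assumes sg: "sgraph V E" and S: "finite S"
  shows "(\<Sum>s\<in>S. card (nbrs E s)) = (\<Sum>e\<in>E. card (e \<inter> S))"
proof -
  have finE: "finite E" by (rule sgraph_finite_edges[OF sg])
  have nb: "card (nbrs E s) = card {e \<in> E. s \<in> e}" for s
  proof (rule bij_betw_same_card)
    show "bij_betw (\<lambda>w. {s, w}) (nbrs E s) {e \<in> E. s \<in> e}"
      unfolding bij_betw_def
    proof
      show "inj_on (\<lambda>w. {s, w}) (nbrs E s)" by (auto simp: inj_on_def doubleton_eq_iff)
      show "(\<lambda>w. {s, w}) ` nbrs E s = {e \<in> E. s \<in> e}"
      proof (intro equalityI subsetI)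
        fix e assume "e \<in> {e \<in> E. s \<in> e}"
        then have e: "e \<in> E" "s \<in> e" by auto
        from sg e(1) obtain u v where "e = {u, v}" by (rule sgraph_edge_cases)
        with e show "e \<in> (\<lambda>w. {s, w}) ` nbrs E s"
          by (auto simp: nbrs_def insert_commute image_iff)
      qed (auto simp: nbrs_def)
    qed
  qed
  have "(\<Sum>s\<in>S. card (nbrs E s)) = (\<Sum>s\<in>S. \<Sum>e\<in>E. if s \<in> e then 1 else 0)"
    unfolding nb using finE by (intro sum.cong refl) (simp add: sum.If_cases Int_def)
  also have "\<dots> = (\<Sum>e\<in>E. \<Sum>s\<in>S. if s \<in> e then 1 else 0)" by (rule sum.swap)
  also have "\<dots> = (\<Sum>e\<in>E. card (e \<inter> S))"
    using S by (intro sum.cong refl) (simp add: sum.If_cases Int_def conj_commute)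
  finally show ?thesis .
qed

text \<open>The degree sum over \<open>S\<close> counts an edge once for each end in
  \<open>S\<close>, so the edges of \<open>F\<close> are counted twice. The vertices of
  \<open>W\<close> outside \<open>S\<close> add no edge of their own.\<close>

lemma edges_at_count:
  assumes sg: "sgraph V E" and SW: "S \<subseteq> W" and WS: "\<And>e. e \<in> E \<Longrightarrow> e \<inter> W \<noteq> {} \<Longrightarrow> e \<inter> S \<noteq> {}"
    and S: "finite S" and F: "F \<subseteq> E" "\<And>f. f \<in> F \<Longrightarrow> f \<subseteq> S"
  shows "card E + card F \<le> card (del E W) + (\<Sum>s\<in>S. card (nbrs E s))"
proof -
  have finE: "finite E" by (rule sgraph_finite_edges[OF sg])
  have "(\<Sum>e\<in>E. (if e \<inter> S \<noteq> {} then 1 else 0) + (if e \<in> F then 1 else 0)) \<le> (\<Sum>e\<in>E. card (e \<inter> S))"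
  proof (rule sum_mono)
    fix e assume e: "e \<in> E"
    then have c: "card e = 2" using sg by (auto simp: sgraph_def)
    have fin: "finite (e \<inter> S)" using S by auto
    show "(if e \<inter> S \<noteq> {} then 1 else 0) + (if e \<in> F then 1 else 0) \<le> card (e \<inter> S)"
    proof (cases "e \<in> F")
      case True
      then have "e \<inter> S = e" using F by auto
      then show ?thesis using True c by auto
    next
      case False
      then show ?thesis using fin by (auto simp: Suc_le_eq card_gt_0_iff)
    qed
  qed
  then have "(\<Sum>e\<in>E. (if e \<inter> S \<noteq> {} then 1 else 0) + (if e \<in> F then 1 else 0))
      \<le> (\<Sum>s\<in>S. card (nbrs E s))" unfolding degree_sum[OF sg S] .
  moreover have "(\<Sum>e\<in>E. (if e \<inter> S \<noteq> {} then 1 else 0) + (if e \<in> F then 1 else 0))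
      = card {e\<in>E. e \<inter> S \<noteq> {}} + card F"
    using finE F(1) by (simp add: sum.distrib sum.If_cases Int_absorb1 Int_def conj_commute)
      (metis (no_types, lifting) Collect_cong Int_def inf.absorb_iff2 inf_commute mem_Collect_eq)
  moreover have "card E = card (del E W) + card {e\<in>E. e \<inter> S \<noteq> {}}"
  proof -
    have "E = del E W \<union> {e\<in>E. e \<inter> S \<noteq> {}}" using WS by (auto simp: del_def)
    moreover have "del E W \<inter> {e\<in>E. e \<inter> S \<noteq> {}} = {}" using SW by (auto simp: del_def)
    ultimately show ?thesis using finE
      by (metis (no_types, lifting) card_Un_disjoint finite_Un)
  qed
  ultimately show ?thesis by linarith
qed

section \<open>The reduced graph\<close>

lemma sgraph_reduced:
  assumes sg: "sgraph V E" and L: "\<And>f. f \<in> L \<Longrightarrow> f \<subseteq> V - W \<and> card f = 2"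
  shows "sgraph (V - W) (del E W \<union> L)"
  using sgraph_del[OF sg, of W] L by (auto simp: sgraph_def)

text \<open>A surviving vertex gains no more neighbours through \<open>L\<close> than it loses in
  \<open>W\<close>, so its degree does not rise.\<close>

lemma subcubic_reduced:
  assumes sg: "sgraph V E" and sc: "subcubic E" and L: "\<And>f. f \<in> L \<Longrightarrow> f \<subseteq> V - W \<and> card f = 2"
    and deg: "\<And>v. v \<notin> W \<Longrightarrow> card (nbrs L v) \<le> card (nbrs E v \<inter> W)"
  shows "subcubic (del E W \<union> L)"
  unfolding subcubic_def
proof
  fix v
  show "card (nbrs (del E W \<union> L) v) \<le> 3"
  proof (cases "v \<in> W")
    case True
    then have "nbrs L v = {}" using L by (fastforce simp: nbrs_def)
    then show ?thesis using True by (simp add: nbrs_Un nbrs_del)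
  next
    case False
    have fin: "finite (nbrs E v)" by (rule sgraph_nbrs(3)[OF sg])
    have "card (nbrs (del E W \<union> L) v) \<le> card (nbrs E v - W) + card (nbrs L v)"
      using False by (simp add: nbrs_Un nbrs_del card_Un_le)
    also have "\<dots> \<le> card (nbrs E v - W) + card (nbrs E v \<inter> W)" using deg[OF False] by simp
    also have "\<dots> = card (nbrs E v)" using fin by (metis add.commute card_Int_Diff)
    finally show ?thesis using sc by (meson le_trans subcubic_def)
  qed
qed

text \<open>Concrete matchings are lists of pairs: distinctness of the list of ends gives
  disjointness, and all side conditions of a reduction become finite conditions for the
  simplifier.\<close>

abbreviation ends :: "('a \<times> 'a) list \<Rightarrow> 'a set" where
  "ends ps \<equiv> set (map fst ps @ map snd ps)"

abbreviation edges :: "('a \<times> 'a) list \<Rightarrow> 'a set set" where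
  "edges ps \<equiv> (\<lambda>(u, v). {u, v}) ` set ps"

lemma Union_edges: "\<Union>(edges ps) = ends ps"
  by (force split: prod.splits)

lemma card_edges_le: "card (edges ps) \<le> length ps"
  by (meson card_image_le card_length finite_set le_trans)

lemma disjoint_edges:
  assumes "distinct (map fst ps @ map snd ps)"
  shows "disjoint (edges ps)"
  using assms
proof (induction ps)
  case (Cons p ps)
  obtain u v where p: "p = (u, v)" by (cases p)
  have "disjoint (edges ps)" using Cons by auto
  moreover have "disjnt {u, v} e" if "e \<in> edges ps" for e
  proof -
    have "e \<subseteq> ends ps" using that Union_edges[of ps] by blast
    moreover have "u \<notin> ends ps" "v \<notin> ends ps" using Cons.prems p by auto
    ultimately show ?thesis by (auto simp: disjnt_def)
  qed
  ultimately show ?case by (auto simp: p pairwise_insert disjnt_sym)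
qed auto

lemma edges_subset:
  assumes "\<forall>(u, v)\<in>set ps. v \<in> nbrs E u"
  shows "edges ps \<subseteq> E"
  using assms by (auto simp: nbrs_def)

section \<open>Two-edge cuts\<close>

text \<open>A set \<open>K\<close> whose edge boundary is the pair of edges \<open>ps\<close>, \<open>qt\<close>; adding the edge \<open>pq\<close> may
  turn such a set into a cubic component.\<close>

definition two_cut :: "'a set set \<Rightarrow> 'a set \<Rightarrow> 'a \<Rightarrow> 'a \<Rightarrow> 'a \<Rightarrow> 'a \<Rightarrow> bool" where
  "two_cut E K p s q t \<longleftrightarrow> p \<in> K \<and> q \<in> K \<and> s \<notin> K \<and> t \<notin> K \<and> s \<in> nbrs E p \<and> t \<in> nbrs E q \<and>
    (\<forall>v\<in>K. \<forall>w\<in>nbrs E v. w \<in> K \<or> v = p \<and> w = s \<or> v = q \<and> w = t)"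

text \<open>Without the edge \<open>pq\<close> there is no cubic set, so \<open>K\<close> contains
  \<open>p\<close> and \<open>q\<close>. A vertex of \<open>K\<close> other than these has its full
  degree inside \<open>K\<close> already; \<open>p\<close> and \<open>q\<close> owe one of their
  three neighbours to the added edge, so each has one real neighbour left over, namely
  \<open>s\<close> and \<open>t\<close>.\<close>

lemma two_cut_if_cubic:
  assumes sg: "sgraph V E" and sc: "subcubic E" and cf: "cubic_free (del E W)"
    and K: "K \<noteq> {}" "\<forall>v\<in>K. card (nbrs (insert {p, q} (del E W)) v \<inter> K) = 3"
    and pq: "p \<noteq> q" "p \<notin> W" "q \<notin> W" and s: "s \<in> nbrs E p" "s \<in> W" and t: "t \<in> nbrs E q" "t \<in> W"
  shows "two_cut E K p s q t" "K \<inter> W = {}"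
proof -
  let ?N = "nbrs (insert {p, q} (del E W))"
  have N: "?N v = (if v \<in> W then {} else nbrs E v - W) \<union>
      (if v = p then {q} else if v = q then {p} else {})" for v
    using pq(1) by (auto simp: nbrs_insert nbrs_del)
  have fin: "finite (nbrs E v)" for v by (rule sgraph_nbrs(3)[OF sg])
  have le3: "card (nbrs E v) \<le> 3" for v using sc by (simp add: subcubic_def)
  show KW: "K \<inter> W = {}"
  proof (rule ccontr)
    assume "K \<inter> W \<noteq> {}"
    then obtain v where "v \<in> K" "v \<in> W" by auto
    then have "?N v = {}" using pq N by auto
    then show False using K(2) \<open>v \<in> K\<close> by force
  qed
  \<comment> \<open>Three real neighbours in \<open>K\<close> exhaust the degree, so none is left
    outside.\<close>
  have full: "nbrs E v \<subseteq> K" if v: "v \<in> K" and "?N v \<inter> K \<subseteq> nbrs E v" for v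
  proof -
    have "card (?N v \<inter> K) = 3" using K(2) v by blast
    then have "?N v \<inter> K = nbrs E v"
      using that(2) fin[of v] le3[of v] by (intro card_seteq) auto
    then show ?thesis by blast
  qed
  have pqK: "p \<in> K \<and> q \<in> K"
  proof (rule ccontr)
    assume n: "\<not> (p \<in> K \<and> q \<in> K)"
    have "card (nbrs E v \<inter> K) = 3" if v: "v \<in> K" for v
    proof -
      have "?N v \<inter> K \<subseteq> nbrs E v" using n v N[of v] by (auto split: if_splits)
      from full[OF v this] this have "?N v \<inter> K \<subseteq> nbrs E v \<inter> K" "nbrs E v \<inter> K = nbrs E v" by auto
      moreover have "card (?N v \<inter> K) = 3" using K(2) v by blast
      ultimately show ?thesis using fin[of v] le3[of v] card_mono[of "nbrs E v" "?N v \<inter> K"] by auto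
    qed
    moreover have "nbrs (del E W) v \<inter> K = nbrs E v \<inter> K" if "v \<in> K" for v
      using that KW by (auto simp: nbrs_del)
    ultimately show False using cf K(1) by (auto simp: cubic_free_def)
  qed
  \<comment> \<open>Here \<open>r'\<close> is the neighbour gained by the added edge and
    \<open>r\<close> the one lost in \<open>W\<close>; the two other neighbours must lie in
    \<open>K\<close>.\<close>
  have one: "nbrs E v \<subseteq> insert r K" if v: "v \<in> K" and r: "r \<in> nbrs E v" "r \<in> W"
    and sub: "?N v \<inter> K \<subseteq> insert r' (nbrs E v - {r})" for v r r'
  proof -
    have "card (?N v \<inter> K - {r'}) \<ge> 2"
      using K(2) v diff_card_le_card_Diff[of "{r'}" "?N v \<inter> K"] by simp
    moreover have "?N v \<inter> K - {r'} \<subseteq> nbrs E v - {r}" using sub by auto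
    moreover have "card (nbrs E v - {r}) \<le> 2" using le3[of v] r(1) fin[of v]
      by (simp add: card_Diff_singleton_if)
    ultimately have "?N v \<inter> K - {r'} = nbrs E v - {r}"
      using fin[of v] by (intro card_seteq) auto
    then show ?thesis by blast
  qed
  have p: "nbrs E p \<subseteq> insert s K"
    by (rule one[of p s q]) (use pqK s N[of p] in auto)
  have q: "nbrs E q \<subseteq> insert t K"
    by (rule one[of q t p]) (use pqK t N[of q] pq(1) in auto)
  have other: "nbrs E v \<subseteq> K" if "v \<in> K" "v \<noteq> p" "v \<noteq> q" for v
    by (rule full[OF that(1)]) (use that N[of v] in \<open>auto split: if_splits\<close>)
  show "two_cut E K p s q t"
    unfolding two_cut_def
  proof (intro conjI ballI)
    fix v w assume "v \<in> K" "w \<in> nbrs E v"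
    then show "w \<in> K \<or> v = p \<and> w = s \<or> v = q \<and> w = t"
      using p q other[of v] by (cases "v = p"; cases "v = q") auto
  qed (use pqK s t KW in auto)
qed

text \<open>If \<open>q\<close> is blocked by the cut \<open>K\<close>, a further neighbour
  \<open>r\<close> of \<open>t\<close> is on the other side of it: otherwise the edge
  \<open>rt\<close> would be a third boundary edge. So \<open>r\<close> can take over the role of
  \<open>q\<close>.\<close>

lemma two_cut_avoids:
  assumes "two_cut E K p s q t" "t \<in> nbrs E r" "r \<notin> {q, s, t}" "s \<noteq> t"
  shows "r \<notin> K" "r \<noteq> p" "r \<notin> nbrs E p"
proof -
  have c: "p \<in> K" "t \<notin> K" "\<forall>v\<in>K. \<forall>w\<in>nbrs E v. w \<in> K \<or> v = p \<and> w = s \<or> v = q \<and> w = t"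
    using assms(1) by (auto simp: two_cut_def)
  show r: "r \<notin> K" using c(2,3) assms(2-4) by auto
  show "r \<noteq> p" using c(1) r by auto
  show "r \<notin> nbrs E p" using c(1,3) r assms(3) by auto
qed

definition ind :: "'a set set \<Rightarrow> 'a set \<Rightarrow> 'a set set" where
  "ind E X = {e \<in> E. e \<subseteq> X}"

section \<open>Bridges\<close>

lemma sgraph_ind: "sgraph V E \<Longrightarrow> X \<subseteq> V \<Longrightarrow> sgraph X (ind E X)"
  by (auto simp: sgraph_def ind_def intro: finite_subset)

lemma ind_subset: "ind E X \<subseteq> E"
  by (auto simp: ind_def)

lemma nbrs_ind: "nbrs (ind E X) v = (if v \<in> X then nbrs E v \<inter> X else {})"
  by (auto simp: nbrs_def ind_def)

lemma ind_Diff: "ind E (X - W) = del (ind E X) W"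
  by (auto simp: ind_def del_def)

text \<open>Three treatments of the side \<open>X\<close> of a bridge \<open>uv\<close>:
  \<open>A\<close> ignores the bridge, \<open>B\<close> leaves \<open>u\<close> to be matched along
  the bridge, \<open>C\<close> covers \<open>u\<close> from inside. As \<open>u\<close> has at most
  two neighbours in \<open>X\<close>, removing it gains 4 - 2 = 2. Matching \<open>u\<close> to
  \<open>u'\<close> costs 6 and gains 8 minus at most 2 + 3 - 1 edges, a net loss of 2.\<close>

lemma half_bridge:
  assumes sg: "sgraph V E" and sc: "subcubic E"
    and X: "X \<subseteq> V" "u \<in> X" "u' \<in> X" "u' \<in> nbrs E u" and v: "v \<notin> X" "v \<in> nbrs E u"
    and ok: "\<And>Y. Y \<subset> V \<Longrightarrow> meets_bound Y (ind E Y)"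
  obtains A B C where
    "dominating_matching (ind E X) A" "6 * card A + card (ind E X) \<le> 4 * card X"
    "dominating_matching (ind E (X - {u})) B" "6 * card B + card (ind E X) + 2 \<le> 4 * card X"
    "dominating_matching (ind E X) C" "u \<in> \<Union>C" "6 * card C + card (ind E X) \<le> 4 * card X + 2"
proof -
  have sgX: "sgraph X (ind E X)" by (rule sgraph_ind[OF sg X(1)])
  have finX: "finite X" using sgX by (auto simp: sgraph_def)
  have fin: "finite (nbrs E w)" for w by (rule sgraph_nbrs(3)[OF sg])
  have le3: "card (nbrs E w) \<le> 3" for w using sc by (simp add: subcubic_def)
  have vV: "v \<in> V" using v sgraph_nbrs(1)[OF sg] by auto
  have uu': "u \<noteq> u'" using X(4) sgraph_nbrs(2)[OF sg] by auto
  have du: "card (nbrs (ind E X) u) \<le> 2"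
  proof -
    have "nbrs (ind E X) u \<subseteq> nbrs E u - {v}" using v by (auto simp: nbrs_ind)
    then have "card (nbrs (ind E X) u) \<le> card (nbrs E u - {v})" using fin by (intro card_mono) auto
    then show ?thesis using le3[of u] v fin[of u] by (simp add: card_Diff_singleton_if)
  qed
  have du': "card (nbrs (ind E X) u') \<le> 3"
  proof -
    have "card (nbrs (ind E X) u') \<le> card (nbrs E u')"
      using fin by (intro card_mono nbrs_mono ind_subset) auto
    then show ?thesis using le3[of u'] by linarith
  qed
  have edge: "{u, u'} \<in> ind E X" using X by (auto simp: nbrs_def ind_def)
  obtain A where A: "dominating_matching (ind E X) A" "6 * card A + card (ind E X) \<le> 4 * card X"
    using ok[of X] X(1) v(1) vV unfolding meets_bound_def by blast
  have "X - {u} \<subset> V" "X - {u, u'} \<subset> V" using X vV v by auto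
  then obtain B D where B: "dominating_matching (ind E (X - {u})) B"
      "6 * card B + card (ind E (X - {u})) \<le> 4 * card (X - {u})"
    and D: "dominating_matching (ind E (X - {u, u'})) D"
      "6 * card D + card (ind E (X - {u, u'})) \<le> 4 * card (X - {u, u'})"
    using ok unfolding meets_bound_def by meson
  have "card (ind E X) + card ({} :: 'a set set) \<le> card (del (ind E X) {u}) + (\<Sum>s\<in>{u}. card (nbrs (ind E X) s))"
    by (rule edges_at_count[OF sgX]) auto
  then have c1: "card (ind E X) \<le> card (ind E (X - {u})) + 2" using du by (simp add: ind_Diff)
  have "card (ind E X) + card {{u, u'}} \<le>
      card (del (ind E X) {u, u'}) + (\<Sum>s\<in>{u, u'}. card (nbrs (ind E X) s))"
    by (rule edges_at_count[OF sgX]) (use edge in auto)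
  then have c2: "card (ind E X) \<le> card (ind E (X - {u, u'})) + 4"
    using du du' uu' by (simp add: ind_Diff)
  have cX: "card (X - {u}) = card X - 1" "card (X - {u, u'}) = card X - 2" "card X \<ge> 2"
    using X uu' finX card_mono[of X "{u, u'}"] by (auto simp: card_Diff_subset)
  define C where "C = insert {u, u'} D"
  have D': "D \<subseteq> ind E (X - {u, u'})" "disjoint D" using D by (auto simp: dominating_matching_def)
  have finD: "finite D" using D' sgraph_finite_edges[OF sg] ind_subset finite_subset by metis
  have "dominating_matching (ind E X) C"
    unfolding dominating_matching_def
  proof (intro conjI ballI)
    show "C \<subseteq> ind E X" using D'(1) edge by (auto simp: C_def ind_def)
    show "disjoint C" unfolding C_def using D'
      by (auto simp: pairwise_insert disjnt_def ind_def)
    fix e assume e: "e \<in> ind E X"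
    show "e \<inter> \<Union>C \<noteq> {}"
    proof (cases "e \<inter> {u, u'} = {}")
      case True
      then have "e \<in> ind E (X - {u, u'})" using e by (auto simp: ind_def)
      then have "e \<inter> \<Union>D \<noteq> {}" using D by (auto simp: dominating_matching_def)
      then show ?thesis by (auto simp: C_def)
    qed (auto simp: C_def)
  qed
  moreover have "u \<in> \<Union>C" by (simp add: C_def)
  moreover have "card C \<le> card D + 1" using finD by (simp add: C_def card_insert_if)
  ultimately show ?thesis
    using that[OF A B(1), of C] B(2) D(2) c1 c2 cX by linarith
qed

text \<open>The bridge has to be dominated from one of its ends or be matched itself, which leaves
  three candidates: \<open>A\<close> with \<open>C'\<close>, \<open>C\<close> with
  \<open>A'\<close>, and \<open>uv\<close> with \<open>B\<close> and \<open>B'\<close>. Divisibility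
  by 6 shows that they cannot all be too large. Only the bound for proper induced subgraphs enters,
  so the lemma also serves for cubic graphs.\<close>

lemma meets_bound_if_bridge:
  assumes sg: "sgraph V E" and sc: "subcubic E"
    and X: "X \<subseteq> V" "u \<in> X" "v \<in> V" "v \<notin> X" "v \<in> nbrs E u"
    and cross: "\<And>p q. p \<in> X \<Longrightarrow> q \<in> nbrs E p \<Longrightarrow> q \<in> X \<or> p = u \<and> q = v"
    and u': "u' \<in> nbrs E u" "u' \<noteq> v" and v': "v' \<in> nbrs E v" "v' \<noteq> u"
    and ok: "\<And>Y. Y \<subset> V \<Longrightarrow> meets_bound Y (ind E Y)"
  shows "meets_bound V E"
proof -
  have uv: "u \<in> nbrs E v" "{u, v} \<in> E" using X(5) by (simp_all add: nbrs_def insert_commute)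
  have u'X: "u' \<in> X" using cross[OF X(2) u'(1)] u'(2) by auto
  have v'V: "v' \<in> V" using v' sgraph_nbrs(1)[OF sg] by auto
  have v'X: "v' \<notin> X" using cross[of v' v] v' X(4) by (auto simp: nbrs_sym[of v' E v])
  define Z where "Z = V - X"
  have Z: "Z \<subseteq> V" "v \<in> Z" "v' \<in> Z" "u \<notin> Z" using X v'V v'X by (auto simp: Z_def)
  obtain A B C where
    ABC: "dominating_matching (ind E X) A" "6 * card A + card (ind E X) \<le> 4 * card X"
    "dominating_matching (ind E (X - {u})) B" "6 * card B + card (ind E X) + 2 \<le> 4 * card X"
    "dominating_matching (ind E X) C" "u \<in> \<Union>C" "6 * card C + card (ind E X) \<le> 4 * card X + 2"
    by (rule half_bridge[OF sg sc X(1,2) u'X u'(1) X(4,5) ok])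
  obtain A' B' C' where
    ABC': "dominating_matching (ind E Z) A'" "6 * card A' + card (ind E Z) \<le> 4 * card Z"
    "dominating_matching (ind E (Z - {v})) B'" "6 * card B' + card (ind E Z) + 2 \<le> 4 * card Z"
    "dominating_matching (ind E Z) C'" "v \<in> \<Union>C'" "6 * card C' + card (ind E Z) \<le> 4 * card Z + 2"
    by (rule half_bridge[OF sg sc Z(1-3) v'(1) Z(4) uv(1) ok])
  have E_cases: "e \<in> ind E X \<or> e \<in> ind E Z \<or> e = {u, v}" if "e \<in> E" for e
  proof -
    from sg that obtain p q where e: "e = {p, q}" "p \<in> V" "q \<in> V" "q \<in> nbrs E p"
      by (rule sgraph_edge_cases)
    then show ?thesis using that cross[of p q] cross[of q p] nbrs_sym[of q E p]
      by (auto simp: ind_def Z_def)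
  qed
  have fin: "finite (ind E Y)" for Y
    using sgraph_finite_edges[OF sg] ind_subset finite_subset by metis
  have finM: "finite M" if "dominating_matching (ind E Y) M" for M Y
    using that fin finite_subset by (auto simp: dominating_matching_def)
  have join: "dominating_matching E (P \<union> Q)"
    if "dominating_matching (ind E X) P" "dominating_matching (ind E Z) Q" "u \<in> \<Union>P \<or> v \<in> \<Union>Q" for P Q
    unfolding dominating_matching_def
  proof (intro conjI ballI)
    show "P \<union> Q \<subseteq> E" using that by (auto simp: dominating_matching_def ind_def)
    have "P \<subseteq> ind E X" "Q \<subseteq> ind E Z" "disjoint P" "disjoint Q"
      using that by (auto simp: dominating_matching_def)
    moreover have "\<Union>P \<inter> \<Union>Q = {}"
    proof -
      have "\<Union>P \<subseteq> X" "\<Union>Q \<subseteq> Z" using \<open>P \<subseteq> _\<close> \<open>Q \<subseteq> _\<close> by (auto simp: ind_def)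
      then show ?thesis by (auto simp: Z_def)
    qed
    ultimately show "disjoint (P \<union> Q)" by (intro disjoint_union)
    fix e assume "e \<in> E"
    then consider "e \<in> ind E X" | "e \<in> ind E Z" | "e = {u, v}" using E_cases by blast
    then show "e \<inter> \<Union>(P \<union> Q) \<noteq> {}"
    proof cases
      case 1
      then have "e \<inter> \<Union>P \<noteq> {}" using that(1) by (auto simp: dominating_matching_def)
      then show ?thesis by auto
    next
      case 2
      then have "e \<inter> \<Union>Q \<noteq> {}" using that(2) by (auto simp: dominating_matching_def)
      then show ?thesis by auto
    qed (use that(3) in auto)
  qed
  have join': "dominating_matching E (insert {u, v} (B \<union> B'))"
    unfolding dominating_matching_def
  proof (intro conjI ballI)
    show "insert {u, v} (B \<union> B') \<subseteq> E"
      using ABC(3) ABC'(3) uv by (auto simp: dominating_matching_def ind_def)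
    have "B \<subseteq> ind E (X - {u})" "B' \<subseteq> ind E (Z - {v})" "disjoint B" "disjoint B'"
      using ABC(3) ABC'(3) by (auto simp: dominating_matching_def)
    moreover have "\<Union>B \<inter> \<Union>B' = {}"
    proof -
      have "\<Union>B \<subseteq> X" "\<Union>B' \<subseteq> Z" using \<open>B \<subseteq> _\<close> \<open>B' \<subseteq> _\<close> by (auto simp: ind_def)
      then show ?thesis by (auto simp: Z_def)
    qed
    ultimately have "disjoint (B \<union> B')" by (intro disjoint_union)
    moreover have "disjnt {u, v} f" if "f \<in> B \<union> B'" for f
    proof -
      have "f \<subseteq> X - {u} \<or> f \<subseteq> Z - {v}"
        using that \<open>B \<subseteq> _\<close> \<open>B' \<subseteq> _\<close> by (auto simp: ind_def)
      then show ?thesis using X(2,4) Z(2,4) by (auto simp: disjnt_def)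
    qed
    ultimately show "disjoint (insert {u, v} (B \<union> B'))"
      by (auto simp: pairwise_insert disjnt_sym)
    fix e assume "e \<in> E"
    then consider "u \<in> e" | "v \<in> e" | "e \<in> ind E (X - {u})" | "e \<in> ind E (Z - {v})"
      using E_cases[of e] by (auto simp: ind_def)
    then show "e \<inter> \<Union>(insert {u, v} (B \<union> B')) \<noteq> {}"
    proof cases
      case 3
      then have "e \<inter> \<Union>B \<noteq> {}" using ABC(3) by (auto simp: dominating_matching_def)
      then show ?thesis by auto
    next
      case 4
      then have "e \<inter> \<Union>B' \<noteq> {}" using ABC'(3) by (auto simp: dominating_matching_def)
      then show ?thesis by auto
    qed auto
  qed
  have cE: "card E = card (ind E X) + card (ind E Z) + 1"
  proof -
    have eq: "E = insert {u, v} (ind E X \<union> ind E Z)"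
      using E_cases uv(2) by (auto simp: ind_def)
    have "{u, v} \<notin> ind E X \<union> ind E Z" using X(4) Z(4) by (auto simp: ind_def)
    moreover have "ind E X \<inter> ind E Z = {}"
    proof -
      have False if "e \<in> ind E X" "e \<in> ind E Z" for e
      proof -
        have "e = {}" using that by (auto simp: ind_def Z_def)
        moreover have "card e = 2" using that sg by (auto simp: ind_def sgraph_def)
        ultimately show False by simp
      qed
      then show ?thesis by blast
    qed
    ultimately show ?thesis using fin
      by (subst eq) (simp add: card_Un_disjoint)
  qed
  have cV: "card V = card X + card Z"
    unfolding Z_def using X(1) sg by (metis card_Diff_subset card_mono finite_subset le_add_diff_inverse sgraph_def)
  have 1: "meets_bound V E" if "6 * (card A + card C') + card E \<le> 4 * card V"
    using join[OF ABC(1) ABC'(5)] ABC'(6) that card_Un_le[of A C'] unfolding meets_bound_def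
    by (intro exI[of _ "A \<union> C'"]) auto
  have 2: "meets_bound V E" if "6 * (card C + card A') + card E \<le> 4 * card V"
    using join[OF ABC(5) ABC'(1)] ABC(6) that card_Un_le[of C A'] unfolding meets_bound_def
    by (intro exI[of _ "C \<union> A'"]) auto
  have 3: "meets_bound V E" if "6 * (card B + card B' + 1) + card E \<le> 4 * card V"
  proof -
    have "card (insert {u, v} (B \<union> B')) \<le> card B + card B' + 1"
      using card_Un_le[of B B'] finM[OF ABC(3)] finM[OF ABC'(3)] by (simp add: card_insert_if)
    then show ?thesis using join' that unfolding meets_bound_def
      by (intro exI[of _ "insert {u, v} (B \<union> B')"]) auto
  qed
  \<comment> \<open>Suppose all three candidates fail. Inserting the bounds of the primed side gives
    strict inequalities such as 6a < 6b + 5, and integrality turns them into a = b = c. But then the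
    matching \<open>C\<close> has the size of \<open>B\<close>, whose bound is smaller by 2, and
    \<open>C\<close> with \<open>A'\<close> is good enough after all.\<close>
  have arith: "6 * (a + c') + (e + e' + 1) \<le> 4 * (x + x') \<or> 6 * (c + a') + (e + e' + 1) \<le> 4 * (x + x')
      \<or> 6 * (b + b' + 1) + (e + e' + 1) \<le> 4 * (x + x')"
    if "6 * a + e \<le> 4 * x" "6 * b + e + 2 \<le> 4 * x" "6 * c + e \<le> 4 * x + 2"
      "6 * a' + e' \<le> 4 * x'" "6 * b' + e' + 2 \<le> 4 * x'" "6 * c' + e' \<le> 4 * x' + 2"
    for a b c a' b' c' e e' x x' :: nat
  proof (rule ccontr)
    assume "\<not> ?thesis"
    then have n: "4 * x + 4 * x' < 6 * a + 6 * c' + (e + e' + 1)"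
      "4 * x + 4 * x' < 6 * c + 6 * a' + (e + e' + 1)"
      "4 * x + 4 * x' < 6 * b + 6 * b' + 6 + (e + e' + 1)" by (auto simp: algebra_simps)
    have "a < b + 1" using that(1,5) n(3) by linarith
    moreover have "b < a + 1" using that(2,6) n(1) by linarith
    moreover have "a < c + 1" using that(1,4) n(2) by linarith
    moreover have "c < a + 1" using that(3,6) n(1) by linarith
    ultimately have "a = b" "a = c" by auto
    then show False using that n by linarith
  qed
  show ?thesis
    using arith[OF ABC(2,4,7) ABC'(2,4,7)] 1 2 3 unfolding cE cV by blast
qed

section \<open>Reductions of a minimal counterexample\<close>

text \<open>The two added edges may share an end, so the new degree is charged to the removed
  neighbours: \<open>h\<close> sends each removed neighbour to the new neighbour that replaces
  it.\<close>

lemma added_degree: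
  assumes "distinct [a, a1, b, b1]"
  shows "card (nbrs {{p, q}, {r, s}} v) \<le> card {w. (v, w) \<in> {(p, a), (q, a1), (r, b), (s, b1)}}" (is "_ \<le> card ?T")
proof -
  define h where "h w = (if w = a then q else if w = a1 then p else if w = b then s else r)" for w
  have h: "h a = q" "h a1 = p" "h b = s" "h b1 = r" using assms by (auto simp: h_def)
  have "nbrs {{p, q}, {r, s}} v \<subseteq> h ` ?T"
  proof
    fix w assume "w \<in> nbrs {{p, q}, {r, s}} v"
    then have "v = p \<and> w = q \<or> v = q \<and> w = p \<or> v = r \<and> w = s \<or> v = s \<and> w = r"
      by (auto simp: nbrs_def doubleton_eq_iff)
    then have "\<exists>u\<in>?T. h u = w" using h by (elim disjE) auto
    then show "w \<in> h ` ?T" by auto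
  qed
  moreover have "finite ?T" by (rule finite_subset[of _ "{a, a1, b, b1}"]) auto
  ultimately show ?thesis by (meson surj_card_le)
qed

locale min_counterexample =
  fixes V :: "'a set" and E :: "'a set set"
  assumes sg: "sgraph V E" and sc: "subcubic E" and cf: "cubic_free E"
    and IH: "\<And>V' E'. sgraph V' E' \<Longrightarrow> subcubic E' \<Longrightarrow> cubic_free E' \<Longrightarrow> card (V' :: 'a set) < card V \<Longrightarrow> meets_bound V' E'"
    and not_meets_bound: "\<not> meets_bound V E"
begin

abbreviation N :: "'a \<Rightarrow> 'a set" where "N \<equiv> nbrs E"

lemma finV: "finite V"
  using sg by (simp add: sgraph_def)

lemma finN [simp]: "finite (N v)"
  by (rule sgraph_nbrs(3)[OF sg])

lemma N_le3: "card (N v) \<le> 3"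
  using sc by (simp add: subcubic_def)

lemma N_irrefl [simp]: "v \<notin> N v"
  by (rule sgraph_nbrs(2)[OF sg])

lemma N_V: "w \<in> N v \<Longrightarrow> w \<in> V" "w \<in> N v \<Longrightarrow> v \<in> V"
  using sgraph_nbrs(1,4)[OF sg] by auto

lemma N_sym: "w \<in> N v \<Longrightarrow> v \<in> N w"
  by (simp add: nbrs_sym)

text \<open>Removing \<open>W\<close> and adding \<open>L\<close> lowers 4n - m by at least 4 |W| +
  |F| + |L| minus the degree sum over \<open>S\<close>, while the matching grows by \<open>k\<close>
  edges of price 6; \<open>count\<close> says that this pays. The hypothesis \<open>ext\<close> is
  the local part of the extension of the matching.\<close>

lemma reduce:
  assumes W: "W \<subseteq> V" "W \<noteq> {}" and S: "S \<subseteq> W" "\<And>e. e \<in> E \<Longrightarrow> e \<inter> W \<noteq> {} \<Longrightarrow> e \<inter> S \<noteq> {}"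
    and F: "F \<subseteq> E" "\<And>f. f \<in> F \<Longrightarrow> f \<subseteq> S"
    and L: "\<And>f. f \<in> L \<Longrightarrow> f \<subseteq> V - W \<and> card f = 2" "L \<inter> E = {}"
    and deg: "\<And>v. v \<notin> W \<Longrightarrow> card (nbrs L v) \<le> card (N v \<inter> W)"
    and free: "cubic_free (del E W \<union> L)"
    and ext: "\<And>X. X \<subseteq> L \<Longrightarrow> disjoint X \<Longrightarrow>
      \<exists>Y. Y \<subseteq> E \<and> disjoint Y \<and> \<Union>X \<subseteq> \<Union>Y \<and> \<Union>Y \<subseteq> W \<union> \<Union>X \<and> card Y \<le> k + card X \<and>
        (\<forall>e\<in>E. e \<inter> W \<noteq> {} \<longrightarrow> e \<inter> \<Union>Y \<noteq> {})"
    and count: "6 * k + (\<Sum>s\<in>S. card (N s)) \<le> 4 * card W + card F + card L"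
  shows False
proof -
  have finW: "finite W" using W(1) finV finite_subset by auto
  have cW: "card (V - W) = card V - card W" "card W \<le> card V" "card W > 0"
    using W finW finV by (auto simp: card_Diff_subset card_mono card_gt_0_iff)
  have finL: "finite L"
    by (rule finite_subset[of _ "Pow V"]) (use L(1) finV in auto)
  have finE: "finite E" by (rule sgraph_finite_edges[OF sg])
  have "meets_bound (V - W) (del E W \<union> L)"
    by (rule IH[OF sgraph_reduced[OF sg L(1)] subcubic_reduced[OF sg sc L(1) deg] free]) (use cW in auto)
  then obtain M' where M': "dominating_matching (del E W \<union> L) M'"
      "6 * card M' + card (del E W \<union> L) \<le> 4 * card (V - W)"
    unfolding meets_bound_def by blast
  have "card (del E W \<union> L) = card (del E W) + card L"
    using L(2) finL finite_subset[OF del_subset finE] del_subset[of E W]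
    by (intro card_Un_disjoint) auto
  then have M'2: "6 * card M' + card (del E W) + card L \<le> 4 * card V - 4 * card W"
    using M'(2) cW by auto
  obtain M where M: "dominating_matching E M" "card M \<le> card M' + k"
    using extend_matching[OF sg M'(1) L(2) finL ext] by blast
  have "card E + card F \<le> card (del E W) + (\<Sum>s\<in>S. card (N s))"
    by (rule edges_at_count[OF sg S(1) S(2) _ F]) (use S(1) finW finite_subset in auto)
  then have "6 * card M + card E \<le> 4 * card V"
    using M'2 M(2) count cW by linarith
  then show False using M(1) not_meets_bound unfolding meets_bound_def by blast
qed

lemma cubic_free_del: "cubic_free (del E W)"
  by (rule cubic_free_mono[OF sg sc cf del_subset])

lemma sum_card_N:
  assumes "finite S" "T \<subseteq> S" "\<And>t. t \<in> T \<Longrightarrow> card (N t) \<le> 2"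
  shows "(\<Sum>s\<in>S. card (N s)) + card T \<le> 3 * card S"
proof -
  have "(\<Sum>s\<in>S. card (N s) + (if s \<in> T then 1 else 0)) \<le> (\<Sum>s\<in>S. 3)"
    using assms(3) N_le3 by (intro sum_mono) (auto simp: le_Suc_eq numeral_3_eq_3 numeral_2_eq_2)
  then show ?thesis using assms(1,2)
    by (simp add: sum.distrib sum.If_cases Int_absorb1)
qed

lemma edge_meets:
  assumes "e \<in> E" "e \<inter> W \<noteq> {}" "\<And>w. w \<in> W \<Longrightarrow> w \<in> S \<or> N w \<subseteq> S"
  shows "e \<inter> S \<noteq> {}"
proof -
  from assms(2) obtain w where w: "w \<in> e" "w \<in> W" by auto
  from sg assms(1) obtain u v where "e = {u, v}" "v \<in> N u" by (rule sgraph_edge_cases)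
  then show ?thesis using w assms(3)[of w] N_sym by auto
qed

text \<open>The set \<open>ends ps \<union> set is\<close> is removed: the pairs \<open>ps\<close> are matched and \<open>is\<close> stays unmatched. The
  lists \<open>fs\<close> (edges inside \<open>ends ps\<close>) and \<open>ts\<close> (vertices of \<open>ends ps\<close> of degree at most 2) bound
  the number of removed edges.\<close>

lemma direct:
  assumes dist: "distinct (map fst ps @ map snd ps @ is)"
    and ps: "\<forall>(u, v)\<in>set ps. v \<in> N u"
    and isN: "\<forall>i\<in>set is. i \<in> V \<and> N i \<subseteq> ends ps"
    and fs: "distinct (map (\<lambda>(u, v). {u, v}) fs)" "\<forall>(u, v)\<in>set fs. v \<in> N u \<and> u \<in> ends ps \<and> v \<in> ends ps"
    and ts: "distinct ts" "\<forall>t\<in>set ts. t \<in> ends ps \<and> card (N t) \<le> 2"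
    and ne: "ps \<noteq> [] \<or> is \<noteq> []"
    and count: "4 * length ps \<le> 4 * length is + length fs + length ts"
  shows False
proof -
  let ?S = "ends ps" and ?W = "ends ps \<union> set is"
  have cS: "card ?S = 2 * length ps" using dist by (subst distinct_card) auto
  have cW: "card ?W = 2 * length ps + length is"
  proof -
    have "?W = set (map fst ps @ map snd ps @ is)" by auto
    then show ?thesis using distinct_card[OF dist] by simp
  qed
  have WS: "w \<in> ?S \<or> N w \<subseteq> ?S" if "w \<in> ?W" for w using that isN by auto
  have subE: "edges ps \<subseteq> E" by (rule edges_subset[OF ps])
  have psV: "ends ps \<subseteq> V" using ps N_V by fastforce
  have fsE: "edges fs \<subseteq> E" by (rule edges_subset) (use fs(2) in auto)
  have cF: "card (edges fs) = length fs" using distinct_card[OF fs(1)] by simp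
  have "(\<Sum>s\<in>?S. card (N s)) + card (set ts) \<le> 3 * card ?S"
    by (rule sum_card_N) (use ts in auto)
  then have sum: "(\<Sum>s\<in>?S. card (N s)) + length ts \<le> 6 * length ps"
    using cS ts(1) by (simp add: distinct_card)
  have disj: "disjoint (edges ps)" by (rule disjoint_edges) (use dist in auto)
  show False
  proof (rule reduce[of ?W ?S "edges fs" "{}" "length ps"])
    show "?W \<subseteq> V" using psV isN by auto
    show "?W \<noteq> {}" using ne by auto
    show "\<And>f. f \<in> edges fs \<Longrightarrow> f \<subseteq> ?S" using fs(2) by auto
    show "cubic_free (del E ?W \<union> {})" using cubic_free_del by simp
    show meets: "e \<inter> ?S \<noteq> {}" if "e \<in> E" "e \<inter> ?W \<noteq> {}" for e
      by (rule edge_meets[OF that WS])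
    fix X :: "'a set set" assume X: "X \<subseteq> {}"
    show "\<exists>Y. Y \<subseteq> E \<and> disjoint Y \<and> \<Union>X \<subseteq> \<Union>Y \<and> \<Union>Y \<subseteq> ?W \<union> \<Union>X \<and> card Y \<le> length ps + card X \<and>
        (\<forall>e\<in>E. e \<inter> ?W \<noteq> {} \<longrightarrow> e \<inter> \<Union>Y \<noteq> {})"
    proof (intro exI[of _ "edges ps"] conjI ballI impI)
      show "\<Union>(edges ps) \<subseteq> ?W \<union> \<Union>X" unfolding Union_edges by blast
      show "e \<inter> \<Union>(edges ps) \<noteq> {}" if "e \<in> E" "e \<inter> ?W \<noteq> {}" for e
        unfolding Union_edges by (rule meets[OF that])
    qed (use X subE disj card_edges_le[of ps] in auto)
  next
    \<comment> \<open>With k pairs and i unmatched vertices, |S| = 2k and |W| = 2k + i. The left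
      side is at most 12k minus the length of \<open>ts\<close>, the right side is 8k + 4i plus the
      length of \<open>fs\<close>; this is where the condition 4k \<le> 4i + ... comes from.\<close>
    show "6 * length ps + (\<Sum>s\<in>?S. card (N s)) \<le> 4 * card ?W + card (edges fs) + card ({} :: 'a set set)"
      using sum count cF cW by simp
  qed (use fsE in \<open>auto simp: nbrs_def\<close>)
qed

text \<open>One edge \<open>pq\<close> is added; \<open>qs\<close> replaces \<open>ps\<close> if the matching of the reduced graph uses \<open>pq\<close>.\<close>

lemma lift1:
  assumes dist: "distinct (map fst ps @ map snd ps @ is)"
    and ps: "\<forall>(u, v)\<in>set ps. v \<in> N u"
    and isN: "\<forall>i\<in>set is. i \<in> V \<and> N i \<subseteq> ends ps"
    and fs: "distinct (map (\<lambda>(u, v). {u, v}) fs)" "\<forall>(u, v)\<in>set fs. v \<in> N u \<and> u \<in> ends ps \<and> v \<in> ends ps"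
    and ts: "distinct ts" "\<forall>t\<in>set ts. t \<in> ends ps \<and> card (N t) \<le> 2"
    and dist2: "distinct (map fst qs @ map snd qs)"
    and qs: "\<forall>(u, v)\<in>set qs. v \<in> N u" "length qs = Suc (length ps)"
    and pq: "{p, q} \<subseteq> ends qs" "ends qs \<subseteq> {p, q} \<union> ends ps \<union> set is"
    and cov: "\<forall>w\<in>ends ps \<union> set is. w \<in> ends qs \<or> N w \<subseteq> ends qs"
    and p: "p \<notin> ends ps \<union> set is" "q \<notin> ends ps \<union> set is" "p \<noteq> q" "q \<notin> N p"
    and s: "s \<in> N p" "s \<in> ends ps \<union> set is" and t: "t \<in> N q" "t \<in> ends ps \<union> set is"
    and cut: "\<And>K. two_cut E K p s q t \<Longrightarrow> K \<inter> (ends ps \<union> set is) = {} \<Longrightarrow> False"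
    and count: "4 * length ps \<le> 4 * length is + length fs + length ts + 1"
  shows False
proof -
  let ?S = "ends ps" and ?W = "ends ps \<union> set is" and ?L = "{{p, q}}"
  have cS: "card ?S = 2 * length ps" using dist by (subst distinct_card) auto
  have cW: "card ?W = 2 * length ps + length is"
  proof -
    have "?W = set (map fst ps @ map snd ps @ is)" by auto
    then show ?thesis using distinct_card[OF dist] by simp
  qed
  have WS: "w \<in> ?S \<or> N w \<subseteq> ?S" if "w \<in> ?W" for w using that isN by auto
  \<comment> \<open>The replacement \<open>qs\<close> need not cover all of \<open>ends ps\<close>,
    but must still meet every edge at the removed set.\<close>
  have WQ: "w \<in> ends qs \<or> N w \<subseteq> ends qs" if "w \<in> ?W" for w using that cov by blast
  have subE: "edges ps \<subseteq> E" by (rule edges_subset[OF ps])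
  have subE2: "edges qs \<subseteq> E" by (rule edges_subset[OF qs(1)])
  have psV: "ends ps \<subseteq> V" using ps N_V by fastforce
  have fsE: "edges fs \<subseteq> E" by (rule edges_subset) (use fs(2) in auto)
  have cF: "card (edges fs) = length fs" using distinct_card[OF fs(1)] by simp
  have "(\<Sum>s\<in>?S. card (N s)) + card (set ts) \<le> 3 * card ?S"
    by (rule sum_card_N) (use ts in auto)
  then have sum: "(\<Sum>s\<in>?S. card (N s)) + length ts \<le> 6 * length ps"
    using cS ts(1) by (simp add: distinct_card)
  have disj: "disjoint (edges ps)" by (rule disjoint_edges) (use dist in auto)
  have disj2: "disjoint (edges qs)" by (rule disjoint_edges[OF dist2])
  have pqV: "p \<in> V" "q \<in> V" using s(1) t(1) N_V by auto
  have nL: "nbrs ?L v = (if v = p then {q} else if v = q then {p} else {})" for v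
    using p(3) nbrs_insert[of p q "{}" v] by (auto simp: nbrs_def)
  show False
  proof (rule reduce[of ?W ?S "edges fs" ?L "length ps"])
    show "?W \<subseteq> V" using psV isN by auto
    show "?W \<noteq> {}" using s(2) by auto
    show "\<And>f. f \<in> edges fs \<Longrightarrow> f \<subseteq> ?S" using fs(2) by auto
    show "cubic_free (del E ?W \<union> ?L)"
    proof (rule ccontr)
      assume "\<not> cubic_free (del E ?W \<union> ?L)"
      then obtain K where K: "K \<noteq> {}" "\<forall>v\<in>K. card (nbrs (insert {p, q} (del E ?W)) v \<inter> K) = 3"
        by (auto simp: cubic_free_def)
      show False
        by (rule cut; rule two_cut_if_cubic[OF sg sc cubic_free_del K p(3,1,2) s t])
    qed
    show meets: "e \<inter> ?S \<noteq> {}" if "e \<in> E" "e \<inter> ?W \<noteq> {}" for e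
      by (rule edge_meets[OF that WS])
    show "card (nbrs ?L v) \<le> card (N v \<inter> ?W)" if "v \<notin> ?W" for v
    proof -
      have "card (N v \<inter> ?W) \<ge> 1" if "w \<in> N v" "w \<in> ?W" for w
        using that by (metis Int_iff One_nat_def Suc_leI card_gt_0_iff empty_iff finN finite_Int)
      then show ?thesis using s t unfolding nL by auto
    qed
    fix X :: "'a set set" assume X: "X \<subseteq> ?L"
    show "\<exists>Y. Y \<subseteq> E \<and> disjoint Y \<and> \<Union>X \<subseteq> \<Union>Y \<and> \<Union>Y \<subseteq> ?W \<union> \<Union>X \<and> card Y \<le> length ps + card X \<and>
        (\<forall>e\<in>E. e \<inter> ?W \<noteq> {} \<longrightarrow> e \<inter> \<Union>Y \<noteq> {})"
    proof (cases "X = {}")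
      case True
      show ?thesis
      proof (intro exI[of _ "edges ps"] conjI ballI impI)
        show "\<Union>(edges ps) \<subseteq> ?W \<union> \<Union>X" unfolding Union_edges by blast
        show "e \<inter> \<Union>(edges ps) \<noteq> {}" if "e \<in> E" "e \<inter> ?W \<noteq> {}" for e
          unfolding Union_edges by (rule meets[OF that])
      qed (use True subE disj card_edges_le[of ps] in auto)
    next
      case False
      then have X: "X = ?L" using X by auto
      show ?thesis
      proof (intro exI[of _ "edges qs"] conjI ballI impI)
        show "\<Union>(edges qs) \<subseteq> ?W \<union> \<Union>X" "\<Union>X \<subseteq> \<Union>(edges qs)"
          unfolding Union_edges X using pq by auto
        show "e \<inter> \<Union>(edges qs) \<noteq> {}" if "e \<in> E" "e \<inter> ?W \<noteq> {}" for e
          unfolding Union_edges by (rule edge_meets[OF that WQ])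
        show "card (edges qs) \<le> length ps + card X"
          using card_edges_le[of qs] qs(2) X by simp
      qed (use subE2 disj2 in auto)
    qed
  next
    show "6 * length ps + (\<Sum>s\<in>?S. card (N s)) \<le> 4 * card ?W + card (edges fs) + card ?L"
      using sum count cF cW by simp
  next
    show "f \<subseteq> V - ?W \<and> card f = 2" if "f \<in> ?L" for f
      using that p pqV by auto
    show "?L \<inter> E = {}" using p(4) by (auto simp: nbrs_def)
  qed (use fsE in auto)
qed

text \<open>The added edges close the paths \<open>p a a' q\<close> and \<open>r b b' s\<close>. Of
  the 8 units required, \<open>x\<close> gives 4, the two matching edges 2 and the two added edges
  2, so nothing is to spare.\<close>

lemma lift2:
  assumes d: "distinct [x, a, a', b, b']" and Nx: "N x = {a, b}" and ab: "a' \<in> N a" "b' \<in> N b"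
    and p: "p \<in> N a" "p \<notin> {x, a, a', b, b'}" and q: "q \<in> N a'" "q \<notin> {x, a, a', b, b'}"
    and r: "r \<in> N b" "r \<notin> {x, a, a', b, b'}" and s: "s \<in> N b'" "s \<notin> {x, a, a', b, b'}"
    and pq: "p \<noteq> q" "q \<notin> N p" and rs: "r \<noteq> s" "s \<notin> N r" and ne: "{p, q} \<noteq> {r, s}"
    and free: "cubic_free (del E {x, a, a', b, b'} \<union> {{p, q}, {r, s}})"
  shows False
proof -
  let ?W = "{x, a, a', b, b'}" and ?S = "{a, a', b, b'}" and ?L = "{{p, q}, {r, s}}"
  have V: "x \<in> V" "a \<in> V" "a' \<in> V" "b \<in> V" "b' \<in> V" "p \<in> V" "q \<in> V" "r \<in> V" "s \<in> V"
    using Nx ab p q r s N_V N_V(2)[of a x] by auto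
  have E: "{a, a'} \<in> E" "{b, b'} \<in> E" "{p, a} \<in> E" "{q, a'} \<in> E" "{r, b} \<in> E" "{s, b'} \<in> E"
    using ab p q r s by (auto simp: nbrs_def insert_commute)
  have meets: "e \<inter> ?S \<noteq> {}" if "e \<in> E" "e \<inter> ?W \<noteq> {}" for e
    by (rule edge_meets[OF that]) (use Nx in auto)
  show False
  proof (rule reduce[of ?W ?S "{{a, a'}, {b, b'}}" ?L 2])
    show "card (nbrs ?L v) \<le> card (N v \<inter> ?W)" if "v \<notin> ?W" for v
    proof -
      let ?T = "{w. (v, w) \<in> {(p, a), (q, a'), (r, b), (s, b')}}"
      have "card (nbrs ?L v) \<le> card ?T" by (rule added_degree) (use d in auto)
      also have "\<dots> \<le> card (N v \<inter> ?W)"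
        by (rule card_mono) (use p(1) q(1) r(1) s(1) N_sym in auto)
      finally show ?thesis .
    qed
    fix X :: "'a set set" assume X: "X \<subseteq> ?L" "disjoint X"
    have Y: "\<exists>Y. Y \<subseteq> E \<and> disjoint Y \<and> \<Union>X \<subseteq> \<Union>Y \<and> \<Union>Y \<subseteq> ?W \<union> \<Union>X \<and> card Y \<le> 2 + card X \<and>
        (\<forall>e\<in>E. e \<inter> ?W \<noteq> {} \<longrightarrow> e \<inter> \<Union>Y \<noteq> {})"
      if qs: "distinct (map fst qs @ map snd qs)" "\<forall>(u, v)\<in>set qs. v \<in> N u" "\<Union>X \<subseteq> ends qs"
        "ends qs \<subseteq> ?W \<union> \<Union>X" "?S \<subseteq> ends qs" "length qs \<le> 2 + card X" for qs
    proof (intro exI[of _ "edges qs"] conjI ballI impI)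
      show "edges qs \<subseteq> E" by (rule edges_subset[OF qs(2)])
      show "disjoint (edges qs)" by (rule disjoint_edges[OF qs(1)])
      show "\<Union>X \<subseteq> \<Union>(edges qs)" "\<Union>(edges qs) \<subseteq> ?W \<union> \<Union>X" unfolding Union_edges by (rule qs)+
      show "card (edges qs) \<le> 2 + card X" using card_edges_le[of qs] qs(6) by linarith
      show "e \<inter> \<Union>(edges qs) \<noteq> {}" if "e \<in> E" "e \<inter> ?W \<noteq> {}" for e
        unfolding Union_edges using meets[OF that] qs(5) by blast
    qed
    consider "X = {}" | "X = {{p, q}}" | "X = {{r, s}}" | "X = ?L" using X(1) by blast
    then show "\<exists>Y. Y \<subseteq> E \<and> disjoint Y \<and> \<Union>X \<subseteq> \<Union>Y \<and> \<Union>Y \<subseteq> ?W \<union> \<Union>X \<and> card Y \<le> 2 + card X \<and>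
        (\<forall>e\<in>E. e \<inter> ?W \<noteq> {} \<longrightarrow> e \<inter> \<Union>Y \<noteq> {})"
    proof cases
      case 1
      then show ?thesis using d ab by (intro Y[of "[(a, a'), (b, b')]"]) auto
    next
      case 2
      then show ?thesis using d ab p q pq by (intro Y[of "[(a, p), (a', q), (b, b')]"]) auto
    next
      case 3
      then show ?thesis using d ab r s rs by (intro Y[of "[(b, r), (b', s), (a, a')]"]) auto
    next
      case 4
      \<comment> \<open>The added edges may share an end, but not when one matching contains both;
        hence the four pairs below are disjoint.\<close>
      have "{p, q} \<inter> {r, s} = {}" using X(2) ne unfolding 4 by (auto simp: pairwise_insert disjnt_def)
      then have "p \<noteq> r" "p \<noteq> s" "q \<noteq> r" "q \<noteq> s" by auto
      then show ?thesis using 4 d p q pq r s rs ne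
        by (intro Y[of "[(a, p), (a', q), (b, r), (b', s)]"]) auto
    qed
  next
    have "card ?S = 4" "card ?W = 5" "card {{a, a'}, {b, b'}} = 2" "card ?L = 2"
      using d ne by (auto simp: doubleton_eq_iff)
    moreover have "(\<Sum>s\<in>?S. card (N s)) + card ({} :: 'a set) \<le> 3 * card ?S"
      by (rule sum_card_N) auto
    ultimately show "6 * 2 + (\<Sum>s\<in>?S. card (N s)) \<le> 4 * card ?W + card {{a, a'}, {b, b'}} + card ?L"
      by linarith
  next
    show "f \<subseteq> V - ?W \<and> card f = 2" if "f \<in> ?L" for f
      using that p q r s pq rs V by auto
    show "?L \<inter> E = {}" using pq rs by (auto simp: nbrs_def)
  qed (use V E meets free in auto)
qed

end

section \<open>Degrees, bridges and two-edge cuts\<close>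

lemma two_cutD: "two_cut E K p s q t \<Longrightarrow> v \<in> K \<Longrightarrow> w \<in> nbrs E v \<Longrightarrow>
    w \<in> K \<or> v = p \<and> w = s \<or> v = q \<and> w = t"
  by (simp add: two_cut_def)

lemma card3_obtain: "card A = 3 \<Longrightarrow> p \<in> A \<Longrightarrow> \<exists>q r. A = {p, q, r} \<and> q \<noteq> p \<and> r \<noteq> p \<and> q \<noteq> r"
  by (auto simp: card_3_iff insert_commute)

lemma card3_obtain2: "card A = 3 \<Longrightarrow> p \<in> A \<Longrightarrow> q \<in> A \<Longrightarrow> p \<noteq> q \<Longrightarrow> \<exists>r. A = {p, q, r} \<and> r \<noteq> p \<and> r \<noteq> q"
  by (auto simp: card_3_iff insert_commute)

context min_counterexample
begin

lemma min_degree: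
  assumes "x \<in> V" shows "card (N x) = 2 \<or> card (N x) = 3"
proof -
  have "N x \<noteq> {}"
  proof
    assume "N x = {}"
    then show False by (intro direct[of "[]" "[x]" "[]" "[]"]) (use assms in auto)
  qed
  moreover have "card (N x) \<noteq> 1"
  proof
    assume "card (N x) = 1"
    then obtain a where a: "N x = {a}" by (auto simp: card_1_singleton_iff)
    have xa: "x \<in> N a" "x \<noteq> a" "a \<in> V" using a N_sym[of a x] N_V[of a x] by auto
    show False
    proof (cases "N a = {x}")
      case False
      then obtain b where b: "b \<in> N a" "b \<noteq> x" using xa(1) by blast
      then have "a \<noteq> b" by auto
      then show False
        by (intro direct[of "[(a, b)]" "[x]" "[]" "[]"]) (use a b xa assms in auto)
    next
      case True
      have E: "{x, a} \<in> E" using xa by (simp add: nbrs_def insert_commute)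
      show False
      \<comment> \<open>For a component consisting of one edge \<open>direct\<close> is too weak,
        because it credits only one unit for a vertex of degree at most 2. The exact degree sum
        gives 6 + 2 \<le> 8 + 1.\<close>
      proof (rule reduce[of "{x, a}" "{x, a}" "{{x, a}}" "{}" 1])
        fix X :: "'a set set" assume "X \<subseteq> {}"
        then show "\<exists>Y. Y \<subseteq> E \<and> disjoint Y \<and> \<Union>X \<subseteq> \<Union>Y \<and> \<Union>Y \<subseteq> {x, a} \<union> \<Union>X \<and> card Y \<le> 1 + card X \<and>
            (\<forall>e\<in>E. e \<inter> {x, a} \<noteq> {} \<longrightarrow> e \<inter> \<Union>Y \<noteq> {})"
          using E by (intro exI[of _ "{{x, a}}"]) auto
      qed (use assms xa a True E cubic_free_del in \<open>auto simp: nbrs_def\<close>)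
    qed
  qed
  moreover have "card (N x) \<le> 3" by (rule N_le3)
  ultimately have "card (N x) \<noteq> 0" "card (N x) \<noteq> 1" "card (N x) \<le> 3" by auto
  then show ?thesis by linarith
qed

lemma second_nbr:
  assumes "a \<in> N x" obtains b where "b \<in> N x" "b \<noteq> a"
proof -
  have "card (N x) \<noteq> card {a}" using min_degree[of x] N_V(2)[OF assms] by auto
  then have "N x \<noteq> {a}" by metis
  then show ?thesis using that assms by blast
qed

lemma third_nbr:
  assumes "p \<in> N v" "q \<in> N v" "p \<noteq> q"
  obtains "N v = {p, q}" "card (N v) = 2" | r where "N v = {p, q, r}" "r \<noteq> p" "r \<noteq> q" "r \<noteq> v" "card (N v) = 3"
proof -
  from min_degree[of v] N_V(2)[OF assms(1)] consider "card (N v) = 2" | "card (N v) = 3" by auto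
  then show ?thesis
  proof cases
    case 1
    then have "N v = {p, q}" using assms by (auto simp: card_2_iff)
    then show ?thesis using 1 that by auto
  next
    case 2
    then obtain r where r: "N v = {p, q, r}" "r \<noteq> p" "r \<noteq> q" using card3_obtain2[OF 2 assms] by auto
    moreover have "r \<noteq> v" using r N_irrefl[of v] by auto
    ultimately show ?thesis using 2 that by auto
  qed
qed

lemma third_nbr_ex:
  assumes "card (N v) \<noteq> 2" "p \<in> N v" "q \<in> N v" "p \<noteq> q"
  shows "\<exists>r. N v = {p, q, r} \<and> r \<noteq> p \<and> r \<noteq> q \<and> r \<noteq> v"
  using assms(2-4) by (cases rule: third_nbr) (use assms(1) in auto)

lemma three_nbrs:
  assumes "p \<in> N v" "q \<in> N v" "r \<in> N v" "p \<noteq> q" "p \<noteq> r" "q \<noteq> r"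
  shows "N v = {p, q, r}"
  using assms(1,2,4) by (cases rule: third_nbr) (use assms in auto)

lemma no_bridge:
  assumes "u \<in> X" "v \<notin> X" "v \<in> N u"
    and cross: "\<And>p q. p \<in> X \<Longrightarrow> q \<in> N p \<Longrightarrow> q \<in> X \<or> p = u \<and> q = v"
  shows False
proof -
  obtain u' where u': "u' \<in> N u" "u' \<noteq> v" using second_nbr[OF assms(3)] .
  obtain v' where v': "v' \<in> N v" "v' \<noteq> u" using second_nbr[OF N_sym[OF assms(3)]] .
  have ok: "meets_bound Y (ind E Y)" if "Y \<subset> V" for Y
  proof (rule IH)
    show "sgraph Y (ind E Y)" by (rule sgraph_ind[OF sg]) (use that in auto)
    show "subcubic (ind E Y)" by (rule subcubic_mono[OF sg sc ind_subset])
    show "cubic_free (ind E Y)" by (rule cubic_free_mono[OF sg sc cf ind_subset])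
    show "card Y < card V" by (rule psubset_card_mono[OF finV that])
  qed
  have "meets_bound V E"
  proof (rule meets_bound_if_bridge[OF sg sc, of "X \<inter> V" u v u' v'])
    show "q \<in> X \<inter> V \<or> p = u \<and> q = v" if "p \<in> X \<inter> V" "q \<in> N p" for p q
      using cross[of p q] that N_V(1)[of q p] by auto
    show "meets_bound Y (ind E Y)" if "Y \<subset> V" for Y by (rule ok[OF that])
  qed (use assms(1-3) u' v' N_V[OF assms(3)] in auto)
  then show False using not_meets_bound by contradiction
qed

text \<open>Both sets have \<open>ps\<close> as a boundary edge. The other boundary edge of each
  starts outside the intersection, which is therefore left through \<open>ps\<close> alone, a
  bridge.\<close>

lemma two_cuts:
  assumes K: "two_cut E K p s q t" and K': "two_cut E K' p s q' t'" and q: "q \<notin> K'" "q' \<notin> K"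
  shows False
proof (rule no_bridge[of p "K \<inter> K'" s])
  show "w \<in> K \<inter> K' \<or> v = p \<and> w = s" if "v \<in> K \<inter> K'" "w \<in> N v" for v w
  proof -
    have v: "v \<in> K" "v \<in> K'" using that by auto
    have "w \<in> K \<or> v = p \<and> w = s \<or> v = q \<and> w = t" "w \<in> K' \<or> v = p \<and> w = s \<or> v = q' \<and> w = t'"
      by (rule two_cutD[OF K v(1) that(2)], rule two_cutD[OF K' v(2) that(2)])
    then show ?thesis using that q by auto
  qed
qed (use K K' in \<open>auto simp: two_cut_def\<close>)

text \<open>Of the two candidates \<open>q\<close> and \<open>r\<close> at \<open>t\<close> at least
  one works: a cut that blocks \<open>q\<close> makes \<open>r\<close> admissible, and a cut that
  blocks \<open>r\<close> as well would yield a bridge by \<open>two_cuts\<close>.\<close>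

lemma lift_choice:
  assumes t: "N t = {s, q, r}" "q \<noteq> r" "s \<noteq> q" "s \<noteq> r" and q: "q \<noteq> p" "q \<notin> N p"
  obtains q' r' where "{q', r'} = {q, r}" "q' \<noteq> p" "q' \<notin> N p" "\<And>K. \<not> two_cut E K p s q' t"
proof (cases "\<exists>K. two_cut E K p s q t")
  case False
  then show ?thesis using that[of q r] q by auto
next
  case True
  then obtain K where K: "two_cut E K p s q t" ..
  have st: "s \<noteq> t" "q \<noteq> t" "r \<noteq> t" "t \<in> N r" "t \<in> N q" using t N_irrefl[of t] N_sym[of r t] N_sym[of q t] by auto
  note r = two_cut_avoids[OF K st(4), of]
  have r': "r \<notin> K" "r \<noteq> p" "r \<notin> N p" using r t st by auto
  moreover have "\<not> two_cut E K' p s r t" for K'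
  proof
    assume K': "two_cut E K' p s r t"
    have "q \<notin> K'" using two_cut_avoids(1)[OF K' st(5)] t st by auto
    then show False using two_cuts[OF K K'] r'(1) by auto
  qed
  ultimately show ?thesis using that[of r q] by auto
qed

lemma ex_degree2: "\<exists>x\<in>V. card (N x) = 2"
proof -
  have "V \<noteq> {}"
  proof
    assume "V = {}"
    then have "E = {}" using sg by (fastforce simp: sgraph_def)
    then have "meets_bound V E" unfolding meets_bound_def dominating_matching_def by (intro exI[of _ "{}"]) auto
    then show False using not_meets_bound by contradiction
  qed
  then obtain v where v: "v \<in> V" "card (N v \<inter> V) \<noteq> 3" using cf by (auto simp: cubic_free_def)
  have "N v \<inter> V = N v" using N_V by auto
  then show ?thesis using v min_degree[of v] by auto
qed

lemma no_triangle:
  assumes x: "N x = {a, b}" "a \<noteq> b"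
  shows "b \<notin> N a"
proof
  assume b: "b \<in> N a"
  show False
    by (rule direct[of "[(a, b)]" "[x]" "[]" "[]"]) (use x b N_V(2)[of a x] N_irrefl[of x] in auto)
qed

end

section \<open>Short cycles through a vertex of degree two\<close>

context min_counterexample
begin

text \<open>On the four-cycle \<open>x a y b\<close>, the matching \<open>ay\<close>,
  \<open>bb'\<close> with \<open>x\<close> left free collects 4 + 3 of the 8 units required. Hence
  one vertex of degree 2, one further edge or one added edge finishes the proof, also for the
  variant \<open>by\<close>, \<open>aa'\<close>. What survives is rigid: the third neighbour
  \<open>g\<close> of \<open>y\<close> is adjacent to both \<open>a'\<close> and
  \<open>b'\<close>.\<close>

lemma common_nbr1:
  assumes x: "N x = {a, b}" "a \<noteq> b" and y: "y \<in> N a" "y \<noteq> x" and b: "N b = {x, y, b'}" "b' \<noteq> x" "b' \<noteq> y"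
  shows False
proof -
  have xV: "x \<in> V" using x N_V(2)[of a x] by auto
  have ba: "b \<notin> N a" by (rule no_triangle[OF x])
  have xN: "x \<in> N a" using x N_sym[of a x] by auto
  have yb: "b \<in> N y" "b \<in> N b'" "a \<in> N y" using b y N_sym[of y b] N_sym[of b' b] N_sym[of y a] by auto
  have ne: "x \<noteq> a" "x \<noteq> b" "y \<noteq> a" "y \<noteq> b" "b' \<noteq> b" "b' \<noteq> a"
    using x y b yb ba N_irrefl[of x] N_irrefl[of y] N_irrefl[of b] N_sym[of a b] by auto
  have "card (N a) \<noteq> 2"
  proof
    assume "card (N a) = 2"
    then show False
      by (intro direct[of "[(a, y), (b, b')]" "[x]" "[(a, y), (b, y), (b, b')]" "[a]"])
        (use x y b ne xV in \<open>auto simp: doubleton_eq_iff\<close>)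
  qed
  then obtain a' where a': "N a = {x, y, a'}" "a' \<noteq> x" "a' \<noteq> y" "a' \<noteq> a"
    using third_nbr_ex[OF _ xN y(1)] y by blast
  have "card (N y) \<noteq> 2"
  proof
    assume "card (N y) = 2"
    then show False
      by (intro direct[of "[(a, y), (b, b')]" "[x]" "[(a, y), (b, y), (b, b')]" "[y]"])
        (use x y b ne xV in \<open>auto simp: doubleton_eq_iff\<close>)
  qed
  then obtain g where g: "N y = {a, b, g}" "g \<noteq> a" "g \<noteq> b" "g \<noteq> y"
    using third_nbr_ex[OF _ yb(3,1)] x by blast
  have a'b: "a' \<noteq> b" using a' ba by auto
  have gx: "g \<noteq> x" using g x ne N_sym[of g y] by auto
  have "card (N b') \<noteq> 2"
  proof
    assume "card (N b') = 2"
    then show False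
      by (intro direct[of "[(a, y), (b, b')]" "[x]" "[(a, y), (b, y), (b, b')]" "[b']"])
        (use x y b ne xV in \<open>auto simp: doubleton_eq_iff\<close>)
  qed
  moreover have a'b': "a' \<noteq> b'"
  proof
    assume "a' = b'"
    then show False
      by (intro direct[of "[(a, y), (b, b')]" "[x]" "[(a, y), (b, y), (b, b'), (a, b')]" "[]"])
        (use x y b ne xV a' in \<open>auto simp: doubleton_eq_iff\<close>)
  qed
  moreover have gb': "g \<noteq> b'"
  proof
    assume "g = b'"
    then show False
      by (intro direct[of "[(a, y), (b, b')]" "[x]" "[(a, y), (b, y), (b, b'), (y, b')]" "[]"])
        (use x y b ne xV a' g in \<open>auto simp: doubleton_eq_iff\<close>)
  qed
  moreover have ga': "g \<noteq> a'"
  proof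
    assume "g = a'"
    then show False
      by (intro direct[of "[(b, y), (a, a')]" "[x]" "[(a, y), (b, y), (a, a'), (y, a')]" "[]"])
        (use x y b ne xV a' g a'b in \<open>auto simp: doubleton_eq_iff\<close>)
  qed
  moreover have "card (N a') \<noteq> 2"
  proof
    assume "card (N a') = 2"
    then show False
      by (intro direct[of "[(b, y), (a, a')]" "[x]" "[(a, y), (b, y), (a, a')]" "[a']"])
        (use x y b ne xV a' g a'b in \<open>auto simp: doubleton_eq_iff\<close>)
  qed
  moreover have ga: "g \<in> N a'"
  proof (rule ccontr)
    assume n: "g \<notin> N a'"
    show False
    proof (rule lift1[of "[(a, y), (b, b')]" "[x]" "[(a, y), (b, y), (b, b')]" "[]" "[(a, a'), (y, g), (b, b')]" a' g a y])
      fix K assume K: "two_cut E K a' a g y" "K \<inter> (ends [(a, y), (b, b')] \<union> set [x]) = {}"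
      show False
      \<comment> \<open>Both boundary edges of \<open>K\<close> lead into the four-cycle, so their
        union is left only through \<open>bb'\<close>.\<close>
      proof (rule no_bridge[of b "K \<union> {x, a, b, y}" b'])
        show "w \<in> K \<union> {x, a, b, y} \<or> v = b \<and> w = b'" if "v \<in> K \<union> {x, a, b, y}" "w \<in> N v" for v w
          using that K(1) x a' b g unfolding two_cut_def by auto
      qed (use K b ne in auto)
    qed (use x y b ne xV a' g a'b a'b' gb' ga' gx n N_sym[of a' a] N_sym[of g y] in \<open>auto simp: doubleton_eq_iff\<close>)
  qed
  moreover have gb: "g \<in> N b'"
  proof (rule ccontr)
    assume n: "g \<notin> N b'"
    show False
    proof (rule lift1[of "[(b, y), (a, a')]" "[x]" "[(b, y), (a, y), (a, a')]" "[]" "[(b, b'), (y, g), (a, a')]" b' g b y])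
      fix K assume K: "two_cut E K b' b g y" "K \<inter> (ends [(b, y), (a, a')] \<union> set [x]) = {}"
      show False
      proof (rule no_bridge[of a "K \<union> {x, a, b, y}" a'])
        show "w \<in> K \<union> {x, a, b, y} \<or> v = a \<and> w = a'" if "v \<in> K \<union> {x, a, b, y}" "w \<in> N v" for v w
          using that K(1) x a' b g unfolding two_cut_def by auto
      qed (use K a' a'b ne in auto)
    qed (use x y b ne xV a' g a'b a'b' gb' ga' gx n yb N_sym[of g y] in \<open>auto simp: doubleton_eq_iff\<close>)
  qed
  ultimately obtain c d where c: "N a' = {a, g, c}" "c \<noteq> a" "c \<noteq> g" "c \<noteq> a'" and d: "N b' = {b, g, d}" "d \<noteq> b" "d \<noteq> g" "d \<noteq> b'"
    using third_nbr_ex[of a' a g] third_nbr_ex[of b' b g] g(2,3) yb(2) N_sym[of a' a] a'(1) by auto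
  have Ng: "N g = {y, a', b'}"
  proof -
    have "y \<in> N g" "a' \<in> N g" "b' \<in> N g" using g c d ga gb N_sym[of g y] N_sym[of g a'] N_sym[of g b'] by auto
    then show ?thesis by (rule three_nbrs) (use a' a'b' b in auto)
  qed
  have nab: "c \<noteq> b'" "d \<noteq> a'"
  proof -
    have "b' \<notin> N a'"
    proof
      assume "b' \<in> N a'"
      then show False
        by (intro direct[of "[(a, y), (b, b'), (a', g)]" "[x]"
              "[(a, y), (b, y), (b, b'), (a', g), (a, a'), (y, g), (b', g), (a', b')]" "[]"])
          (use x y b ne xV a' g a'b a'b' gb' ga' gx c d in \<open>auto simp: doubleton_eq_iff\<close>)
    qed
    then show "c \<noteq> b'" "d \<noteq> a'" using c d N_sym[of a' b'] by auto
  qed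
  have cn: "a' \<in> N c" "b' \<in> N d" using c d N_sym[of c a'] N_sym[of d b'] by auto
  have cd: "c \<noteq> x" "c \<noteq> b" "c \<noteq> y" "d \<noteq> x" "d \<noteq> a" "d \<noteq> y"
    using cn x b a' g a'b a'b' ne gb' ga' by auto
  show False
  proof (cases "c = d")
    case True
    from cn True have "a' \<in> N c" "b' \<in> N c" by auto
    then show False using a'b'
    proof (cases rule: third_nbr)
      case 1
      then show False
        by (intro direct[of "[(a, y), (b, b'), (a', g)]" "[x, c]"
              "[(a, y), (b, y), (b, b'), (a', g)]" "[]"])
          (use x y b ne xV a' g a'b a'b' gb' ga' gx c d cd nab N_V[of c a'] True in \<open>auto simp: doubleton_eq_iff\<close>)
    next
      case (2 h)
      have "c \<in> N h" using 2 N_sym[of h c] by auto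
      then have h: "h \<noteq> v" if "c \<notin> N v" for v using that by auto
      have "c \<notin> N x" "c \<notin> N a" "c \<notin> N b" "c \<notin> N y" "c \<notin> N g"
        using cd c nab d(2,3) True by (simp_all add: x(1) a'(1) b(1) g(1) Ng)
      then have "h \<notin> {x, a, b, y, a', b', g, c}" using 2 h by auto
      moreover have "q \<in> {x, a, b, y, a', b', g, c} \<or> p = c \<and> q = h"
        if "p \<in> {x, a, b, y, a', b', g, c}" "q \<in> N p" for p q
        using that by (elim insertE emptyE) (auto simp: x(1) a'(1) b(1) g(1) Ng c(1) d(1) 2(1) True[symmetric])
      ultimately show False
        using 2(1) by (intro no_bridge[of c "{x, a, b, y, a', b', g, c}" h]) auto
    qed
  next
    case False
    show False
    \<comment> \<open>Both added edges start at \<open>y\<close>, which can take two because it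
      loses \<open>a\<close> and \<open>b\<close>; they close the paths \<open>y a a' c\<close> and
      \<open>y b b' d\<close>.\<close>
    proof (rule lift2[of x a a' b b' y c y d])
      show "cubic_free (del E {x, a, a', b, b'} \<union> {{y, c}, {y, d}})" (is "cubic_free ?F")
        unfolding cubic_free_def
      proof (intro allI impI, rule ccontr)
        fix K :: "'a set" assume K: "K \<noteq> {}" "\<not> (\<exists>v\<in>K. card (nbrs ?F v \<inter> K) \<noteq> 3)"
        have nF: "nbrs ?F v = nbrs (del E {x, a, a', b, b'}) v \<union> {w. {v, w} = {y, c} \<or> {v, w} = {y, d}}" for v
          by (auto simp: nbrs_def)
        show False
        proof (cases "y \<in> K")
          case True
          have "nbrs ?F y = {g, c, d}"
            using g ne gx gb' ga' cd a' b y unfolding nF by (auto simp: nbrs_del doubleton_eq_iff)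
          moreover have "card {g, c, d} \<le> 3" by (simp add: card_insert_if)
          ultimately have "{g, c, d} \<inter> K = {g, c, d}"
            using K(2) True by (intro card_seteq) auto
          then have "g \<in> K" by auto
          \<comment> \<open>A cubic set through \<open>y\<close> must contain \<open>g\<close>, but
            \<open>g\<close> has lost \<open>a'\<close> and \<open>b'\<close> and now has degree
            1.\<close>
          have "nbrs ?F g = {y}"
            using g Ng ne gx gb' ga' cd c d a' b y unfolding nF by (auto simp: nbrs_del doubleton_eq_iff)
          then have "card (nbrs ?F g \<inter> K) \<le> card {y}" by (intro card_mono) auto
          then show False using K(2) \<open>g \<in> K\<close> by auto
        next
          case nK: False
          have "nbrs ?F v \<inter> K = nbrs (del E {x, a, a', b, b'}) v \<inter> K" if "v \<in> K" for v
            using that nK unfolding nF by (auto simp: doubleton_eq_iff)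
          then show False using K cubic_free_del[of "{x, a, a', b, b'}"] by (auto simp: cubic_free_def)
        qed
      qed
    qed (use x y b ne xV a' g a'b a'b' gb' ga' gx c d cd nab False in \<open>auto simp: doubleton_eq_iff\<close>)
  qed
qed

lemma common_nbr:
  assumes x: "N x = {a, b}" "a \<noteq> b" and y: "y \<in> N a" "y \<in> N b" "y \<noteq> x"
  shows False
proof -
  have xN: "x \<in> N a" "x \<in> N b" "x \<in> V" using x N_sym[of a x] N_sym[of b x] N_V(2)[of a x] by auto
  have ba: "b \<notin> N a" by (rule no_triangle[OF x])
  have yN: "a \<in> N y" "b \<in> N y" using y N_sym by auto
  from xN(2) y(2) y(3)[symmetric] show False
  proof (cases rule: third_nbr)
    case (2 b')
    then show False using common_nbr1[OF x y(1,3)] by auto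
  next
    case b: 1
    from xN(1) y(1) y(3)[symmetric] show False
    proof (cases rule: third_nbr)
      case (2 a')
      have "N x = {b, a}" using x by auto
      then show False using common_nbr1[of x b a y a'] x y 2 by auto
    next
      case a: 1
      have ne: "x \<noteq> a" "x \<noteq> b" "y \<noteq> a" "y \<noteq> b" using x y N_irrefl by auto
      from yN x(2) show False
      proof (cases rule: third_nbr)
        case 1
        \<comment> \<open>An isolated four-cycle is an extremal case: 8 units are required, and its
          four edges and four vertices of degree 2 supply exactly 8.\<close>
        then show False
          by (intro direct[of "[(a, x), (b, y)]" "[]" "[(a, x), (a, y), (b, x), (b, y)]" "[x, a, b, y]"])
            (use x y ne a b in \<open>auto simp: doubleton_eq_iff\<close>)
      next
        case (2 z)
        then have "z \<noteq> x" using x ne N_sym[of z y] by auto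
        then show False
          by (intro direct[of "[(y, z), (a, x)]" "[b]" "[(y, z), (a, x), (a, y)]" "[x, a]"])
            (use 2 x y ne a b N_V[of b x] in \<open>auto simp: doubleton_eq_iff\<close>)
      qed
    qed
  qed
qed

end

section \<open>Copies of \<open>K\<^bsub>3,3\<^esub>\<close> minus an edge\<close>

text \<open>The simplifier needs both orientations of the disequations.\<close>

primrec apart :: "'a list \<Rightarrow> bool" where
  "apart [] \<longleftrightarrow> True"
| "apart (x # xs) \<longleftrightarrow> (\<forall>y\<in>set xs. x \<noteq> y \<and> y \<noteq> x) \<and> apart xs"

lemma apart: "distinct xs \<Longrightarrow> apart xs"
  by (induction xs) auto

locale degree_two = min_counterexample +
  fixes x a b
  assumes Nx: "N x = {a, b}" and ab: "a \<noteq> b"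
begin

lemma swap: "degree_two V E x b a"
  by unfold_locales (use Nx ab in auto)

lemma basic: "x \<in> V" "x \<in> N a" "x \<in> N b" "a \<notin> N b" "b \<notin> N a" "x \<noteq> a" "x \<noteq> b"
  using Nx ab N_sym[of a x] N_sym[of b x] N_V(2)[of a x] no_triangle[OF Nx ab] N_sym[of a b] N_irrefl[of x]
  by auto

lemma common: "y \<in> N a \<Longrightarrow> y \<in> N b \<Longrightarrow> y = x"
  using common_nbr[OF Nx ab] by auto

lemma nbr_x: "x \<in> N v \<Longrightarrow> v = a \<or> v = b"
  using N_sym[of x v] Nx by auto

lemma diamond:
  assumes b: "N b = {x, b1, b2}" and b1: "N b1 = {b, b2, c}" and c: "c \<in> N b2"
    and D: "distinct [x, b, b1, b2, c]"
  shows False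
proof -
  have "c \<noteq> a" using common[of b1] b1 b D N_sym[of a b1] by auto
  then show False
    by (intro direct[of "[(b, x), (b2, c)]" "[b1]" "[(b, x), (b2, c), (b, b2)]" "[x]"])
      (use apart[OF D] c ab in \<open>simp_all add: b b1 Nx doubleton_eq_iff card_insert_if N_V(1)[of b1 b]\<close>)
qed

text \<open>No edge can be added along \<open>b2 b b1\<close> here, since both further neighbours of
  \<open>b1\<close> are adjacent to \<open>b2\<close>. An edge \<open>cc'\<close>, a vertex
  \<open>c\<close>, \<open>c'\<close> or \<open>z\<close> of degree 2, or different third neighbours
  of \<open>c\<close> and \<open>c'\<close> would each permit a direct reduction; what remains is
  K_{3,3} minus an edge. The hypothesis \<open>cross\<close> keeps \<open>z\<close> apart from
  \<open>a\<close>.\<close>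

lemma block:
  assumes b: "N b = {x, b1, b2}" and b1: "N b1 = {b, c, c'}" and b2: "N b2 = {b, c, c'}"
    and D: "distinct [x, b, b1, b2, c, c']"
    and cross: "\<And>a' b'. a' \<in> N a \<Longrightarrow> b' \<in> N b \<Longrightarrow> a' \<noteq> x \<Longrightarrow> b' \<noteq> x \<Longrightarrow> a' \<notin> N b'"
  obtains z u where "N c = {b1, b2, z}" "N c' = {b1, b2, z}" "N z = {c, c', u}"
    "distinct [x, a, b, b1, b2, c, c', z]" "u \<notin> {x, b, b1, b2, c, c', z}"
proof -
  have V: "b1 \<in> V" "b2 \<in> V" "c \<in> V" "c' \<in> V" using N_V(1)[of _ b] N_V(1)[of _ b1] b b1 by auto
  have cN: "b1 \<in> N c" "b2 \<in> N c" "b1 \<in> N c'" "b2 \<in> N c'" "b1 \<noteq> b2"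
    using b1 b2 D N_sym[of c b1] N_sym[of c b2] N_sym[of c' b1] N_sym[of c' b2] by auto
  have ca: "c \<noteq> a" "c' \<noteq> a" using common[of b1] cN b D by auto
  have 1: "c' \<notin> N c"
  proof
    assume "c' \<in> N c"
    then show False
      by (intro direct[of "[(b, x), (c, c')]" "[b1, b2]" "[]" "[]"])
        (use apart[OF D] in \<open>simp_all add: b b1 b2 V\<close>)
  qed
  have "card (N c) \<noteq> 2"
  proof
    assume "card (N c) = 2"
    then have "N c = {b1, b2}" using cN by (auto simp: card_2_iff)
    then show False
      by (intro direct[of "[(b, b1), (b2, c')]" "[c]" "[(b, b1), (b2, c'), (b, b2), (b1, c')]" "[]"])
        (use apart[OF D] in \<open>simp_all add: b b1 b2 V doubleton_eq_iff\<close>)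
  qed
  then obtain w where w: "N c = {b1, b2, w}" "w \<noteq> b1" "w \<noteq> b2" "w \<noteq> c"
    using third_nbr_ex[OF _ cN(1,2,5)] by blast
  have "card (N c') \<noteq> 2"
  proof
    assume "card (N c') = 2"
    then have "N c' = {b1, b2}" using cN by (auto simp: card_2_iff)
    then show False
      by (intro direct[of "[(b, b1), (b2, c)]" "[c']" "[(b, b1), (b2, c), (b, b2), (b1, c)]" "[]"])
        (use apart[OF D] in \<open>simp_all add: b b1 b2 V doubleton_eq_iff\<close>)
  qed
  then obtain w' where w': "N c' = {b1, b2, w'}" "w' \<noteq> b1" "w' \<noteq> b2" "w' \<noteq> c'"
    using third_nbr_ex[OF _ cN(3,4,5)] by blast
  have "c \<notin> N x" "c \<notin> N b" "c \<notin> N c'" "c' \<notin> N x" "c' \<notin> N b" "c' \<notin> N c"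
    using apart[OF D] ca 1 N_sym[of c c'] by (auto simp: Nx b)
  moreover have "c \<in> N w" "c' \<in> N w'" using w(1) w'(1) N_sym[of w c] N_sym[of w' c'] by auto
  ultimately have w_ne: "w \<noteq> x" "w \<noteq> b" "w \<noteq> c'" "w' \<noteq> x" "w' \<noteq> b" "w' \<noteq> c"
    by auto
  have ww': "w = w'"
  proof (rule ccontr)
    assume "w \<noteq> w'"
    then show False
      \<comment> \<open>The 12 units required are 8 for the free vertices \<open>b1\<close> and
        \<open>b2\<close>, 3 for the matching edges and 1 for the degree of
        \<open>x\<close>.\<close>
      by (intro direct[of "[(b, x), (c, w), (c', w')]" "[b1, b2]" "[(b, x), (c, w), (c', w')]" "[x]"])
        (use apart[OF D] w(2-4) w'(2-4) w_ne in \<open>simp_all add: b b1 b2 V w(1) w'(1) Nx doubleton_eq_iff card_insert_if\<close>)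
  qed
  have w2: "N c' = {b1, b2, w}" using w'(1) ww' by simp
  have wN: "c \<in> N w" "c' \<in> N w" "c \<noteq> c'" using w w' ww' N_sym[of w c] N_sym[of w c'] D by auto
  have "card (N w) \<noteq> 2"
  proof
    assume "card (N w) = 2"
    then have Nw: "N w = {c, c'}" using wN by (auto simp: card_2_iff)
    show False
      by (rule direct[of "[(c, b1), (c', b2), (b, x)]" "[w]"
            "[(c, b1), (c, b2), (c', b1), (c', b2), (b, x), (b, b1), (b, b2)]" "[x]"])
        (use apart[OF D] w(2-4) w'(2-4) w_ne in
          \<open>simp_all add: b b1 b2 V w(1) w2 Nx Nw N_V(1)[of w c] doubleton_eq_iff card_insert_if\<close>)
  qed
  then obtain u where u: "N w = {c, c', u}" "u \<noteq> c" "u \<noteq> c'" "u \<noteq> w"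
    using third_nbr_ex[OF _ wN] by blast
  have "w \<in> N u" using u(1) N_sym[of u w] by auto
  moreover have "w \<notin> N b" "w \<notin> N b1" "w \<notin> N b2" using w_ne w(2-4) ww' w'(2-4) by (simp_all add: b b1 b2)
  moreover have wa: "w \<noteq> a"
    using cross[of c b1] b b1 wN D basic(2) by auto
  then have "w \<notin> N x" using w_ne D by (simp add: Nx w)
  ultimately have "u \<noteq> x" "u \<noteq> b" "u \<noteq> b1" "u \<noteq> b2" by auto
  moreover have "a \<noteq> b1" "a \<noteq> b2" using basic(4) b by auto
  ultimately show ?thesis
    using that[of w u] w w' u w_ne apart[OF D] ww' wa ca basic(6) ab by simp
qed

end

text \<open>\<open>b\<close> lies in a copy of \<open>K\<^bsub>3,3\<^esub>\<close> minus the edge \<open>bz\<close>, attached to the rest by \<open>xb\<close> and \<open>zu\<close>.\<close>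

locale b_block = degree_two +
  fixes b1 b2 c c' z u
  assumes Nb: "N b = {x, b1, b2}" and Nb1: "N b1 = {b, c, c'}" and Nb2: "N b2 = {b, c, c'}"
    and Nc: "N c = {b1, b2, z}" and Nc': "N c' = {b1, b2, z}" and Nz: "N z = {c, c', u}"
    and D: "distinct [x, a, b, b1, b2, c, c', z]" and u: "u \<notin> {x, b, b1, b2, c, c', z}"
begin

lemmas nb = Nx Nb Nb1 Nb2 Nc Nc' Nz

lemma inV: "x \<in> V" "b \<in> V" "b1 \<in> V" "b2 \<in> V" "c \<in> V" "c' \<in> V" "z \<in> V" "u \<in> V" "a \<in> V"
proof -
  have "b \<in> N x" "a \<in> N x" "b1 \<in> N b" "b2 \<in> N b" "c \<in> N b1" "c' \<in> N b1" "z \<in> N c" "u \<in> N z" by (simp_all add: nb)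
  then show "x \<in> V" "b \<in> V" "b1 \<in> V" "b2 \<in> V" "c \<in> V" "c' \<in> V" "z \<in> V" "u \<in> V" "a \<in> V"
    by (blast intro: N_V)+
qed

lemma u_ne_a: "u \<noteq> a"
proof
  assume "u = a"
  then have Nz: "N z = {c, c', a}" using Nz by simp
  show False
    by (rule direct[of "[(x, a), (c, b1), (c', b2)]" "[b, z]" "[(x, a), (c, b1), (c, b2), (c', b1)]" "[]"])
      (use apart[OF D] in \<open>simp_all add: Nx Nb Nb1 Nb2 Nc Nc' Nz inV doubleton_eq_iff\<close>)
qed

lemma D': "distinct [x, a, b, b1, b2, c, c', z, u]"
  using D u u_ne_a by auto

lemma z_in: "z \<in> N u"
  using Nz N_sym[of u z] by simp

lemma a_nbr:
  assumes "v \<in> N a" "v \<noteq> x" shows "v \<notin> {x, a, b, b1, b2, c, c', z}"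
proof -
  have "a \<in> N v" by (rule N_sym[OF assms(1)])
  moreover have "a \<notin> N a" "a \<notin> N b" "a \<notin> N b1" "a \<notin> N b2" "a \<notin> N c" "a \<notin> N c'" "a \<notin> N z"
    using apart[OF D'] by (simp_all add: nb)
  ultimately show ?thesis using assms(2) by auto
qed

lemma u_nbr:
  assumes "v \<in> N u" "v \<noteq> z" shows "v \<notin> {x, b, b1, b2, c, c', z, u}"
proof -
  have "u \<in> N v" by (rule N_sym[OF assms(1)])
  moreover have "u \<notin> N x" "u \<notin> N u" "u \<notin> N b" "u \<notin> N b1" "u \<notin> N b2" "u \<notin> N c" "u \<notin> N c'"
    using apart[OF D'] by (simp_all add: nb)
  ultimately show ?thesis using assms(2) by auto
qed

text \<open>Ensures that a matching edge at \<open>a\<close> other than \<open>ax\<close> never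
  shares an end with \<open>zu\<close>, so that the reductions below can use both.\<close>

lemma u_notin: "u \<notin> N a"
proof
  assume ua: "u \<in> N a"
  have au: "a \<in> N u" by (rule N_sym[OF ua])
  have "a \<noteq> z" using D by simp
  from au z_in this show False
  proof (cases rule: third_nbr)
    case (2 h)
    have h: "h \<notin> {x, b, b1, b2, c, c', z, u}" by (rule u_nbr) (use 2 in auto)
    have D2: "distinct [x, a, b, b1, b2, c, c', z, u, h]" using D' h 2(2) by auto
    show False
      by (rule direct[of "[(x, a), (u, h), (c, b1), (c', b2)]" "[b, z]"
            "[(x, a), (u, a), (u, h), (c, b1), (c, b2), (c', b1), (c', b2)]" "[x]"])
        (use apart[OF D2] in \<open>simp_all add: nb 2(1) inV doubleton_eq_iff card_insert_if\<close>)
  next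
    case 1
    have xu: "x \<noteq> u" using D' by simp
    from basic(2) ua xu show False
    proof (cases rule: third_nbr)
      case one: 1
      show False
        by (rule direct[of "[(a, u), (b, b1), (b2, c), (z, c')]" "[x]"
            "[(a, u), (u, z), (b, b1), (b, b2), (b1, c), (b1, c'), (b2, c), (b2, c'), (c, z), (c', z)]" "[a, u]"])
          (use apart[OF D'] in \<open>simp_all add: nb 1 one inV doubleton_eq_iff card_insert_if\<close>)
    next
      case (2 g)
      have g: "g \<notin> {x, a, b, b1, b2, c, c', z}" by (rule a_nbr) (use 2 in auto)
      have D2: "distinct [x, a, b, b1, b2, c, c', z, u, g]" using D' g 2(3) by auto
      show False
        by (rule direct[of "[(a, g), (b, b1), (b2, c), (z, c')]" "[x, u]"
            "[(b, b1), (b, b2), (b1, c), (b1, c'), (b2, c), (b2, c'), (c, z), (c', z)]" "[]"])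
          (use apart[OF D2] in \<open>simp_all add: nb 1 2(1) inV doubleton_eq_iff card_insert_if\<close>)
    qed
  qed
qed

lemma a_nbr': "v \<in> N a \<Longrightarrow> v \<noteq> x \<Longrightarrow> v \<notin> {x, a, b, b1, b2, c, c', z, u}"
  using a_nbr[of v] u_notin by auto

text \<open>Matching \<open>bb1\<close>, \<open>b2c\<close>, \<open>zu\<close> and leaving
  \<open>x\<close> and \<open>c'\<close> free disposes of the block. Together with \<open>av\<close>
  this collects 8 + 7 of the 16 units required, and a vertex of degree 2 would supply the last
  one.\<close>

lemma no_saving:
  assumes "v \<in> N a" "v \<noteq> x" shows "card (N a) \<noteq> 2" "card (N v) \<noteq> 2"
proof -
  have D2: "distinct [x, a, b, b1, b2, c, c', z, u, v]" using D' a_nbr'[OF assms] by auto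
  have False if "card (N w) = 2" "w = a \<or> w = v" for w
    by (rule direct[of "[(a, v), (b, b1), (b2, c), (z, u)]" "[x, c']"
          "[(a, v), (b, b1), (b, b2), (b1, c), (b2, c), (c, z), (z, u)]" "[w]"])
      (use apart[OF D2] that in \<open>auto simp add: nb assms inV doubleton_eq_iff\<close>)
  then show "card (N a) \<noteq> 2" "card (N v) \<noteq> 2" by auto
qed

text \<open>The missing unit of the same matching, now with \<open>aa1\<close>, comes from an edge
  added along \<open>a2 a a1\<close>. The added edge must not end in the removed vertex
  \<open>u\<close>; were \<open>u\<close> adjacent to \<open>a1\<close>, the edge
  \<open>a1 u\<close> would already be the sixteenth unit.\<close>

lemma no_lift:
  assumes Na: "N a = {x, a1, a2}" and a1: "N a1 = {a, q, r}"
    and d: "distinct [x, a1, a2]" "distinct [a, q, r]" and q: "q \<noteq> a2" "q \<notin> N a2"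
  shows False
proof -
  have a12: "a1 \<notin> {x, a, b, b1, b2, c, c', z, u}" "a2 \<notin> {x, a, b, b1, b2, c, c', z, u}"
    using a_nbr'[of a1] a_nbr'[of a2] Na d by auto
  have D2: "distinct [x, a, b, b1, b2, c, c', z, u, a1, a2]" using D' a12 d by auto
  have u: "u \<notin> N a1"
  proof
    assume "u \<in> N a1"
    then show False
      by (intro direct[of "[(a, a1), (b, b1), (b2, c), (z, u)]" "[x, c']"
          "[(a, a1), (b, b1), (b, b2), (b1, c), (b2, c), (c, z), (z, u), (a1, u)]" "[]"])
        (use apart[OF D2] in \<open>simp_all add: nb Na inV doubleton_eq_iff\<close>)
  qed
  have "q \<noteq> r" "a \<noteq> q" "a \<noteq> r" using d by auto
  from lift_choice[OF a1 this q] obtain q' r' where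
    q': "{q', r'} = {q, r}" "q' \<noteq> a2" "q' \<notin> N a2" "\<And>K. \<not> two_cut E K a2 a q' a1" by metis
  have "q' \<in> N a1" "q' \<noteq> a" using q'(1) a1 d(2) by auto
  have a1q: "a1 \<in> N q'" by (rule N_sym[OF \<open>q' \<in> N a1\<close>])
  have "a1 \<notin> N x" "a1 \<notin> N b" "a1 \<notin> N b1" "a1 \<notin> N b2" "a1 \<notin> N c" "a1 \<notin> N c'" "a1 \<notin> N z" "a1 \<notin> N a1"
    using apart[OF D2] by (simp_all add: nb)
  then have "q' \<notin> {x, b, b1, b2, c, c', z, a1}" using a1q by auto
  then have D3: "distinct [x, a, b, b1, b2, c, c', z, u, a1, a2, q']"
    using D2 q'(2) \<open>q' \<noteq> a\<close> u \<open>q' \<in> N a1\<close> by auto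
  have "a \<in> N a2" using Na N_sym[of a2 a] by simp
  show False
    by (rule lift1[of "[(a, a1), (b, b1), (b2, c), (z, u)]" "[x, c']"
          "[(a, a1), (b, b1), (b, b2), (b1, c), (b2, c), (c, z), (z, u)]" "[]"
          "[(a, a2), (a1, q'), (b, b1), (b2, c), (z, u)]" a2 q' a a1])
      (use apart[OF D3] q'(3,4) a1q \<open>q' \<in> N a1\<close> \<open>a \<in> N a2\<close> in \<open>simp_all add: nb Na inV doubleton_eq_iff\<close>)
qed

end

text \<open>Each block is attached through one further edge, \<open>zu\<close> and
  \<open>yv\<close>. These coincide, end in the same vertex outside the blocks, or are disjoint, and
  each case has its own matching with an exact count.\<close>

lemma two_blocks:
  assumes "b_block V E x a b b1 b2 c c' z u" and "b_block V E x b a a1 a2 e e' y v"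
  shows False
proof -
  interpret B: b_block V E x a b b1 b2 c c' z u by fact
  interpret A: b_block V E x b a a1 a2 e e' y v by fact
  note nb = B.nb A.nb
  have a12: "a1 \<notin> {x, a, b, b1, b2, c, c', z, u}" "a2 \<notin> {x, a, b, b1, b2, c, c', z, u}"
    using B.a_nbr'[of a1] B.a_nbr'[of a2] A.Nb A.D by auto
  have e: "w \<notin> {x, a, b, b1, b2, c, c', z}" if "a1 \<in> B.N w" "w \<noteq> a" for w
  proof -
    have "a1 \<notin> B.N x" "a1 \<notin> B.N b" "a1 \<notin> B.N b1" "a1 \<notin> B.N b2" "a1 \<notin> B.N c" "a1 \<notin> B.N c'" "a1 \<notin> B.N z"
      using a12 by (simp_all add: B.nb)
    then show ?thesis using that by auto
  qed
  have ee: "e \<notin> {x, a, b, b1, b2, c, c', z}"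
    by (rule e) (use apart[OF A.D] in \<open>simp_all add: A.nb\<close>)
  have ee': "e' \<notin> {x, a, b, b1, b2, c, c', z}"
    by (rule e) (use apart[OF A.D] in \<open>simp_all add: A.nb\<close>)
  have y: "y \<notin> {x, a, b, b1, b2, c, c'}"
  proof -
    have "e \<notin> B.N x" "e \<notin> B.N a" "e \<notin> B.N b" "e \<notin> B.N b1" "e \<notin> B.N b2" "e \<notin> B.N c" "e \<notin> B.N c'"
      using ee apart[OF A.D] by (simp_all add: nb)
    moreover have "e \<in> B.N y" by (simp add: A.nb)
    ultimately show ?thesis by auto
  qed
  have yz: "y \<noteq> z"
  proof
    assume "y = z"
    then have "e \<in> B.N z" "e' \<in> B.N z" using A.Nz by simp_all
    then have "e = u" "e' = u" using ee ee' by (simp_all add: B.Nz)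
    then show False using A.D by simp
  qed
  have D13: "distinct [x, a, b, b1, b2, c, c', z, a1, a2, e, e', y]"
    using B.D A.D a12 ee ee' y yz by auto
  have ue: "u \<notin> {a1, a2, e, e'}"
  proof -
    have "z \<in> B.N u" by (rule B.z_in)
    moreover have "z \<notin> B.N e" "z \<notin> B.N e'" using apart[OF D13] by (simp_all add: A.nb)
    ultimately show ?thesis using a12 by auto
  qed
  show False
  proof (cases "u = y")
    case True
    then have "z \<in> B.N y" using B.z_in by simp
    then have "v = z" using apart[OF D13] by (simp add: A.Nz)
    then have Ny: "B.N y = {e, e', z}" using A.Nz by simp
    have Nz: "B.N z = {c, c', y}" using B.Nz True by simp
    show False
      by (rule B.direct[of "[(z, y), (b, b1), (b2, c), (a, a1), (a2, e)]" "[x, c', e']"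
          "[(z, y), (b, b1), (b2, c), (a, a1), (a2, e), (b, b2), (b1, c), (a, a2)]" "[]"])
        (use apart[OF D13] in \<open>simp_all add: B.Nx B.Nb B.Nb1 B.Nb2 B.Nc B.Nc' A.Nb A.Nb1 A.Nb2 A.Nc A.Nc' Ny Nz
          B.inV A.inV doubleton_eq_iff\<close>)
  next
    case False
    have D14: "distinct [x, a, b, b1, b2, c, c', z, a1, a2, e, e', y, u]"
      using D13 ue False B.D' by auto
    have yv: "y \<in> B.N v" by (rule A.z_in)
    have "y \<notin> B.N b" "y \<notin> B.N b1" "y \<notin> B.N b2" "y \<notin> B.N c" "y \<notin> B.N c'" "y \<notin> B.N z"
      using apart[OF D14] by (simp_all add: B.nb)
    then have "v \<notin> {b, b1, b2, c, c', z}" using yv by auto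
    then have v: "v \<notin> {x, a, b, b1, b2, c, c', z, a1, a2, e, e', y}" using A.u by auto
    show False
    proof (cases "u = v")
      case ne: False
      have D15: "distinct [x, a, b, b1, b2, c, c', z, a1, a2, e, e', y, u, v]"
        using D14 v ne by auto
      show False
        by (rule B.direct[of "[(a, a1), (a2, e), (y, v), (b, b1), (b2, c), (z, u)]" "[x, e', c']"
            "[(a, a1), (a2, e), (y, v), (b, b1), (b2, c), (z, u), (a, a2), (a1, e), (e, y), (b, b2), (b1, c), (c, z)]" "[]"])
          (use apart[OF D15] in \<open>simp_all add: nb B.inV A.inV doubleton_eq_iff\<close>)
    next
      case uv: True
      have "y \<in> B.N u" using yv uv by simp
      from this B.z_in yz show False
      proof (cases rule: B.third_nbr)
        \<comment> \<open>Now \<open>x\<close>, \<open>u\<close> and the two blocks form a whole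
          component: 24 units from two free vertices and all 16 block edges.\<close>
        case 1
        show False
          by (rule B.direct[of "[(a, a1), (a2, e), (y, e'), (b, b1), (b2, c), (z, c')]" "[x, u]"
              "[(a, a1), (a, a2), (a1, e), (a1, e'), (a2, e), (a2, e'), (e, y), (e', y),
                (b, b1), (b, b2), (b1, c), (b1, c'), (b2, c), (b2, c'), (c, z), (c', z)]" "[]"])
            (use apart[OF D14] in \<open>simp_all add: B.nb A.Nb A.Nb1 A.Nb2 A.Nc A.Nc' A.Nz[folded uv] 1(1)
              B.inV A.inV doubleton_eq_iff\<close>)
      next
        case (2 h)
        have "h \<notin> {x, b, b1, b2, c, c', z, u}" by (rule B.u_nbr) (use 2 in auto)
        moreover have "h \<notin> {x, a, a1, a2, e, e', y, v}" by (rule A.u_nbr) (use 2 uv in auto)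
        ultimately have D15: "distinct [x, a, b, b1, b2, c, c', z, a1, a2, e, e', y, u, h]"
          using D14 by auto
        show False
          by (rule B.direct[of "[(x, a), (u, h), (c, b1), (c', b2), (a2, e), (y, e')]" "[b, z, a1]"
              "[(x, a), (u, h), (c, b1), (c, b2), (c', b1), (c', b2), (a2, e), (a2, e'), (y, e), (y, e'), (y, u), (a, a2)]" "[]"])
            (use apart[OF D15] in \<open>simp_all add: B.nb A.Nb A.Nb1 A.Nb2 A.Nc A.Nc' A.Nz[folded uv] 2(1)
              B.inV A.inV doubleton_eq_iff\<close>)
      qed
    qed
  qed
qed

section \<open>Five-cycles through a vertex of degree two\<close>

context degree_two
begin

text \<open>On the five-cycle \<open>x a a1 b1 b\<close> the matching \<open>aa1\<close>,
  \<open>bb1\<close> collects 4 + 3 of 8 units, so one added edge suffices. The first choice is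
  \<open>a2 b2\<close>, with \<open>a1 b1\<close> in the replacement. If a cut \<open>K\<close>
  blocks it, then \<open>c\<close> lies outside \<open>K\<close> and \<open>a2 c\<close> is added
  instead; a cut against that shares the boundary edge \<open>a2 a\<close> with
  \<open>K\<close>.\<close>

lemma cross_edge_only:
  assumes Na: "N a = {x, a1, a2}" and Nb: "N b = {x, b1, b2}" and Na1: "N a1 = {a, b1, c}" and b1: "a1 \<in> N b1"
    and D: "distinct [x, a, b, a1, a2, b1, b2]" and c: "c \<noteq> a" "c \<noteq> b1" and nb: "b2 \<notin> N a2"
  shows False
proof -
  have a2: "a \<in> N a2" and b2: "b \<in> N b2" and cN: "a1 \<in> N c"
    using Na Nb Na1 N_sym[of a2 a] N_sym[of b2 b] N_sym[of c a1] by auto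
  have cW: "c \<notin> {x, a, b, a1, b1}"
  proof -
    have "a1 \<notin> N x" "a1 \<notin> N b" "a1 \<notin> N a1" using apart[OF D] by (simp_all add: Nx Nb)
    then show ?thesis using cN c by auto
  qed
  have b1N: "b1 \<in> N b" using Nb by simp
  show False
  proof (rule lift1[of "[(a, a1), (b, b1)]" "[x]" "[(a, a1), (b, b1), (a1, b1)]" "[]"
        "[(a, a2), (a1, b1), (b, b2)]" a2 b2 a b])
    fix K assume K: "two_cut E K a2 a b2 b" "K \<inter> (ends [(a, a1), (b, b1)] \<union> set [x]) = {}"
    have aK: "a1 \<notin> K" "a2 \<in> K" using K by (auto simp: two_cut_def)
    have cK: "c \<notin> K"
    proof
      assume "c \<in> K"
      from two_cutD[OF K(1) this cN] show False using aK D by auto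
    qed
    have ca2: "c \<noteq> a2" "c \<notin> N a2"
    proof -
      show "c \<noteq> a2" using aK cK by auto
      show "c \<notin> N a2"
      proof
        assume "c \<in> N a2"
        from two_cutD[OF K(1) aK(2) this] show False using cK c D by auto
      qed
    qed
    show False
    proof (rule lift1[of "[(a, a1), (b, b1)]" "[x]" "[(a, a1), (b, b1), (a1, b1)]" "[]"
          "[(a, a2), (a1, c), (b, b1)]" a2 c a a1])
      fix K' assume K': "two_cut E K' a2 a c a1" "K' \<inter> (ends [(a, a1), (b, b1)] \<union> set [x]) = {}"
      have "b2 \<notin> K'"
      proof
        assume "b2 \<in> K'"
        from two_cutD[OF K'(1) this b2] show False using K'(2) D by auto
      qed
      then show False using two_cuts[OF K(1) K'(1)] cK by auto
    qed (use apart[OF D] cW ca2 a2 cN basic(1) b1 in \<open>auto simp: Nx Na Nb Na1 doubleton_eq_iff\<close>)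
  qed (use apart[OF D] a2 b2 nb basic(1) b1 cW in \<open>auto simp: Nx Na Nb Na1 doubleton_eq_iff\<close>)
qed

text \<open>Otherwise \<open>a2 c1\<close> could be added. A cut against it would contain
  \<open>a2\<close>, hence its neighbour \<open>b2\<close>, and would then be left through
  \<open>b2 b\<close>, which is not one of its two boundary edges.\<close>

lemma cross_third_nbr:
  assumes Na: "N a = {x, a1, a2}" and Nb: "N b = {x, b1, b2}" and Na1: "N a1 = {a, b1, c1}" and Na2: "N a2 = {a, b2, c2}"
    and D: "distinct [x, a, b, a1, a2, b1, b2]" and c: "c1 \<noteq> a" "c1 \<noteq> b1" "c1 \<noteq> b2"
  shows "c1 = a2 \<or> c1 = c2"
proof (rule ccontr)
  assume "\<not> ?thesis"
  then have n: "c1 \<noteq> a2" "c1 \<notin> N a2" using c by (auto simp: Na2)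
  have a2: "a \<in> N a2" and b2: "b \<in> N b2" and cN: "a1 \<in> N c1"
    using Na Nb Na1 N_sym[of a2 a] N_sym[of b2 b] N_sym[of c1 a1] by auto
  have cW: "c1 \<notin> {x, a, b, a1, b1}"
  proof -
    have "a1 \<notin> N x" "a1 \<notin> N b" "a1 \<notin> N a1" using apart[OF D] by (simp_all add: Nx Nb)
    then show ?thesis using cN c by auto
  qed
  have D2: "distinct [x, a, b, a1, a2, b1, b2, c1]" using D cW n(1) c by auto
  show False
  proof (rule lift1[of "[(a, a1), (b, b1)]" "[x]" "[(a, a1), (b, b1), (a1, b1)]" "[]"
        "[(a, a2), (a1, c1), (b, b1)]" a2 c1 a a1])
    fix K assume K: "two_cut E K a2 a c1 a1" "K \<inter> (ends [(a, a1), (b, b1)] \<union> set [x]) = {}"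
    have "a2 \<in> K" "b2 \<in> N a2" using K(1) Na2 by (auto simp: two_cut_def)
    from two_cutD[OF K(1) this] have "b2 \<in> K" using apart[OF D] c by auto
    from two_cutD[OF K(1) this b2] show False using K(2) D by auto
  qed (use apart[OF D2] n(2) a2 cN basic(1) in \<open>simp_all add: Nx Na Nb Na1 doubleton_eq_iff\<close>)
qed

lemma cross_triangle:
  assumes Na: "N a = {x, a1, a2}" and Nb: "N b = {x, b1, b2}" and Na1: "N a1 = {a, b1, a2}" and Na2: "N a2 = {a, b2, a1}"
    and Nb1: "N b1 = {b, a1, d}" and Nb2: "N b2 = {b, a2, d}"
    and D: "distinct [x, a, b, a1, a2, b1, b2, d]"
  shows False
proof -
  have "b1 \<in> N d" "b2 \<in> N d" "b1 \<noteq> b2" using Nb1 Nb2 D N_sym[of d b1] N_sym[of d b2] by auto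
  then show False
  proof (cases rule: third_nbr)
    case 1
    show False
      by (rule direct[of "[(a, a1), (b, b1), (a2, b2)]" "[x, d]" "[(a, a1), (a, a2), (b, b1), (b, b2)]" "[]"])
        (use apart[OF D] basic(1) N_V(1)[of d b1] in \<open>simp_all add: Nx Na Nb Na1 Na2 Nb1 Nb2 1 doubleton_eq_iff\<close>)
  next
    case (2 h)
    have "d \<in> N h" using 2 N_sym[of h d] by auto
    moreover have "d \<notin> N x" "d \<notin> N a" "d \<notin> N b" "d \<notin> N a1" "d \<notin> N a2"
      using apart[OF D] by (simp_all add: Nx Na Nb Na1 Na2)
    ultimately have "h \<notin> {x, a, b, a1, a2, b1, b2, d}" using 2 by auto
    moreover have "q \<in> {x, a, b, a1, a2, b1, b2, d} \<or> p = d \<and> q = h"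
      if "p \<in> {x, a, b, a1, a2, b1, b2, d}" "q \<in> N p" for p q
      using that by (elim insertE emptyE) (auto simp: Nx Na Nb Na1 Na2 Nb1 Nb2 2(1))
    ultimately show False
      using 2(1) by (intro no_bridge[of d "{x, a, b, a1, a2, b1, b2, d}" h]) auto
  qed
qed

text \<open>The nine vertices leave only one free edge each at \<open>c\<close> and
  \<open>d\<close>. Different outer ends give a direct reduction with exact count, and a common
  outer end \<open>w\<close> has degree 2 or is the end of a bridge.\<close>

lemma cross_common:
  assumes Na: "N a = {x, a1, a2}" and Nb: "N b = {x, b1, b2}" and Na1: "N a1 = {a, b1, c}" and Na2: "N a2 = {a, b2, c}"
    and Nb1: "N b1 = {b, a1, d}" and Nb2: "N b2 = {b, a2, d}"
    and D: "distinct [x, a, b, a1, a2, b1, b2, c, d]"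
  shows False
proof -
  note nb = Nx Na Nb Na1 Na2 Nb1 Nb2
  have V: "c \<in> V" "d \<in> V" "a1 \<in> V" "b2 \<in> V" using N_V(1)[of c a1] N_V(1)[of d b1] N_V(1)[of a1 a] N_V(1)[of b2 b]
    by (simp_all add: nb)
  have cN: "a1 \<in> N c" "a2 \<in> N c" "a1 \<noteq> a2" and dN: "b1 \<in> N d" "b2 \<in> N d" "b1 \<noteq> b2"
    using Na1 Na2 Nb1 Nb2 D N_sym[of d b1] N_sym[of d b2] N_sym[of c a1] N_sym[of c a2] by auto
  have cd: "d \<notin> N c"
  proof
    assume "d \<in> N c"
    then show False
      by (intro direct[of "[(a, a2), (b, b1), (c, d)]" "[x, a1, b2]" "[]" "[]"])
        (use apart[OF D] in \<open>simp_all add: nb V basic(1)\<close>)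
  qed
  from cN show False
  proof (cases rule: third_nbr)
    case 1
    show False
      by (rule direct[of "[(a, a1), (b, b1), (a2, b2)]" "[x, c]" "[(a, a1), (a, a2), (b, b1), (b, b2)]" "[]"])
        (use apart[OF D] basic(1) in \<open>simp_all add: nb V 1 doubleton_eq_iff\<close>)
  next
    case c: (2 w)
    from dN show False
    proof (cases rule: third_nbr)
      case 1
      show False
        by (rule direct[of "[(a, a1), (b, b1), (a2, b2)]" "[x, d]" "[(a, a1), (a, a2), (b, b1), (b, b2)]" "[]"])
          (use apart[OF D] basic(1) in \<open>simp_all add: nb V 1 doubleton_eq_iff\<close>)
    next
      case d: (2 w')
      have "c \<in> N w" "d \<in> N w'" using c d N_sym[of w c] N_sym[of w' d] by auto
      moreover have "c \<notin> N x" "c \<notin> N a" "c \<notin> N b" "c \<notin> N b1" "c \<notin> N b2"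
        "d \<notin> N x" "d \<notin> N a" "d \<notin> N b" "d \<notin> N a1" "d \<notin> N a2"
        using apart[OF D] by (simp_all add: nb)
      moreover have "w \<noteq> d" "w' \<noteq> c" using cd c d N_sym[of c d] by auto
      ultimately have w: "w \<notin> {x, a, b, a1, a2, b1, b2, c, d}" "w' \<notin> {x, a, b, a1, a2, b1, b2, c, d}"
        using c d by auto
      show False
      proof (cases "w = w'")
        case False
        have D2: "distinct [x, a, b, a1, a2, b1, b2, c, d, w, w']" using D w False by auto
        show False
          by (rule direct[of "[(a, a2), (b, b1), (c, w), (d, w')]" "[x, a1, b2]"
                "[(a, a2), (b, b1), (c, w), (d, w')]" "[]"])
            (use apart[OF D2] in \<open>simp_all add: nb V basic(1) c(1) d(1) doubleton_eq_iff\<close>)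
      next
        case True
        have Nd: "N d = {b1, b2, w}" using d(1) True by simp
        have D2: "distinct [x, a, b, a1, a2, b1, b2, c, d, w]" using D w by auto
        have "c \<in> N w" "d \<in> N w" "c \<noteq> d" using \<open>c \<in> N w\<close> \<open>d \<in> N w'\<close> True D by auto
        then show False
        proof (cases rule: third_nbr)
          case 1
          show False
            by (rule direct[of "[(a, a1), (c, a2), (b, b1), (d, b2)]" "[x, w]"
                  "[(a, a1), (a, a2), (c, a1), (c, a2), (b, b1), (b, b2), (d, b1), (d, b2)]" "[]"])
              (use apart[OF D2] N_V(1)[of w c] in \<open>simp_all add: nb V basic(1) c(1) Nd 1 doubleton_eq_iff\<close>)
        next
          case (2 h)
          have "w \<in> N h" using 2 N_sym[of h w] by auto
          moreover have "w \<notin> N x" "w \<notin> N a" "w \<notin> N b" "w \<notin> N a1" "w \<notin> N a2" "w \<notin> N b1" "w \<notin> N b2"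
            using apart[OF D2] by (simp_all add: nb)
          ultimately have "h \<notin> {x, a, b, a1, a2, b1, b2, c, d, w}" using 2 by auto
          moreover have "q \<in> {x, a, b, a1, a2, b1, b2, c, d, w} \<or> p = w \<and> q = h"
            if "p \<in> {x, a, b, a1, a2, b1, b2, c, d, w}" "q \<in> N p" for p q
            using that by (elim insertE emptyE) (auto simp: nb c(1) Nd 2(1))
          ultimately show False
            using 2(1) by (intro no_bridge[of w "{x, a, b, a1, a2, b1, b2, c, d, w}" h]) auto
        qed
      qed
    qed
  qed
qed

end

context degree_two
begin

lemma cross_degree:
  assumes "a1 \<in> N a" "a1 \<noteq> x" "b1 \<in> N b" "b1 \<noteq> x" "b1 \<in> N a1" "t \<in> {a, b, a1, b1}"
  shows "card (N t) \<noteq> 2"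
proof
  assume "card (N t) = 2"
  moreover have "distinct [x, a, b, a1, b1]"
    using assms basic N_irrefl by (auto simp: ab)
  ultimately show False
    by (intro direct[of "[(a, a1), (b, b1)]" "[x]" "[(a, a1), (b, b1), (a1, b1)]" "[t]"])
      (use assms basic(1) apart[of "[x, a, b, a1, b1]"] in \<open>auto simp: Nx doubleton_eq_iff\<close>)
qed

text \<open>No five-cycle passes through \<open>x\<close>. By \<open>cross_edge_only\<close> the
  edges between the outer neighbours of \<open>a\<close> and of \<open>b\<close> occur in
  complementary pairs; four of them close up a component, and two of them fix the third neighbours
  up to a few configurations.\<close>

lemma no_cross:
  assumes a1: "a1 \<in> N a" "a1 \<noteq> x" and b1: "b1 \<in> N b" "b1 \<noteq> x"
  shows "b1 \<notin> N a1"
proof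
  assume ab1: "b1 \<in> N a1"
  note dg = cross_degree[OF a1 b1 ab1]
  have a1b: "a1 \<noteq> b" "b1 \<noteq> a" "a1 \<noteq> b1" "a \<noteq> b1" "b \<noteq> a1" "x \<noteq> a1" "x \<noteq> b1" using a1 b1 ab1 basic N_irrefl by auto
  have ne1: "a1 \<noteq> a" "b1 \<noteq> b" using a1(1) b1(1) by (metis N_irrefl)+
  have sym: "a \<in> N a1" "b \<in> N b1" "a1 \<in> N b1" using a1 b1 ab1 N_sym by auto
  obtain a2 where Na: "N a = {x, a1, a2}" "a2 \<noteq> x" "a2 \<noteq> a1" "a2 \<noteq> a"
    using third_nbr_ex[OF dg basic(2) a1(1)] a1b by auto
  obtain b2 where Nb: "N b = {x, b1, b2}" "b2 \<noteq> x" "b2 \<noteq> b1" "b2 \<noteq> b"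
    using third_nbr_ex[OF dg basic(3) b1(1)] a1b by auto
  obtain c1 where Na1: "N a1 = {a, b1, c1}" "c1 \<noteq> a" "c1 \<noteq> b1" "c1 \<noteq> a1"
    using third_nbr_ex[OF dg sym(1) ab1] a1b by auto
  obtain d1 where Nb1: "N b1 = {b, a1, d1}" "d1 \<noteq> b" "d1 \<noteq> a1" "d1 \<noteq> b1"
    using third_nbr_ex[OF dg sym(2,3)] a1b by auto
  have "a2 \<noteq> b" "b2 \<noteq> a" using Na Nb basic by auto
  moreover have a2: "a2 \<in> N a" and b2: "b2 \<in> N b" using Na(1) Nb(1) by simp_all
  moreover have "a2 \<noteq> b1" "a2 \<noteq> b2" "a1 \<noteq> b2"
    using common[OF a2] common[OF a1(1)] Na(2) a1(2) b1(1) b2 by metis+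
  ultimately have D: "distinct [x, a, b, a1, a2, b1, b2]"
    using Na(2-4) Nb(2-4) a1b basic(6,7) ab ne1 by auto
  have ab2: "b2 \<in> N a2"
  proof (rule ccontr)
    assume "b2 \<notin> N a2"
    then show False using cross_edge_only[OF Na(1) Nb(1) Na1(1) sym(3) D Na1(2,3)] by auto
  qed
  note dg2 = cross_degree[OF a2 Na(2) b2 Nb(2) ab2]
  have sym2: "a \<in> N a2" "b \<in> N b2" "a2 \<in> N b2" using a2 b2 ab2 N_sym by auto
  obtain c2 where Na2: "N a2 = {a, b2, c2}" "c2 \<noteq> a" "c2 \<noteq> b2" "c2 \<noteq> a2"
    using third_nbr_ex[OF dg2 sym2(1) ab2] D by auto
  obtain d2 where Nb2: "N b2 = {b, a2, d2}" "d2 \<noteq> b" "d2 \<noteq> a2" "d2 \<noteq> b2"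
    using third_nbr_ex[OF dg2 sym2(2,3)] D by auto
  note neq = apart[OF D]
  have Nar: "N a = {x, a2, a1}" "N b = {x, b2, b1}" using Na Nb by auto
  show False
  \<comment> \<open>An edge \<open>a1 b2\<close> forces \<open>a2 b1\<close> by
    \<open>cross_edge_only\<close> with \<open>b1\<close> and \<open>b2\<close> exchanged, and
    conversely.\<close>
  proof (cases "b2 \<in> N a1")
    case True
    then have c1: "c1 = b2" using neq by (simp add: Na1)
    have "a1 \<in> N b2" using True by (rule N_sym)
    show False
    proof (cases "b1 \<in> N a2")
      case t: True
      then have "c2 = b1" using neq by (simp add: Na2)
      then show False
        by (intro direct[of "[(a, a1), (b, b1), (a2, b2)]" "[x]"
              "[(a, a1), (a, a2), (b, b1), (b, b2), (a1, b1), (a1, b2), (a2, b1), (a2, b2)]" "[]"])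
          (use neq basic(1) in \<open>simp_all add: Nx Na Nb Na1 Na2 c1 doubleton_eq_iff\<close>)
    next
      case False
      have "N a1 = {a, b2, b1}" using Na1 c1 by auto
      then show False using cross_edge_only[OF Na(1) Nar(2) _ \<open>a1 \<in> N b2\<close>, of b1] False D by auto
    qed
  next
    case nc: False
    show False
    proof (cases "b1 \<in> N a2")
      case True
      then have "c2 = b1" using neq by (simp add: Na2)
      then have "N a2 = {a, b1, b2}" using Na2 by auto
      then show False using cross_edge_only[OF Nar(1) Nb(1) _ N_sym[OF True], of b2] nc D by auto
    next
      case nc2: False
      have c12: "c1 \<noteq> b2" "c2 \<noteq> b1" using nc nc2 Na1 Na2 by auto
      have d12: "d1 \<noteq> a2" "d2 \<noteq> a1" using nc nc2 Nb1 Nb2 N_sym[of b1 a2] N_sym[of b2 a1]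
          N_sym[of a2 b1] N_sym[of a1 b2] by auto
      interpret S: degree_two V E x b a by (rule swap)
      have D': "distinct [x, b, a, b1, b2, a1, a2]" using D by auto
      have c: "c1 = a2 \<or> c1 = c2" by (rule cross_third_nbr[OF Na(1) Nb(1) Na1(1) Na2(1) D Na1(2,3) c12(1)])
      have d: "d1 = b2 \<or> d1 = d2" by (rule S.cross_third_nbr[OF Nb(1) Na(1) Nb1(1) Nb2(1) D' Nb1(2,3) d12(1)])
      have c1N: "a1 \<in> N c1" and d1N: "b1 \<in> N d1" using Na1 Nb1 N_sym[of c1 a1] N_sym[of d1 b1] by auto
      have cx: "c1 \<notin> {x, b, b2}"
      proof -
        have "a1 \<notin> N x" "a1 \<notin> N b" using neq by (simp_all add: Nx Nb)
        then show ?thesis using c1N c12 by auto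
      qed
      have dx: "d1 \<notin> {x, a, a2}"
      proof -
        have "b1 \<notin> N x" "b1 \<notin> N a" using neq by (simp_all add: Nx Na)
        then show ?thesis using d1N d12 by auto
      qed
      have Na2': "N a2 = {a, b2, a1}" if "c1 = a2"
      proof -
        have "a1 \<in> N a2" using that c1N by simp
        then show ?thesis using neq by (simp add: Na2)
      qed
      have Nb2': "N b2 = {b, a2, b1}" if "d1 = b2"
      proof -
        have "b1 \<in> N b2" using that d1N by simp
        then show ?thesis using neq by (simp add: Nb2)
      qed
      show False
      proof (cases "c1 = a2"; cases "d1 = b2")
        assume h: "c1 = a2" "d1 = b2"
        show False
          by (rule direct[of "[(a, a1), (b, b1), (a2, b2)]" "[x]"
                "[(a, a1), (a, a2), (b, b1), (b, b2), (a1, b1), (a2, b2), (a1, a2), (b1, b2)]" "[]"])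
            (use neq basic(1) h in \<open>simp_all add: Nx Na Nb Na1 Na2'[OF h(1)] Nb1 Nb2'[OF h(2)] doubleton_eq_iff\<close>)
      next
        assume h: "c1 = a2" "d1 \<noteq> b2"
        then have d1: "d1 = d2" using d by simp
        show False
          by (rule cross_triangle[OF Na(1) Nb(1) _ Na2'[OF h(1)] Nb1(1)])
            (use h(2) Na1(1)[unfolded h(1)] Nb2(1)[folded d1] dx Nb1(2-4) D in auto)
      next
        assume h: "c1 \<noteq> a2" "d1 = b2"
        then have c1: "c1 = c2" using c by simp
        show False
          by (rule S.cross_triangle[OF Nb(1) Na(1) _ Nb2'[OF h(2)] Na1(1)])
            (use h(1) Nb1(1)[unfolded h(2)] Na2(1)[folded c1] cx Na1(2-4) D' in auto)
      next
        assume h: "c1 \<noteq> a2" "d1 \<noteq> b2"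
        then have e: "c1 = c2" "d1 = d2" using c d by auto
        have "c1 \<noteq> d1"
        proof
          assume "c1 = d1"
          then have "b1 \<in> N c1" "b2 \<in> N c1" "a2 \<in> N c1"
            using d1N e Na2(1) Nb2(1) N_sym[of c2 a2] N_sym[of d2 b2] by auto
          then have "{a1, a2, b1, b2} \<subseteq> N c1" using c1N by auto
          then have "card {a1, a2, b1, b2} \<le> card (N c1)" by (intro card_mono) auto
          then show False using N_le3[of c1] neq by simp
        qed
        then have D3: "distinct [x, a, b, a1, a2, b1, b2, c1, d1]"
          using D cx dx h Na1(2-4) Nb1(2-4) by auto
        show False
          by (rule cross_common[OF Na(1) Nb(1) Na1(1) Na2(1)[folded e(1)] Nb1(1) Nb2(1)[folded e(2)] D3])
      qed
    qed
  qed
qed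

end

section \<open>Reductions with two added edges\<close>

text \<open>The counterpart of \<open>two_cut\<close> for two added edges: \<open>B\<close> lists
  the possible boundary edges, inner end first.\<close>

definition quad_cut :: "'a set set \<Rightarrow> 'a set \<Rightarrow> ('a \<times> 'a) set \<Rightarrow> 'a set \<Rightarrow> bool" where
  "quad_cut E W B K \<longleftrightarrow> fst ` B \<subseteq> K \<and> K \<inter> W = {} \<and> (\<forall>v\<in>K. \<forall>w\<in>nbrs E v. w \<in> K \<or> (v, w) \<in> B)"

lemma quad_cutD: "quad_cut E W B K \<Longrightarrow> v \<in> K \<Longrightarrow> w \<in> nbrs E v \<Longrightarrow> w \<in> K \<or> (v, w) \<in> B"
  by (simp add: quad_cut_def)

context degree_two
begin

lemma outer_nbr:
  assumes "a1 \<in> N a" "a1 \<noteq> x" "c \<in> N a1" "c \<noteq> a" "b1 \<in> N b" "b1 \<noteq> x"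
  shows "c \<notin> {x, a, a1, b, b1}"
proof -
  have "b1 \<notin> N a1" by (rule no_cross[OF assms(1,2,5,6)])
  moreover have "c \<noteq> x" using nbr_x[of a1] assms basic(5) N_irrefl by auto
  moreover have "c \<noteq> b" using common[of a1] assms N_sym[of b a1] by auto
  moreover have "c \<noteq> a1" using assms(3) N_irrefl by auto
  ultimately show ?thesis using assms by auto
qed

text \<open>Only a cubic set can prevent adding both \<open>a2 c\<close> and \<open>b2 d\<close>. It
  must contain both edges, since a set that uses just one of them would be a two-edge cut, which is
  excluded by hypothesis.\<close>

lemma ex_quad_cut:
  assumes Na: "N a = {x, a1, a2}" and Nb: "N b = {x, b1, b2}" and D: "distinct [x, a1, a2]" "distinct [x, b1, b2]"
    and c: "c \<in> N a1" "c \<noteq> a" "c \<noteq> a2" "c \<notin> N a2" "\<And>K. \<not> two_cut E K a2 a c a1"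
    and d: "d \<in> N b1" "d \<noteq> b" "d \<noteq> b2" "d \<notin> N b2" "\<And>K. \<not> two_cut E K b2 b d b1"
  shows "\<exists>K. quad_cut E {x, a, a1, b, b1} {(a2, a), (c, a1), (b2, b), (d, b1)} K"
proof -
  let ?W = "{x, a, a1, b, b1}" and ?F = "del E {x, a, a1, b, b1} \<union> {{a2, c}, {b2, d}}"
  interpret S: degree_two V E x b a by (rule swap)
  have m: "a1 \<in> N a" "a2 \<in> N a" "b1 \<in> N b" "b2 \<in> N b" using Na Nb by simp_all
  have ne: "a1 \<noteq> x" "a2 \<noteq> x" "b1 \<noteq> x" "b2 \<noteq> x" "a1 \<noteq> a2" "b1 \<noteq> b2" using D by auto
  have cW: "c \<notin> ?W" using outer_nbr[OF m(1) ne(1) c(1,2) m(3) ne(3)] by auto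
  have dW: "d \<notin> ?W" using S.outer_nbr[OF m(3) ne(3) d(1,2) m(1) ne(1)] by auto
  have a2W: "a2 \<notin> ?W"
    using m(2) ne common[OF m(2)] m(3) basic(5) by (metis N_irrefl empty_iff insert_iff)
  have b2W: "b2 \<notin> ?W"
    using m(4) ne common[OF _ m(4)] m(1) basic(4) by (metis N_irrefl empty_iff insert_iff)
  have a1b1: "a1 \<noteq> b1" using common[OF m(1)] m(3) ne by metis
  have ab1: "a \<noteq> a1" "b \<noteq> b1" "a \<noteq> b1" "b \<noteq> a1"
    using m basic(4,5) by (metis N_irrefl)+
  have D5: "distinct [x, a, a1, b, b1]" using a1b1 ab1 ne basic(6,7) ab by auto
  have a2d: "a2 \<noteq> d" using no_cross[OF m(2) ne(2) m(3) ne(3)] d(1) N_sym[of d b1] by metis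
  have a2b2: "a2 \<noteq> b2" using common[OF m(2)] m(4) ne by metis
  have sym: "a \<in> N a2" "a1 \<in> N c" "b \<in> N b2" "b1 \<in> N d" using m c(1) d(1) N_sym by auto
  have "\<not> cubic_free ?F"
  proof
    assume free: "cubic_free ?F"
    show False
      by (rule lift2[OF D5 Nx m(1,3) m(2) a2W c(1) cW m(4) b2W d(1) dW _ c(4) _ d(4) _ free])
        (use c(3) d(3) a2b2 a2d in \<open>auto simp: doubleton_eq_iff\<close>)
  qed
  then obtain K where K: "K \<noteq> {}" "\<forall>v\<in>K. card (nbrs ?F v \<inter> K) = 3"
    by (auto simp: cubic_free_def)
  have nF: "nbrs ?F v = nbrs (del E ?W) v \<union> nbrs {{a2, c}, {b2, d}} v" for v
    by (rule nbrs_Un)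
  have c1: "{a2, c} \<subseteq> K"
  proof (rule ccontr)
    assume n: "\<not> {a2, c} \<subseteq> K"
    have "nbrs ?F v \<inter> K = nbrs (insert {b2, d} (del E ?W)) v \<inter> K" if "v \<in> K" for v
      using n that by (auto simp: nbrs_def doubleton_eq_iff)
    then have K': "\<forall>v\<in>K. card (nbrs (insert {b2, d} (del E ?W)) v \<inter> K) = 3" using K(2) by simp
    have "two_cut E K b2 b d b1"
      by (rule two_cut_if_cubic(1)[OF sg sc cubic_free_del K(1) K' d(3)[symmetric] b2W dW sym(3) _ sym(4)]) auto
    then show False using d(5) by simp
  qed
  have c2: "{b2, d} \<subseteq> K"
  proof (rule ccontr)
    assume n: "\<not> {b2, d} \<subseteq> K"
    have "nbrs ?F v \<inter> K = nbrs (insert {a2, c} (del E ?W)) v \<inter> K" if "v \<in> K" for v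
      using n that by (auto simp: nbrs_def doubleton_eq_iff)
    then have K': "\<forall>v\<in>K. card (nbrs (insert {a2, c} (del E ?W)) v \<inter> K) = 3" using K(2) by simp
    have "two_cut E K a2 a c a1"
      by (rule two_cut_if_cubic(1)[OF sg sc cubic_free_del K(1) K' c(3)[symmetric] a2W cW sym(1) _ sym(2)]) auto
    then show False using c(5) by simp
  qed
  have KW: "K \<inter> ?W = {}"
  proof (rule ccontr)
    assume "K \<inter> ?W \<noteq> {}"
    then obtain v where v: "v \<in> K" "v \<in> ?W" by auto
    have "v \<noteq> a2" "v \<noteq> b2" "v \<noteq> c" "v \<noteq> d" using v(2) a2W b2W cW dW by metis+
    then have "nbrs {{a2, c}, {b2, d}} v = {}" by (auto simp: nbrs_def doubleton_eq_iff)
    then have "nbrs ?F v = {}" using v(2) unfolding nF by (simp add: nbrs_del)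
    then show False using K(2) v(1) by force
  qed
  let ?B = "{(a2, a), (c, a1), (b2, b), (d, b1)}"
  \<comment> \<open>The neighbours gained at \<open>v\<close> are charged to those lost in
    \<open>W\<close>. An additional neighbour outside \<open>K\<close> would leave too few to make
    \<open>v\<close> cubic in \<open>K\<close>.\<close>
  have leave: "w \<in> K \<or> (v, w) \<in> ?B" if v: "v \<in> K" and w: "w \<in> N v" for v w
  proof (rule ccontr)
    assume n: "\<not> (w \<in> K \<or> (v, w) \<in> ?B)"
    let ?T = "{w. (v, w) \<in> ?B}"
    have T: "?T \<subseteq> N v" "?T \<subseteq> ?W" using sym by auto
    have finT: "finite ?T" by (rule finite_subset[OF T(1) finN])
    have "card (nbrs ?F v \<inter> K) \<le> card ((N v \<inter> K) \<union> nbrs {{a2, c}, {b2, d}} v)"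
    proof (rule card_mono)
      have "finite (nbrs {{a2, c}, {b2, d}} v)"
        by (rule finite_subset[of _ "{a2, c, b2, d}"]) (auto simp: nbrs_def doubleton_eq_iff)
      then show "finite (N v \<inter> K \<union> nbrs {{a2, c}, {b2, d}} v)" by simp
      show "nbrs ?F v \<inter> K \<subseteq> N v \<inter> K \<union> nbrs {{a2, c}, {b2, d}} v"
        unfolding nF using nbrs_mono[OF del_subset, of E ?W v] by blast
    qed
    also have "\<dots> \<le> card (N v \<inter> K) + card (nbrs {{a2, c}, {b2, d}} v)" by (rule card_Un_le)
    also have "\<dots> \<le> card (N v \<inter> K) + card ?T"
      using added_degree[of a a1 b b1 a2 c b2 d v] D5 by simp
    also have "\<dots> = card (N v \<inter> K \<union> ?T)"
      using T KW finT by (intro card_Un_disjoint[symmetric]) auto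
    also have "\<dots> < card (N v)"
      by (rule psubset_card_mono) (use n w T in auto)
    finally show False using K(2) v N_le3[of v] by auto
  qed
  show ?thesis
    by (rule exI[of _ K]) (use c1 c2 KW leave in \<open>auto simp: quad_cut_def\<close>)
qed

text \<open>A blocking set for \<open>c\<close> makes the other outer neighbour \<open>c'\<close> of
  \<open>a1\<close> an admissible replacement. If a two-edge cut blocked \<open>c'\<close> in turn,
  it would meet \<open>K\<close> in a set left only through \<open>a2 a\<close>.\<close>

lemma quad_cut_other:
  assumes K: "quad_cut E {x, a, a1, b, b1} {(a2, a), (c, a1), (b2, b), (d, b1)} K"
    and Na: "N a = {x, a1, a2}" and Nb: "N b = {x, b1, b2}" and D: "distinct [x, a1, a2]" "distinct [x, b1, b2]"
    and c: "c \<in> N a1" "c \<noteq> a" and d: "d \<in> N b1" "d \<noteq> b" and c': "c' \<in> N a1" "c' \<noteq> a" "c' \<noteq> c"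
  shows "c' \<notin> K" "c' \<noteq> a2" "c' \<notin> N a2" "\<not> two_cut E K' a2 a c' a1"
proof -
  have m: "a1 \<in> N a" "a2 \<in> N a" "b1 \<in> N b" "b2 \<in> N b" using Na Nb by simp_all
  have ne: "a1 \<noteq> x" "a2 \<noteq> x" "b1 \<noteq> x" "b2 \<noteq> x" "a1 \<noteq> a2" "b1 \<noteq> b2" using D by auto
  have sym: "a \<in> N a2" "a1 \<in> N c" "b \<in> N b2" "b1 \<in> N d" "a1 \<in> N c'" using m c(1) d(1) c'(1) N_sym by auto
  have KW: "a2 \<in> K" "c \<in> K" "b2 \<in> K" "d \<in> K" "a \<notin> K" "a1 \<notin> K" "b \<notin> K" "b1 \<notin> K"
    using K by (auto simp: quad_cut_def)
  have ab1: "a1 \<noteq> a" "b1 \<noteq> b" "a1 \<noteq> b" "a1 \<noteq> b1"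
    using m basic(4,5) common[OF m(1)] ne by (metis N_irrefl)+
  have c'W: "c' \<notin> {x, a, a1, b, b1}" by (rule outer_nbr[OF m(1) ne(1) c'(1,2) m(3) ne(3)])
  have a2: "a2 \<noteq> b2" "a2 \<noteq> d"
    using common[OF m(2)] m(4) ne no_cross[OF m(2) ne(2) m(3) ne(3)] sym(4) d(1) by (metis N_sym)+
  show nK: "c' \<notin> K"
  proof
    assume "c' \<in> K"
    from quad_cutD[OF K this sym(5)] show False using KW c'(3) ab1 by auto
  qed
  show "c' \<noteq> a2" using nK KW by auto
  show "c' \<notin> N a2"
  proof
    assume "c' \<in> N a2"
    from quad_cutD[OF K KW(1) this] show False using nK c'W by auto
  qed
  show "\<not> two_cut E K' a2 a c' a1"
  proof
    assume K': "two_cut E K' a2 a c' a1"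
    have aK: "a \<notin> K'" "a1 \<notin> K'" "a2 \<in> K'" using K' by (auto simp: two_cut_def)
    \<comment> \<open>Since \<open>a2 a\<close> and \<open>c' a1\<close> are the only boundary edges
      of \<open>K'\<close>, non-membership spreads from \<open>a\<close> over \<open>x\<close>,
      \<open>b\<close>, \<open>b1\<close>, \<open>b2\<close> to \<open>d\<close>, and from
      \<open>a1\<close> to \<open>c\<close>.\<close>
    have xK: "x \<notin> K'"
    proof
      assume "x \<in> K'"
      moreover have "a \<in> N x" by (simp add: Nx)
      ultimately show False using two_cutD[OF K'] aK ne c'W by fastforce
    qed
    have bK: "b \<notin> K'"
    proof
      assume "b \<in> K'"
      from two_cutD[OF K' this basic(3)] show False using xK basic(6) ne by auto
    qed
    have b1K: "b1 \<notin> K'"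
    proof
      assume "b1 \<in> K'"
      moreover have "b \<in> N b1" using m(3) by (rule N_sym)
      ultimately show False using two_cutD[OF K'] bK ab ab1 by metis
    qed
    have b2K: "b2 \<notin> K'"
    proof
      assume "b2 \<in> K'"
      from two_cutD[OF K' this sym(3)] show False using bK ab ab1 by auto
    qed
    have dK: "d \<notin> K'"
    proof
      assume "d \<in> K'"
      from two_cutD[OF K' this sym(4)] show False using b1K a2 ab1 by auto
    qed
    have cK: "c \<notin> K'"
    proof
      assume "c \<in> K'"
      from two_cutD[OF K' this sym(2)] show False using aK c'(3) ab1 by auto
    qed
    show False
    proof (rule no_bridge[of a2 "K \<inter> K'" a])
      show "w \<in> K \<inter> K' \<or> v = a2 \<and> w = a" if vw: "v \<in> K \<inter> K'" "w \<in> N v" for v w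
      proof -
        have v: "v \<in> K" "v \<in> K'" using vw(1) by auto
        have "v \<noteq> c" "v \<noteq> b2" "v \<noteq> d" "v \<noteq> c'" using v cK b2K dK nK by metis+
        then show ?thesis
          using quad_cutD[OF K v(1) vw(2)] two_cutD[OF K' v(2) vw(2)] by auto
      qed
    qed (use KW aK sym in auto)
  qed
qed

text \<open>There are blocking sets \<open>K1\<close>, \<open>K2\<close>, \<open>K3\<close> for the
  choices (c, d), (c, d') and (c', d'). Points of \<open>K1\<close> and \<open>K2\<close> outside
  \<open>K3\<close> are none of \<open>a2\<close>, \<open>b2\<close>, \<open>d\<close>,
  \<open>d'\<close>, so the difference is left only through \<open>c a1\<close>, a bridge.\<close>

lemma two_lifts:
  assumes Na: "N a = {x, a1, a2}" and Nb: "N b = {x, b1, b2}" and D: "distinct [x, a1, a2]" "distinct [x, b1, b2]"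
    and a1: "N a1 = {a, q, r}" "distinct [a, q, r]" "q \<noteq> a2" "q \<notin> N a2"
    and b1: "N b1 = {b, s, t}" "distinct [b, s, t]" "s \<noteq> b2" "s \<notin> N b2"
  shows False
proof -
  interpret S: degree_two V E x b a by (rule swap)
  have "q \<noteq> r" "a \<noteq> q" "a \<noteq> r" "s \<noteq> t" "b \<noteq> s" "b \<noteq> t" using a1(2) b1(2) by auto
  with lift_choice[OF a1(1) _ _ _ a1(3,4)] lift_choice[OF b1(1) _ _ _ b1(3,4)]
  obtain c c' d d' where
    c: "{c, c'} = {q, r}" "c \<noteq> a2" "c \<notin> N a2" "\<And>K. \<not> two_cut E K a2 a c a1" and
    d: "{d, d'} = {s, t}" "d \<noteq> b2" "d \<notin> N b2" "\<And>K. \<not> two_cut E K b2 b d b1" by metis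
  have cs: "c \<in> N a1" "c \<noteq> a" "c' \<in> N a1" "c' \<noteq> a" "c' \<noteq> c"
    using c(1) a1(1,2) by (auto simp: doubleton_eq_iff)
  have ds: "d \<in> N b1" "d \<noteq> b" "d' \<in> N b1" "d' \<noteq> b" "d' \<noteq> d"
    using d(1) b1(1,2) by (auto simp: doubleton_eq_iff)
  obtain K1 where K1: "quad_cut E {x, a, a1, b, b1} {(a2, a), (c, a1), (b2, b), (d, b1)} K1"
    using ex_quad_cut[OF Na Nb D cs(1,2) c(2-4) ds(1,2) d(2-4)] by auto
  have sw: "quad_cut E {x, b, b1, a, a1} {(b2, b), (d, b1), (a2, a), (c, a1)} K1"
    using K1 by (auto simp: quad_cut_def)
  note c' = quad_cut_other[OF K1 Na Nb D cs(1,2) ds(1,2) cs(3-5)]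
  note d' = S.quad_cut_other[OF sw Nb Na D(2,1) ds(1,2) cs(1,2) ds(3-5)]
  obtain K2 where K2: "quad_cut E {x, a, a1, b, b1} {(a2, a), (c, a1), (b2, b), (d', b1)} K2"
    using ex_quad_cut[OF Na Nb D cs(1,2) c(2-4) ds(3,4) d'(2-4)] by auto
  obtain K3 where K3: "quad_cut E {x, a, a1, b, b1} {(a2, a), (c', a1), (b2, b), (d', b1)} K3"
    using ex_quad_cut[OF Na Nb D cs(3,4) c'(2-4) ds(3,4) d'(2-4)] by auto
  have cK3: "c \<notin> K3" by (rule quad_cut_other(1)[OF K3 Na Nb D cs(3,4) ds(3,4) cs(1,2)]) (use cs in auto)
  have sw2: "quad_cut E {x, b, b1, a, a1} {(b2, b), (d', b1), (a2, a), (c, a1)} K2"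
    using K2 by (auto simp: quad_cut_def)
  have dK2: "d \<notin> K2"
    by (rule S.quad_cut_other(1)[OF sw2 Nb Na D(2,1) ds(3,4) cs(1,2) ds(1,2)]) (use ds in auto)
  have W: "K1 \<inter> {a, a1, b, b1} = {}" using K1 by (auto simp: quad_cut_def)
  have K3m: "a2 \<in> K3" "b2 \<in> K3" using K3 by (auto simp: quad_cut_def)
  have cK: "c \<in> K1" "c \<in> K2" using K1 K2 by (auto simp: quad_cut_def)
  have a1c: "a1 \<in> N c" using cs(1) by (rule N_sym)
  show False
  proof (rule no_bridge[of c "K1 \<inter> K2 - K3" a1])
    show "w \<in> K1 \<inter> K2 - K3 \<or> v = c \<and> w = a1" if vw: "v \<in> K1 \<inter> K2 - K3" "w \<in> N v" for v w
    proof -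
      have v: "v \<in> K1" "v \<in> K2" "v \<notin> K3" using vw(1) by auto
      have ne: "v \<noteq> a2" "v \<noteq> b2" "v \<noteq> d" "v \<noteq> d'" using v K3m dK2 d'(1) by metis+
      have "w \<in> K1 \<or> v = c \<and> w = a1" "w \<in> K2 \<or> v = c \<and> w = a1"
        using quad_cutD[OF K1 v(1) vw(2)] quad_cutD[OF K2 v(2) vw(2)] ne by auto
      moreover have "w \<notin> K3"
      proof
        assume "w \<in> K3"
        from quad_cutD[OF K3 this N_sym[OF vw(2)]] show False using v W by auto
      qed
      ultimately show ?thesis by auto
    qed
  qed (use cK cK3 W a1c in auto)
qed

end

section \<open>Combining the two sides of a vertex of degree two\<close>

context degree_two
begin

text \<open>If neither further neighbour of \<open>b1\<close> can be joined to \<open>b2\<close>,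
  then each equals \<open>b2\<close> or is adjacent to it. The first leads to
  \<open>diamond\<close>, and if both are adjacent to \<open>b2\<close> the block appears.\<close>

lemma side_b:
  assumes "card (N b) \<noteq> 2" and no: "\<And>v. v \<in> N b \<Longrightarrow> v \<noteq> x \<Longrightarrow> card (N v) \<noteq> 2"
  obtains b1 b2 q r where "N b = {x, b1, b2}" "distinct [x, b1, b2]" "N b1 = {b, q, r}" "distinct [b, q, r]" "q \<noteq> b2" "q \<notin> N b2"
  | b1 b2 c c' z u where "b_block V E x a b b1 b2 c c' z u"
proof -
  have "card (N b) = 3" using assms(1) min_degree[of b] basic(3) N_V(2) by auto
  then obtain b1 b2 where Nb: "N b = {x, b1, b2}" "b1 \<noteq> x" "b2 \<noteq> x" "b1 \<noteq> b2"
    using card3_obtain[OF _ basic(3)] by blast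
  have m: "b1 \<in> N b" "b2 \<in> N b" using Nb by simp_all
  then have sym: "b \<in> N b1" "b \<in> N b2" by (auto intro: N_sym)
  have "card (N b1) = 3" using no[OF m(1) Nb(2)] min_degree[of b1] N_V(1)[OF m(1)] by auto
  then obtain q r where Nb1: "N b1 = {b, q, r}" "q \<noteq> b" "r \<noteq> b" "q \<noteq> r"
    using card3_obtain[OF _ sym(1)] by blast
  have qrN: "b1 \<in> N q" "b1 \<in> N r" using Nb1 N_sym[of q b1] N_sym[of r b1] by auto
  have bne: "b \<noteq> b1" "b \<noteq> b2" using m by (metis N_irrefl)+
  have "b1 \<notin> N x" using Nb(1) bne(1) m(1) basic(4) by (auto simp: Nx)
  then have qx: "q \<noteq> x" "r \<noteq> x" using qrN by auto
  have qb1: "q \<noteq> b1" "r \<noteq> b1" using qrN by (metis N_irrefl)+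
  have D: "distinct [x, b1, b2]" "distinct [b, q, r]" "distinct [b, r, q]" using Nb Nb1 by auto
  have Nb1': "N b1 = {b, r, q}" using Nb1 by auto
  consider "q \<noteq> b2" "q \<notin> N b2" | "r \<noteq> b2" "r \<notin> N b2" | "q = b2" "r \<in> N b2" | "r = b2" "q \<in> N b2"
    | "q \<noteq> b2" "r \<noteq> b2" "q \<in> N b2" "r \<in> N b2" using Nb1(4) by blast
  then show ?thesis
  proof cases
    case 1
    then show ?thesis using that(1)[OF Nb(1) D(1) Nb1(1) D(2)] by simp
  next
    case 2
    then show ?thesis using that(1)[OF Nb(1) D(1) Nb1' D(3)] by simp
  next
    case 3
    have False by (rule diamond[OF Nb(1) Nb1(1)[unfolded 3(1)] 3(2)])
        (use 3 Nb Nb1 qx qb1 bne basic(7) in auto)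
    then show ?thesis ..
  next
    case 4
    have False by (rule diamond[OF Nb(1) Nb1'[unfolded 4(1)] 4(2)])
        (use 4 Nb Nb1 qx qb1 bne basic(7) in auto)
    then show ?thesis ..
  next
    case 5
    have Nb2: "N b2 = {b, q, r}"
      by (rule three_nbrs[OF sym(2) 5(3,4)]) (use Nb1 in auto)
    have cross: "a' \<notin> N b'" if "a' \<in> N a" "b' \<in> N b" "a' \<noteq> x" "b' \<noteq> x" for a' b'
      using no_cross[OF that(1,3,2,4)] N_sym[of a' b'] by blast
    have D6: "distinct [x, b, b1, b2, q, r]"
      using Nb(2-4) Nb1(2-4) 5(1,2) qx qb1 bne basic(7) by auto
    obtain z u where zu: "N q = {b1, b2, z}" "N r = {b1, b2, z}" "N z = {q, r, u}"
      "distinct [x, a, b, b1, b2, q, r, z]" "u \<notin> {x, b, b1, b2, q, r, z}"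
      by (rule block[OF Nb(1) Nb1(1) Nb2 D6 cross])
    have "b_block V E x a b b1 b2 q r z u"
      by unfold_locales (rule Nb(1) Nb1(1) Nb2 zu)+
    then show ?thesis using that(2) by blast
  qed
qed

lemma saving:
  assumes "card (N b) = 2 \<or> (\<exists>v\<in>N b. v \<noteq> x \<and> card (N v) = 2)"
  obtains v t where "v \<in> N b" "v \<noteq> x" "t \<in> {b, v}" "card (N t) = 2"
  using assms second_nbr[OF basic(3)] by blast

text \<open>The side of \<open>a\<close> gets its second unit from a vertex of degree 2, the side of
  \<open>b\<close> from an added edge: 4 + 2 + 1 + 1 = 8.\<close>

lemma saving_lift:
  assumes v: "v \<in> N a" "v \<noteq> x" and t: "t \<in> {a, v}" "card (N t) = 2"
    and Nb: "N b = {x, b1, b2}" "distinct [x, b1, b2]"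
    and b1: "N b1 = {b, q, r}" "distinct [b, q, r]" "q \<noteq> b2" "q \<notin> N b2"
  shows False
proof -
  interpret S: degree_two V E x b a by (rule swap)
  have "q \<noteq> r" "b \<noteq> q" "b \<noteq> r" using b1(2) by auto
  from lift_choice[OF b1(1) this b1(3,4)] obtain c c' where
    c: "{c, c'} = {q, r}" "c \<noteq> b2" "c \<notin> N b2" "\<And>K. \<not> two_cut E K b2 b c b1" by metis
  have m: "b1 \<in> N b" "b2 \<in> N b" "b1 \<noteq> x" "b2 \<noteq> x" "b1 \<noteq> b2" using Nb by auto
  have cN: "c \<in> N b1" "c \<noteq> b" using c(1) b1(1,2) by auto
  have cW: "c \<notin> {x, b, b1, a, v}" by (rule S.outer_nbr[OF m(1,3) cN v])
  have "v \<noteq> b1" "v \<noteq> b2" using common[OF v(1)] v(2) m by metis+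
  moreover have "v \<noteq> a" "v \<noteq> b" "b1 \<noteq> a" "b1 \<noteq> b" "b2 \<noteq> b" "b2 \<noteq> a" using v(1) m basic(4,5) by (metis N_irrefl)+
  ultimately have D: "distinct [x, a, b, v, b1, b2, c]"
    using cW c(2) v(2) m basic(6,7) ab by auto
  have sym: "b \<in> N b2" "b1 \<in> N c" using m cN N_sym by auto
  show False
    by (rule lift1[of "[(a, v), (b, b1)]" "[x]" "[(a, v), (b, b1)]" "[t]" "[(a, v), (b, b2), (b1, c)]" b2 c b b1])
      (use apart[OF D] c(3,4) v t sym cN basic(1) in \<open>auto simp: Nx Nb(1) doubleton_eq_iff\<close>)
qed

lemma saving_saving:
  assumes v: "v \<in> N a" "v \<noteq> x" "t \<in> {a, v}" "card (N t) = 2"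
    and w: "w \<in> N b" "w \<noteq> x" "s \<in> {b, w}" "card (N s) = 2"
  shows False
proof -
  have "v \<noteq> w" using common[OF v(1)] v(2) w by metis
  moreover have "v \<noteq> a" "v \<noteq> b" "w \<noteq> b" "w \<noteq> a" using v(1) w(1) basic(4,5) by (metis N_irrefl)+
  ultimately have D: "distinct [x, a, b, v, w]" using v w basic(6,7) ab by auto
  show False
    by (rule direct[of "[(a, v), (b, w)]" "[x]" "[(a, v), (b, w)]" "[t, s]"])
      (use apart[OF D] v w basic(1) in \<open>auto simp: Nx doubleton_eq_iff\<close>)
qed

text \<open>With a block at \<open>b\<close>, the side of \<open>a\<close> is left with a degree-2
  vertex, an added edge or a second block; each completes a reduction.\<close>

lemma block_impossible:
  assumes B: "b_block V E x a b b1 b2 c c' z u"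
  shows False
proof -
  interpret B: b_block V E x a b b1 b2 c c' z u by (rule B)
  interpret S: degree_two V E x b a by (rule swap)
  have no: "v \<in> N a \<Longrightarrow> v \<noteq> x \<Longrightarrow> card (N v) \<noteq> 2" for v by (rule B.no_saving)
  obtain v where "v \<in> N a" "v \<noteq> x" using second_nbr[OF basic(2)] by blast
  then have "card (N a) \<noteq> 2" by (rule B.no_saving)
  then consider a1 a2 q r where "N a = {x, a1, a2}" "N a1 = {a, q, r}" "distinct [x, a1, a2]"
      "distinct [a, q, r]" "q \<noteq> a2" "q \<notin> N a2"
    | a1 a2 e e' y v where "b_block V E x b a a1 a2 e e' y v"
    using S.side_b[OF _ no] by metis
  then show False
  proof cases
    case 1
    then show False by (rule B.no_lift)
  next
    case 2
    then show False by (rule two_blocks[OF B])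
  qed
qed

lemma impossible: False
proof -
  interpret S: degree_two V E x b a by (rule swap)
  let ?sav = "\<lambda>b. card (N b) = 2 \<or> (\<exists>v\<in>N b. v \<noteq> x \<and> card (N v) = 2)"
  show False
  proof (cases "?sav a")
    case a: True
    from S.saving[OF a] obtain v t where v: "v \<in> N a" "v \<noteq> x" "t \<in> {a, v}" "card (N t) = 2" by blast
    show False
    proof (cases "?sav b")
      case True
      from saving[OF True] show False using saving_saving[OF v] by blast
    next
      case False
      show False
        by (rule side_b) (use False saving_lift[OF v] block_impossible in blast)+
    qed
  next
    case a: False
    show False
    proof (cases "?sav b")
      case b: True
      from saving[OF b] obtain v t where v: "v \<in> N b" "v \<noteq> x" "t \<in> {b, v}" "card (N t) = 2" by blast
      show False
        by (rule S.side_b) (use a S.saving_lift[OF v] S.block_impossible in blast)+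
    next
      case b: False
      have na: "card (N a) \<noteq> 2" "\<And>v. v \<in> N a \<Longrightarrow> v \<noteq> x \<Longrightarrow> card (N v) \<noteq> 2" using a by auto
      have nb: "card (N b) \<noteq> 2" "\<And>v. v \<in> N b \<Longrightarrow> v \<noteq> x \<Longrightarrow> card (N v) \<noteq> 2" using b by auto
      consider a1 a2 q r where "N a = {x, a1, a2}" "distinct [x, a1, a2]" "N a1 = {a, q, r}"
          "distinct [a, q, r]" "q \<noteq> a2" "q \<notin> N a2"
        | a1 a2 e e' y v where "b_block V E x b a a1 a2 e e' y v"
        using S.side_b[OF na] by metis
      then show False
      proof cases
        case A: 1
        consider b1 b2 q r where "N b = {x, b1, b2}" "distinct [x, b1, b2]" "N b1 = {b, q, r}"
            "distinct [b, q, r]" "q \<noteq> b2" "q \<notin> N b2"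
          | b1 b2 c c' z u where "b_block V E x a b b1 b2 c c' z u"
          using side_b[OF nb] by metis
        then show False
        proof cases
          case B: 1
          show False by (rule two_lifts[OF A(1) B(1) A(2) B(2) A(3-6) B(3-6)])
        next
          case 2
          then show False by (rule block_impossible)
        qed
      next
        case 2
        then show False by (rule S.block_impossible)
      qed
    qed
  qed
qed

end

lemma (in min_counterexample) impossible: False
proof -
  obtain x where "card (N x) = 2" using ex_degree2 by blast
  then obtain a b where "N x = {a, b}" "a \<noteq> b" by (auto simp: card_2_iff)
  then interpret degree_two V E x a b by unfold_locales
  show False by (rule impossible)
qed

theorem meets_bound_if_cubic_free:
  assumes "sgraph V E" "subcubic E" "cubic_free E"
  shows "meets_bound V E"
  using assms
proof (induction "card V" arbitrary: V E rule: less_induct)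
  case less
  show ?case
  proof (rule ccontr)
    assume "\<not> meets_bound V E"
    then interpret min_counterexample V E
      using less by unfold_locales auto
    show False by (rule impossible)
  qed
qed

section \<open>Cubic graphs\<close>

definition is_K33 :: "'a set \<Rightarrow> 'a set set \<Rightarrow> bool" where
  "is_K33 V E \<longleftrightarrow> (\<exists>A B. card A = 3 \<and> card B = 3 \<and> A \<inter> B = {} \<and> V = A \<union> B \<and>
    (\<forall>a\<in>A. nbrs E a = B) \<and> (\<forall>b\<in>B. nbrs E b = A))"

text \<open>Connectedness says that no nonempty proper vertex set is closed under neighbours. In
  this form it shows at once that proper induced subgraphs have no cubic component.\<close>

locale connected_cubic =
  fixes V :: "'a set" and E :: "'a set set"
  assumes sg: "sgraph V E" and ne: "V \<noteq> {}"
    and cubic: "\<And>v. v \<in> V \<Longrightarrow> card (nbrs E v) = 3"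
    and conn: "\<And>X. X \<subseteq> V \<Longrightarrow> X \<noteq> {} \<Longrightarrow> (\<And>v. v \<in> X \<Longrightarrow> nbrs E v \<subseteq> X) \<Longrightarrow> X = V"
begin

abbreviation N :: "'a \<Rightarrow> 'a set" where "N \<equiv> nbrs E"

lemma finV: "finite V"
  using sg by (simp add: sgraph_def)

lemma finN [simp]: "finite (N v)"
  by (rule sgraph_nbrs(3)[OF sg])

lemma N_irrefl [simp]: "v \<notin> N v"
  by (rule sgraph_nbrs(2)[OF sg])

lemma N_V: "w \<in> N v \<Longrightarrow> w \<in> V" "w \<in> N v \<Longrightarrow> v \<in> V"
  using sgraph_nbrs(1,4)[OF sg] by auto

lemma N_sym: "w \<in> N v \<Longrightarrow> v \<in> N w"
  by (simp add: nbrs_sym)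

lemma sc: "subcubic E"
  unfolding subcubic_def
proof
  fix v
  show "card (N v) \<le> 3"
  proof (cases "v \<in> V")
    case False
    then have "N v = {}" using N_V by auto
    then show ?thesis by simp
  qed (use cubic in simp)
qed

lemma closed_eq:
  assumes "K \<noteq> {}" "\<forall>v\<in>K. card (N v \<inter> K) = 3"
  shows "K = V"
proof (rule conn)
  have full: "N v \<subseteq> K" "v \<in> V" if "v \<in> K" for v
  proof -
    have c: "card (N v \<inter> K) = 3" using assms(2) that by blast
    moreover have "card (N v) \<le> 3" using sc by (simp add: subcubic_def)
    ultimately have "N v \<inter> K = N v" by (intro card_seteq) auto
    then show "N v \<subseteq> K" by blast
    have "N v \<noteq> {}" using c by auto
    then show "v \<in> V" using N_V by auto
  qed
  then show "K \<subseteq> V" "\<And>v. v \<in> K \<Longrightarrow> N v \<subseteq> K" by auto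
qed (rule assms(1))

lemma cubic_free_ind:
  assumes "Y \<subset> V" shows "cubic_free (ind E Y)"
  unfolding cubic_free_def
proof (intro allI impI, rule ccontr)
  fix K :: "'a set" assume K: "K \<noteq> {}" "\<not> (\<exists>v\<in>K. card (nbrs (ind E Y) v \<inter> K) \<noteq> 3)"
  have KY: "K \<subseteq> Y"
  proof
    fix v assume "v \<in> K"
    then have "card (nbrs (ind E Y) v \<inter> K) = 3" using K(2) by blast
    then have "nbrs (ind E Y) v \<noteq> {}" by auto
    then show "v \<in> Y" by (auto simp: nbrs_ind split: if_splits)
  qed
  have "nbrs (ind E Y) v \<inter> K = N v \<inter> K" if "v \<in> K" for v
    using that KY by (auto simp: nbrs_ind)
  then have "K = V" using closed_eq K by auto
  then show False using KY assms by auto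
qed

lemma cubic_free_del:
  assumes "w \<in> W" "w \<in> V" shows "cubic_free (del E W)"
proof -
  have "cubic_free (ind E (V - W))" by (rule cubic_free_ind) (use assms in auto)
  moreover have "del E W = ind E (V - W)"
    using sg by (auto simp: del_def ind_def sgraph_def)
  ultimately show ?thesis by simp
qed

lemma meets_bound_proper: "Y \<subset> V \<Longrightarrow> meets_bound Y (ind E Y)"
  by (intro meets_bound_if_cubic_free sgraph_ind[OF sg] subcubic_mono[OF sg sc ind_subset] cubic_free_ind) auto

lemma third_nbr:
  assumes "p \<in> N v" "q \<in> N v" "p \<noteq> q"
  obtains r where "N v = {p, q, r}" "r \<noteq> p" "r \<noteq> q"
  using card3_obtain2[OF cubic assms(1-3)] N_V(2)[OF assms(1)] by blast

lemma other_nbr: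
  assumes "p \<in> N v" obtains q where "q \<in> N v" "q \<noteq> p"
  using card3_obtain[OF cubic assms] N_V(2)[OF assms] by auto

text \<open>The slack 2 is what removing one edge with its ends and adding one edge costs in a cubic
  graph. Doubled, it gives 12 \<gamma> \<le> 5n + 4, while the claim allows 5n + 6.\<close>

definition nearly_meets_bound :: bool where
  "nearly_meets_bound \<longleftrightarrow> (\<exists>M. dominating_matching E M \<and> 6 * card M + card E \<le> 4 * card V + 2)"

lemma bridge:
  assumes "u \<in> X" "v \<notin> X" "v \<in> N u"
    and cross: "\<And>p q. p \<in> X \<Longrightarrow> q \<in> N p \<Longrightarrow> q \<in> X \<or> p = u \<and> q = v"
  shows nearly_meets_bound
proof -
  obtain u' where u': "u' \<in> N u" "u' \<noteq> v" using other_nbr[OF assms(3)] .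
  obtain v' where v': "v' \<in> N v" "v' \<noteq> u" using other_nbr[OF N_sym[OF assms(3)]] .
  have "meets_bound V E"
  proof (rule meets_bound_if_bridge[OF sg sc, of "X \<inter> V" u v u' v'])
    show "q \<in> X \<inter> V \<or> p = u \<and> q = v" if "p \<in> X \<inter> V" "q \<in> N p" for p q
      using cross[of p q] that N_V(1)[of q p] by auto
    show "meets_bound Y (ind E Y)" if "Y \<subset> V" for Y by (rule meets_bound_proper[OF that])
  qed (use assms(1-3) u' v' N_V[OF assms(3)] in auto)
  then show ?thesis by (force simp: meets_bound_def nearly_meets_bound_def)
qed

lemma lift:
  assumes v: "v \<in> N u" and p: "p \<in> N u" "p \<noteq> v" and q: "q \<in> N v" "q \<noteq> u" and pq: "p \<noteq> q" "q \<notin> N p"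
    and no: "\<And>K. \<not> two_cut E K p u q v"
  shows nearly_meets_bound
proof -
  let ?W = "{u, v}" and ?L = "{{p, q}}"
  have uv: "u \<noteq> v" "u \<in> V" "v \<in> V" "p \<in> V" "q \<in> V" using v p q N_V N_irrefl by metis+
  have pW: "p \<notin> ?W" "q \<notin> ?W" using p q N_irrefl by auto
  have sym: "u \<in> N p" "v \<in> N q" using p q N_sym by auto
  have E: "{u, v} \<in> E" using v by (simp add: nbrs_def)
  have LE: "?L \<inter> E = {}" using pq by (auto simp: nbrs_def)
  have LV: "f \<subseteq> V - ?W \<and> card f = 2" if "f \<in> ?L" for f using that uv pW pq(1) by auto
  have deg: "card (nbrs ?L w) \<le> card (N w \<inter> ?W)" for w
  proof -
    have "nbrs ?L w = (if w = p then {q} else if w = q then {p} else {})"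
      using pq(1) nbrs_insert[of p q "{}" w] by (auto simp: nbrs_def)
    moreover have "card (N w \<inter> ?W) \<ge> 1" if "N w \<inter> ?W \<noteq> {}"
      using that by (simp add: Suc_leI card_gt_0_iff)
    ultimately show ?thesis using sym by auto
  qed
  have free: "cubic_free (del E ?W \<union> ?L)"
  proof (rule ccontr)
    assume "\<not> cubic_free (del E ?W \<union> ?L)"
    then obtain K where K: "K \<noteq> {}" "\<forall>v\<in>K. card (nbrs (insert {p, q} (del E ?W)) v \<inter> K) = 3"
      by (auto simp: cubic_free_def)
    have "two_cut E K p u q v"
      by (rule two_cut_if_cubic(1)[OF sg sc cubic_free_del K pq(1) pW sym(1) _ sym(2)]) (use uv in auto)
    then show False using no by simp
  qed
  have "meets_bound (V - ?W) (del E ?W \<union> ?L)"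
    by (rule meets_bound_if_cubic_free[OF sgraph_reduced[OF sg LV] subcubic_reduced[OF sg sc LV deg] free])
  then obtain M' where M': "dominating_matching (del E ?W \<union> ?L) M'"
      "6 * card M' + card (del E ?W \<union> ?L) \<le> 4 * card (V - ?W)"
    unfolding meets_bound_def by blast
  have "\<exists>M. dominating_matching E M \<and> card M \<le> card M' + 1"
  proof (rule extend_matching[OF sg M'(1) LE])
    fix X :: "'a set set" assume X: "X \<subseteq> ?L"
    show "\<exists>Y. Y \<subseteq> E \<and> disjoint Y \<and> \<Union>X \<subseteq> \<Union>Y \<and> \<Union>Y \<subseteq> ?W \<union> \<Union>X \<and> card Y \<le> 1 + card X \<and>
        (\<forall>e\<in>E. e \<inter> ?W \<noteq> {} \<longrightarrow> e \<inter> \<Union>Y \<noteq> {})"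
    proof (cases "X = {}")
      case True
      then show ?thesis using E by (intro exI[of _ "{{u, v}}"]) auto
    next
      case False
      then have X: "X = ?L" using X by auto
      have "{u, p} \<in> E" "{v, q} \<in> E" using p q by (auto simp: nbrs_def)
      then show ?thesis using X uv(1) pW pq(1)
        by (intro exI[of _ "{{u, p}, {v, q}}"]) (auto simp: pairwise_insert disjnt_def card_insert_if)
    qed
  qed simp
  then obtain M where M: "dominating_matching E M" "card M \<le> card M' + 1" by blast
  have "card E + card {{u, v}} \<le> card (del E ?W) + (\<Sum>s\<in>?W. card (N s))"
    by (rule edges_at_count[OF sg]) (use E in auto)
  \<comment> \<open>The ends of \<open>uv\<close> take away 3 + 3 - 1 edges. The loss is 6 for the
    matching edge plus 5, minus 8 for the vertices and 1 for the added edge, that is 2.\<close>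
  then have "card E \<le> card (del E ?W) + 5" using uv cubic by simp
  moreover have "card (del E ?W \<union> ?L) = card (del E ?W) + 1"
    using LE del_subset[of E ?W] finite_subset[OF del_subset sgraph_finite_edges[OF sg]]
    by (subst card_Un_disjoint) auto
  moreover have "card (V - ?W) = card V - 2" "2 \<le> card V"
    using uv finV card_mono[of V ?W] by (auto simp: card_Diff_subset)
  ultimately have "6 * card M + card E \<le> 4 * card V + 2" using M'(2) M(2) by linarith
  then show ?thesis using M(1) unfolding nearly_meets_bound_def by blast
qed

text \<open>The argument of \<open>lift_choice\<close>, except that the bridge from two cuts gives
  the bound here rather than a contradiction.\<close>

lemma lift':
  assumes v: "v \<in> N u" and p: "p \<in> N u" "p \<noteq> v" and q: "q \<in> N v" "q \<noteq> u" and pq: "p \<noteq> q" "q \<notin> N p"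
  shows nearly_meets_bound
proof (cases "\<exists>K. two_cut E K p u q v")
  case False
  then show ?thesis using lift[OF v p q pq] by auto
next
  case True
  then obtain K where K: "two_cut E K p u q v" ..
  have uv: "u \<in> N v" "u \<noteq> v" using v N_sym by (auto dest: N_irrefl[THEN notE])
  obtain r where r: "N v = {u, q, r}" "r \<noteq> u" "r \<noteq> q" using third_nbr[OF uv(1) q(1) q(2)[symmetric]] .
  have rN: "r \<in> N v" "v \<in> N r" "r \<noteq> v" using r(1) N_sym[of r v] N_irrefl[of v] by auto
  have rK: "r \<notin> K" "r \<noteq> p" "r \<notin> N p"
    using two_cut_avoids[OF K rN(2) _ uv(2)] r rN by auto
  show ?thesis
  proof (cases "\<exists>K'. two_cut E K' p u r v")
    case False
    then show ?thesis using lift[OF v p rN(1) r(2) rK(2)[symmetric] rK(3)] by auto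
  next
    case True
    then obtain K' where K': "two_cut E K' p u r v" ..
    have qK': "q \<notin> K'"
      using two_cut_avoids(1)[OF K' N_sym[OF q(1)] _ uv(2)] r q by (metis N_irrefl empty_iff insert_iff)
    show ?thesis
    proof (rule bridge[of p "K \<inter> K'" u])
      show "w \<in> K \<inter> K' \<or> x = p \<and> w = u" if xw: "x \<in> K \<inter> K'" "w \<in> N x" for x w
      proof -
        have x: "x \<in> K" "x \<in> K'" using xw(1) by auto
        have "x \<noteq> q" "x \<noteq> r" using x qK' rK by auto
        then show ?thesis using two_cutD[OF K x(1) xw(2)] two_cutD[OF K' x(2) xw(2)] by auto
      qed
    qed (use K K' in \<open>auto simp: two_cut_def\<close>)
  qed
qed

lemma nearly_meets_bound_or_K33:
  "nearly_meets_bound \<or> is_K33 V E"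
proof (cases nearly_meets_bound)
  case ng: False
  have P4: "p = q \<or> q \<in> N p" if "v \<in> N u" "p \<in> N u" "p \<noteq> v" "q \<in> N v" "q \<noteq> u" for u v p q
    using lift'[OF that] ng by blast
  obtain u where u: "u \<in> V" using ne by auto
  then have "N u \<noteq> {}" using cubic[OF u] by auto
  then obtain v where v: "v \<in> N u" by auto
  obtain p1 p2 where Nu: "N u = {v, p1, p2}" "p1 \<noteq> v" "p2 \<noteq> v" "p1 \<noteq> p2"
    using card3_obtain[OF cubic[OF u] v] by blast
  have uv: "u \<in> N v" "v \<in> V" "u \<noteq> v" using v N_sym N_V N_irrefl by metis+
  obtain q1 q2 where Nv: "N v = {u, q1, q2}" "q1 \<noteq> u" "q2 \<noteq> u" "q1 \<noteq> q2"
    using card3_obtain[OF cubic[OF uv(2)] uv(1)] by blast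
  \<comment> \<open>A triangle \<open>u v p\<close> spreads: by \<open>P4\<close> the third
    neighbours of \<open>u\<close> and of \<open>v\<close> are adjacent to \<open>p\<close>, whose
    degree forces them to coincide, and K_4 results.\<close>
  have notri: False if Nu: "N u = {v, p, p'}" "p \<noteq> v" "p' \<noteq> v" "p \<noteq> p'" and Nv: "N v = {u, p, q'}" "p \<noteq> u" "q' \<noteq> u" "p \<noteq> q'"
    for p p' q'
  proof -
    have m: "p \<in> N u" "p' \<in> N u" "p \<in> N v" "q' \<in> N v" using Nu(1) Nv(1) by auto
    have pn: "u \<in> N p" "v \<in> N p" using m N_sym by auto
    have "p \<in> N p'" using P4[OF v m(2) Nu(3) m(3) Nv(2)] Nu(4) by auto
    then have p': "p' \<in> N p" by (rule N_sym)
    have q': "q' \<in> N p" using P4[OF v m(1) Nu(2) m(4) Nv(3)] Nv(4) by auto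
    have ne': "p' \<noteq> u" "q' \<noteq> v" using m N_irrefl by metis+
    obtain r where r: "N p = {u, v, r}" using third_nbr[OF pn uv(3)] .
    then have eq: "p' = q'" "r = p'" using p' q' ne' Nu(3) Nv(3) by auto
    have Np': "N p' = {u, v, p}"
    proof -
      have "u \<in> N p'" "v \<in> N p'" "p \<in> N p'" using m eq \<open>p \<in> N p'\<close> N_sym by auto
      then show ?thesis using third_nbr[OF _ _ uv(3)] Nu(2) Nv(2) by (metis insert_iff empty_iff)
    qed
    have pne: "p \<noteq> u" "p \<noteq> v" by fact+
    have V4: "{u, v, p, p'} = V"
    proof (rule conn)
      show "{u, v, p, p'} \<subseteq> V" using u uv m N_V(1) by auto
      show "N w \<subseteq> {u, v, p, p'}" if "w \<in> {u, v, p, p'}" for w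
        using that Nu(1) Nv(1) r Np' eq by auto
    qed simp
    have D: "distinct [u, v, p, p']" using uv(3) pne Nu(2-4) ne' by auto
    have c4: "card V = 4" unfolding V4[symmetric] using D by simp
    have "(\<Sum>s\<in>V. card (N s)) = (\<Sum>e\<in>E. card (e \<inter> V))" by (rule degree_sum[OF sg finV])
    moreover have "(\<Sum>e\<in>E. card (e \<inter> V)) = (\<Sum>e\<in>E. 2)"
      using sg by (intro sum.cong refl) (auto simp: sgraph_def Int_absorb2)
    ultimately have cE: "card E = 6" using cubic c4 by simp
    have "dominating_matching E {{u, v}, {p, p'}}"
      unfolding dominating_matching_def
    proof (intro conjI ballI)
      show "{{u, v}, {p, p'}} \<subseteq> E" using v p' by (auto simp: nbrs_def)
      show "disjoint {{u, v}, {p, p'}}" using D by (auto simp: pairwise_insert disjnt_def)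
      show "e \<inter> \<Union>{{u, v}, {p, p'}} \<noteq> {}" if "e \<in> E" for e
        by (rule sgraph_edge_cases[OF sg that]) (use V4 in auto)
    qed
    \<comment> \<open>Equality holds for K_4: 12 + 6 = 16 + 2.\<close>
    moreover have "6 * card {{u, v}, {p, p'}} + card E \<le> 4 * card V + 2"
      unfolding cE c4 by (simp add: card_insert_if)
    ultimately show False using ng unfolding nearly_meets_bound_def by blast
  qed
  have Nu': "N u = {v, p2, p1}" and Nv': "N v = {u, q2, q1}" using Nu Nv by auto
  have d: "p1 \<noteq> u" "p2 \<noteq> u" "q1 \<noteq> v" "q2 \<noteq> v" using Nu(1) Nv(1) N_irrefl by (metis insertCI)+
  have ne11: "p1 \<noteq> q1" using notri[OF Nu, of q2] Nv d by auto
  have ne12: "p1 \<noteq> q2" using notri[OF Nu, of q1] Nv Nv' d by auto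
  have ne21: "p2 \<noteq> q1" using notri[OF Nu' Nu(3,2) Nu(4)[symmetric], of q2] Nv d by auto
  have ne22: "p2 \<noteq> q2" using notri[OF Nu' Nu(3,2) Nu(4)[symmetric], of q1] Nv Nv' d by auto
  have m: "p1 \<in> N u" "p2 \<in> N u" "q1 \<in> N v" "q2 \<in> N v" using Nu(1) Nv(1) by auto
  have adj: "q1 \<in> N p1" "q2 \<in> N p1" "q1 \<in> N p2" "q2 \<in> N p2"
    using P4[OF v m(1) Nu(2) m(3) Nv(2)] P4[OF v m(1) Nu(2) m(4) Nv(3)]
      P4[OF v m(2) Nu(3) m(3) Nv(2)] P4[OF v m(2) Nu(3) m(4) Nv(3)] ne11 ne12 ne21 ne22 by auto
  have three: "N x = {a, b, c}" if x: "a \<in> N x" "b \<in> N x" "c \<in> N x" "a \<noteq> b" "a \<noteq> c" "b \<noteq> c" for x a b c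
  proof -
    obtain r where "N x = {a, b, r}" using third_nbr[OF x(1,2,4)] .
    then show ?thesis using x by auto
  qed
  have Np: "N p1 = {u, q1, q2}" "N p2 = {u, q1, q2}"
    by (rule three; use adj m N_sym Nv in auto)+
  have Nq: "N q1 = {v, p1, p2}" "N q2 = {v, p1, p2}"
    by (rule three; use adj m N_sym Nu in auto)+
  have un: "{u, q1, q2} \<union> {v, p1, p2} = V"
  proof (rule conn)
    show "{u, q1, q2} \<union> {v, p1, p2} \<subseteq> V" using u uv m N_V(1) by auto
    show "N w \<subseteq> {u, q1, q2} \<union> {v, p1, p2}" if "w \<in> {u, q1, q2} \<union> {v, p1, p2}" for w
      using that Nu(1) Nv(1) Np Nq by auto
  qed simp
  have cards: "card {u, q1, q2} = 3" "card {v, p1, p2} = 3" using Nu(2-4) Nv(2-4) by auto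
  have disj: "{u, q1, q2} \<inter> {v, p1, p2} = {}" using d ne11 ne12 ne21 ne22 uv(3) by auto
  have nbs: "\<forall>a\<in>{u, q1, q2}. N a = {v, p1, p2}" "\<forall>b\<in>{v, p1, p2}. N b = {u, q1, q2}"
    using Nu(1) Nv(1) Np Nq by simp_all
  show ?thesis unfolding is_K33_def
    by (rule disjI2, rule exI[of _ "{u, q1, q2}"], rule exI[of _ "{v, p1, p2}"])
      (intro conjI cards disj nbs un[symmetric])
qed simp

lemma double_edges: "2 * card E = 3 * card V"
proof -
  have "(\<Sum>s\<in>V. card (N s)) = (\<Sum>e\<in>E. card (e \<inter> V))" by (rule degree_sum[OF sg finV])
  also have "\<dots> = (\<Sum>e\<in>E. 2)"
    using sg by (intro sum.cong refl) (auto simp: sgraph_def Int_absorb2)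
  finally show ?thesis using cubic by simp
qed

end

section \<open>Transfer to digraphs\<close>

context pair_graph
begin

lemma parcs_sym: "(u, v) \<in> parcs G \<Longrightarrow> (v, u) \<in> parcs G"
  using pair_sym_arcs by (auto simp: symmetric_def dest: symD)

lemma nbrs_uedges: "nbrs (uedges G) v = {w. (v, w) \<in> parcs G}"
  by (auto simp: nbrs_def uedges_def doubleton_eq_iff dest: parcs_sym)

lemma sgraph_uedges: "sgraph (pverts G) (uedges G)"
proof -
  have "u \<noteq> v \<and> u \<in> pverts G \<and> v \<in> pverts G" if "(u, v) \<in> parcs G" for u v
    using that pair_no_loops[OF that] in_arcsD1 in_arcsD2 by auto
  then show ?thesis by (auto simp: sgraph_def uedges_def pair_finite_verts)
qed

lemma connected_cubicI:
  assumes "connected (with_proj G)" "cubic_graph G"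
  shows "connected_cubic (pverts G) (uedges G)"
proof
  show "sgraph (pverts G) (uedges G)" by (rule sgraph_uedges)
  have sc: "strongly_connected (with_proj (mk_symmetric (with_proj G)))"
    using assms(1) by (simp add: connected_def)
  show "pverts G \<noteq> {}" using sc by (auto simp: strongly_connected_def)
  show "card (nbrs (uedges G) v) = 3" if "v \<in> pverts G" for v
  proof -
    have "card {w. (v, w) \<in> parcs G} = card (out_arcs (with_proj G) v)"
    proof (rule bij_betw_same_card)
      show "bij_betw (Pair v) {w. (v, w) \<in> parcs G} (out_arcs (with_proj G) v)"
        by (auto simp: bij_betw_def inj_on_def out_arcs_def image_iff)
    qed
    also have "\<dots> = 3" using assms(2) that by (simp add: regular_graph_def out_degree_def)
    finally show ?thesis by (simp add: nbrs_uedges)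
  qed
  show "X = pverts G" if X: "X \<subseteq> pverts G" "X \<noteq> {}" "\<And>v. v \<in> X \<Longrightarrow> nbrs (uedges G) v \<subseteq> X" for X
  proof (rule equalityI[OF X(1)], rule subsetI)
    fix w assume w: "w \<in> pverts G"
    obtain u where u: "u \<in> X" using X(2) by auto
    have "u \<rightarrow>\<^sup>*\<^bsub>with_proj (mk_symmetric (with_proj G))\<^esub> w"
      using sc u w X(1) by (auto simp: strongly_connected_def)
    then have "(u, w) \<in> (arcs_ends (with_proj (mk_symmetric (with_proj G))))\<^sup>*"
      by (rule reachable_rtranclI)
    \<comment> \<open>Connectedness is strong connectedness of the symmetric closure, which adds no
      arcs here.\<close>
    also have "arcs_ends (with_proj (mk_symmetric (with_proj G))) = parcs G"
      using adj_mk_symmetric_eq pair_sym_arcs by simp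
    finally have "(u, w) \<in> (parcs G)\<^sup>*" .
    then show "w \<in> X"
    proof (induction rule: rtrancl_induct)
      case base
      then show ?case by (rule u)
    next
      case (step y z)
      then show ?case using X(3)[of y] by (auto simp: nbrs_uedges)
    qed
  qed
qed

lemma maximal_if_dominating:
  assumes "dominating_matching (uedges G) M"
  shows "maximal_matching G M"
proof -
  have M: "M \<subseteq> uedges G" "disjoint M" "\<forall>e\<in>uedges G. e \<inter> \<Union>M \<noteq> {}"
    using assms by (auto simp: dominating_matching_def)
  have "False" if M': "matching G M'" "M \<subset> M'" for M'
  proof -
    obtain e where e: "e \<in> M'" "e \<notin> M" using M'(2) by auto
    then have "e \<in> uedges G" using M'(1) by (auto simp: matching_def)
    then have "e \<inter> \<Union>M \<noteq> {}" using M(3) by blast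
    then obtain f where "f \<in> M" "e \<inter> f \<noteq> {}" by blast
    moreover have "f \<in> M'" "e \<noteq> f" using \<open>f \<in> M\<close> M'(2) e by auto
    ultimately show False using M'(1) e by (auto simp: matching_def)
  qed
  moreover have "matching G M"
    using M(1,2) by (auto simp: matching_def pairwise_def disjnt_def)
  ultimately show ?thesis unfolding maximal_matching_def by blast
qed

lemma min_maximal_le: "maximal_matching G M \<Longrightarrow> min_maximal_matching G \<le> card M"
  unfolding min_maximal_matching_def
  by (rule Min_le) (auto intro: finite_imageI finite_maximal_matchings)

text \<open>A matching edge uses one vertex of each side, so fewer than three edges leave a free
  vertex on both sides, and these two are adjacent. All maximal matchings therefore have size
  3.\<close>

lemma K33_min_maximal:
  assumes "is_K33 (pverts G) (uedges G)"
  shows "min_maximal_matching G = 3" "card (pverts G) = 6"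
proof -
  obtain A B where AB: "card A = 3" "card B = 3" "A \<inter> B = {}" "pverts G = A \<union> B"
    "\<forall>a\<in>A. nbrs (uedges G) a = B" "\<forall>b\<in>B. nbrs (uedges G) b = A"
    using assms unfolding is_K33_def by blast
  have fin: "finite A" "finite B" using AB(1,2) card.infinite by fastforce+
  show "card (pverts G) = 6" using AB fin by (simp add: card_Un_disjoint)
  have E: "\<exists>a\<in>A. \<exists>b\<in>B. e = {a, b}" if eE: "e \<in> uedges G" for e
  proof -
    obtain u v where e: "e = {u, v}" "u \<in> pverts G" "v \<in> nbrs (uedges G) u"
      using sgraph_edge_cases[OF sgraph_uedges eE] by metis
    then show ?thesis using AB(4-6) by (metis UnE insert_commute)
  qed
  have "card M = 3" if M: "maximal_matching G M" for M
  proof -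
    have m: "M \<subseteq> uedges G" "\<forall>e\<in>M. \<forall>f\<in>M. e \<noteq> f \<longrightarrow> e \<inter> f = {}"
      using M by (auto simp: maximal_matching_def matching_def)
    have finM: "finite M" using m(1) finite_uedges finite_subset by blast
    have half: "card (\<Union>M \<inter> C) = card M" if C: "\<forall>e\<in>M. card (e \<inter> C) = 1" for C
    proof -
      have "\<Union>M \<inter> C = (\<Union>e\<in>M. e \<inter> C)" by blast
      then have "card (\<Union>M \<inter> C) = card (\<Union>e\<in>M. e \<inter> C)" by (rule arg_cong)
      also have "\<dots> = (\<Sum>e\<in>M. card (e \<inter> C))"
      proof (rule card_UN_disjoint[OF finM])
        show "\<forall>e\<in>M. finite (e \<inter> C)" using C by (metis card.infinite zero_neq_one)
        show "\<forall>e\<in>M. \<forall>f\<in>M. e \<noteq> f \<longrightarrow> e \<inter> C \<inter> (f \<inter> C) = {}" using m(2) by blast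
      qed
      finally show ?thesis using C by simp
    qed
    have one: "card (e \<inter> A) = 1 \<and> card (e \<inter> B) = 1" if eM: "e \<in> M" for e
    proof -
      obtain a b where ab: "a \<in> A" "b \<in> B" "e = {a, b}" using E[of e] m(1) eM by blast
      then have "e \<inter> A = {a}" "e \<inter> B = {b}" using AB(3) by auto
      then show ?thesis by simp
    qed
    have cA: "card (\<Union>M \<inter> A) = card M" and cB: "card (\<Union>M \<inter> B) = card M"
      using half one by blast+
    have le: "card M \<le> 3" using card_mono[OF fin(1), of "\<Union>M \<inter> A"] cA AB(1) by auto
    have "\<not> card M < 3"
    proof
      assume lt: "card M < 3"
      have "\<not> A \<subseteq> \<Union>M" "\<not> B \<subseteq> \<Union>M"
        using lt cA cB AB(1,2) by (auto simp: Int_absorb1)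
      then obtain a b where ab: "a \<in> A" "a \<notin> \<Union>M" "b \<in> B" "b \<notin> \<Union>M" by blast
      have "b \<in> nbrs (uedges G) a" using AB(5) ab by auto
      then have "matching G (insert {a, b} M)" using m ab
        by (auto simp: matching_def nbrs_def)
      moreover have "M \<subset> insert {a, b} M" using ab by auto
      ultimately show False using M by (auto simp: maximal_matching_def)
    qed
    then show ?thesis using le by simp
  qed
  \<comment> \<open>Existence of a maximal matching guarantees that the set of sizes is not
    empty.\<close>
  then have "card ` {M. maximal_matching G M} = {3}" using ex_maximal_matching by auto
  then show "min_maximal_matching G = 3" by (simp add: min_maximal_matching_def)
qed

lemma K33_iso:
  assumes "is_K33 (pverts G) (uedges G)"
  shows "digraph_iso (with_proj G) (with_proj (complete_bipartite_graph 3 3))"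
proof -
  obtain A B where AB: "card A = 3" "card B = 3" "A \<inter> B = {}" "pverts G = A \<union> B"
    "\<forall>a\<in>A. nbrs (uedges G) a = B" "\<forall>b\<in>B. nbrs (uedges G) b = A"
    using assms unfolding is_K33_def by blast
  have fin: "finite A" "finite B" using AB(1,2) card.infinite by fastforce+
  obtain f where f: "bij_betw f A {..<3::nat}"
    using ex_bij_betw_finite_nat[OF fin(1)] AB(1) by (auto simp: lessThan_atLeast0)
  obtain g where g: "bij_betw g B {..<3::nat}"
    using ex_bij_betw_finite_nat[OF fin(2)] AB(2) by (auto simp: lessThan_atLeast0)
  define \<phi> :: "'a \<Rightarrow> nat + nat" where "\<phi> v = (if v \<in> A then Inl (f v) else Inr (g v))" for v
  have fg: "inj_on f A" "f ` A = {..<3}" "inj_on g B" "g ` B = {..<3}"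
    using f g by (auto simp: bij_betw_def)
  have "\<phi> ` A = (\<lambda>v. Inl (f v)) ` A" by (rule image_cong) (auto simp: \<phi>_def)
  also have "\<dots> = Inl ` f ` A" by (simp add: image_image)
  finally have imA: "\<phi> ` A = Inl ` {..<3}" unfolding fg .
  have "\<phi> ` B = (\<lambda>v. Inr (g v)) ` B" by (rule image_cong) (use AB(3) in \<open>auto simp: \<phi>_def\<close>)
  also have "\<dots> = Inr ` g ` B" by (simp add: image_image)
  finally have imB: "\<phi> ` B = Inr ` {..<3}" unfolding fg .
  have inj: "inj_on \<phi> (pverts G)"
  proof (rule inj_onI)
    fix v w assume "v \<in> pverts G" "w \<in> pverts G" "\<phi> v = \<phi> w"
    then show "v = w" using inj_onD[OF fg(1), of v w] inj_onD[OF fg(3), of v w]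
      unfolding AB(4) by (auto simp: \<phi>_def split: if_splits)
  qed
  have arcs: "parcs G = A \<times> B \<union> B \<times> A"
  proof -
    have "(u, v) \<in> parcs G \<longleftrightarrow> u \<in> pverts G \<and> v \<in> nbrs (uedges G) u" for u v
      using in_arcsD1 by (auto simp: nbrs_uedges)
    then have "(u, v) \<in> parcs G \<longleftrightarrow> (u, v) \<in> A \<times> B \<union> B \<times> A" for u v
      using AB(3-6) by auto
    then show ?thesis by auto
  qed
  \<comment> \<open>Arcs of the target are pairs with the projections as tail and head, so these
    must be the fields of \<open>h\<close> for the image to equal the target exactly.\<close>
  define h where "h = \<lparr> iso_verts = \<phi>, iso_arcs = (\<lambda>(u, v). (\<phi> u, \<phi> v)), iso_head = snd, iso_tail = fst \<rparr>"
  have "pre_digraph.digraph_isomorphism (with_proj G) h"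
    unfolding pre_digraph.digraph_isomorphism_def
  proof (intro conjI)
    show "wf_digraph (with_proj G)" by unfold_locales
    show "inj_on (iso_verts h) (verts (with_proj G))" using inj by (simp add: h_def)
    show "inj_on (iso_arcs h) (arcs (with_proj G))"
      using inj in_arcsD1 in_arcsD2 by (auto simp: h_def inj_on_def)
  qed (auto simp: h_def)
  moreover have "with_proj (complete_bipartite_graph 3 3) = app_iso h (with_proj G)"
  proof -
    have "(\<lambda>(u, v). (\<phi> u, \<phi> v)) ` (C \<times> D) = \<phi> ` C \<times> \<phi> ` D" for C D by auto
    then show ?thesis
      by (simp add: app_iso_def h_def with_proj_def complete_bipartite_graph_def Let_def AB(4) arcs
          image_Un imA imB)
  qed
  ultimately show ?thesis unfolding digraph_iso_def by blast
qed

lemma iso_K33: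
  assumes "digraph_iso (with_proj G) (with_proj (complete_bipartite_graph 3 3))"
  shows "is_K33 (pverts G) (uedges G)"
proof -
  obtain h where h: "pre_digraph.digraph_isomorphism (with_proj G) h"
      "with_proj (complete_bipartite_graph 3 3) = app_iso h (with_proj G)"
    using assms unfolding digraph_iso_def by blast
  let ?\<phi> = "iso_verts h" and ?U = "Inl ` {..<3} :: (nat + nat) set" and ?W = "Inr ` {..<3} :: (nat + nat) set"
  have inj: "inj_on ?\<phi> (pverts G)" using h(1) by (simp add: pre_digraph.digraph_isomorphism_def)
  have im: "?\<phi> ` pverts G = ?U \<union> ?W"
    using arg_cong[OF h(2), of verts] by (simp add: complete_bipartite_graph_def Let_def)
  \<comment> \<open>The arc map of an isomorphism is a separate function. It respects heads and
    tails, which are projections in the target, and so it acts componentwise on arcs.\<close>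
  have ht: "iso_head h = snd" "iso_tail h = fst"
    using arg_cong[OF h(2), of head] arg_cong[OF h(2), of tail] by simp_all
  have arc: "iso_arcs h (u, v) = (?\<phi> u, ?\<phi> v)" if "(u, v) \<in> parcs G" for u v
    using h(1) that unfolding pre_digraph.digraph_isomorphism_def ht by (force simp: prod_eq_iff)
  have arcs: "iso_arcs h ` parcs G = ?U \<times> ?W \<union> ?W \<times> ?U"
    using arg_cong[OF h(2), of arcs] by (simp add: complete_bipartite_graph_def Let_def)
  have adj: "(u, v) \<in> parcs G \<longleftrightarrow> (?\<phi> u, ?\<phi> v) \<in> ?U \<times> ?W \<union> ?W \<times> ?U"
    if uv: "u \<in> pverts G" "v \<in> pverts G" for u v
  proof
    assume "(u, v) \<in> parcs G"
    then show "(?\<phi> u, ?\<phi> v) \<in> ?U \<times> ?W \<union> ?W \<times> ?U" using arc arcs by (metis imageI)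
  next
    assume "(?\<phi> u, ?\<phi> v) \<in> ?U \<times> ?W \<union> ?W \<times> ?U"
    then have "(?\<phi> u, ?\<phi> v) \<in> iso_arcs h ` parcs G" using arcs by simp
    then obtain e where e: "e \<in> parcs G" "iso_arcs h e = (?\<phi> u, ?\<phi> v)" by auto
    obtain u' v' where e': "e = (u', v')" by (cases e)
    then have "?\<phi> u' = ?\<phi> u" "?\<phi> v' = ?\<phi> v" using arc e by auto
    moreover have "u' \<in> pverts G" "v' \<in> pverts G" using e(1) e' in_arcsD1 in_arcsD2 by auto
    ultimately have "u' = u" "v' = v" using inj uv by (auto dest: inj_onD)
    then show "(u, v) \<in> parcs G" using e(1) e' by simp
  qed
  define A where "A = {v \<in> pverts G. ?\<phi> v \<in> ?U}"
  define B where "B = {v \<in> pverts G. ?\<phi> v \<in> ?W}"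
  have "inj_on ?\<phi> A" "inj_on ?\<phi> B" using inj by (auto simp: A_def B_def inj_on_def)
  moreover have "?\<phi> ` A = ?U"
  proof
    show "?U \<subseteq> ?\<phi> ` A"
    proof
      fix y assume y: "y \<in> ?U"
      then have "y \<in> ?\<phi> ` pverts G" unfolding im by simp
      then show "y \<in> ?\<phi> ` A" using y unfolding A_def by fastforce
    qed
  qed (auto simp: A_def)
  moreover have "?\<phi> ` B = ?W"
  proof
    show "?W \<subseteq> ?\<phi> ` B"
    proof
      fix y assume y: "y \<in> ?W"
      then have "y \<in> ?\<phi> ` pverts G" unfolding im by simp
      then show "y \<in> ?\<phi> ` B" using y unfolding B_def by fastforce
    qed
  qed (auto simp: B_def)
  ultimately have card: "card A = 3" "card B = 3"
    using card_image[of ?\<phi> A] card_image[of ?\<phi> B] by (simp_all add: card_image)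
  have disj: "A \<inter> B = {}" by (auto simp: A_def B_def)
  have un: "pverts G = A \<union> B"
    using im by (auto simp: A_def B_def simp del: image_Un)
  have A: "nbrs (uedges G) a = B" if "a \<in> A" for a
  proof -
    have "(a, w) \<in> parcs G \<longleftrightarrow> w \<in> B" for w
    proof (cases "w \<in> pverts G")
      case True
      then show ?thesis using adj[of a w] that by (auto simp: A_def B_def)
    next
      case False
      then show ?thesis using in_arcsD2 by (auto simp: B_def)
    qed
    then show ?thesis by (auto simp: nbrs_uedges)
  qed
  have B: "nbrs (uedges G) b = A" if "b \<in> B" for b
  proof -
    have "(b, w) \<in> parcs G \<longleftrightarrow> w \<in> A" for w
    proof (cases "w \<in> pverts G")
      case True
      then show ?thesis using adj[of b w] that by (auto simp: A_def B_def)
    next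
      case False
      then show ?thesis using in_arcsD2 by (auto simp: A_def)
    qed
    then show ?thesis by (auto simp: nbrs_uedges)
  qed
  show ?thesis unfolding is_K33_def
    by (rule exI[of _ A], rule exI[of _ B]) (use card disj un A B in auto)
qed

end

theorem theorem1p2:
  fixes G :: "'a pair_pre_digraph" and n :: nat
  assumes "pair_graph G"
    and "connected (with_proj G)"
    and "cubic_graph G"
    and "card (pverts G) = n"
  shows "real (min_maximal_matching G) \<le> 5 / 12 * real n + 1 / 2
    \<and> (real (min_maximal_matching G) = 5 / 12 * real n + 1 / 2
        \<longleftrightarrow> digraph_iso (with_proj G) (with_proj (complete_bipartite_graph 3 3)))"
proof -
  interpret pair_graph G by fact
  interpret C: connected_cubic "pverts G" "uedges G"
    by (rule connected_cubicI) fact+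
  have K33: "min_maximal_matching G = 3 \<and> n = 6" if "is_K33 (pverts G) (uedges G)"
    using K33_min_maximal[OF that] assms(4) by simp
  show ?thesis
  proof (cases "is_K33 (pverts G) (uedges G)")
    case True
    then show ?thesis using K33 K33_iso by simp
  next
    case False
    then have "C.nearly_meets_bound" using C.nearly_meets_bound_or_K33 by blast
    then obtain M where M: "dominating_matching (uedges G) M"
        "6 * card M + card (uedges G) \<le> 4 * card (pverts G) + 2"
      unfolding C.nearly_meets_bound_def by blast
    have "min_maximal_matching G \<le> card M"
      by (rule min_maximal_le[OF maximal_if_dominating[OF M(1)]])
    \<comment> \<open>Doubling and 2m = 3n turn 6 \<gamma> + m \<le> 4n + 2 into this; it is strict
      against 5n + 6, so equality is confined to K_{3,3}.\<close>
    then have "12 * min_maximal_matching G \<le> 5 * n + 4"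
      using M(2) C.double_edges assms(4) by linarith
    then have "12 * real (min_maximal_matching G) \<le> 5 * real n + 4"
      by (metis (mono_tags, lifting) of_nat_add of_nat_le_iff of_nat_mult of_nat_numeral)
    then have "real (min_maximal_matching G) < 5 / 12 * real n + 1 / 2" by simp
    moreover have "\<not> digraph_iso (with_proj G) (with_proj (complete_bipartite_graph 3 3))"
      using iso_K33 False by blast
    ultimately show ?thesis by simp
  qed
qed

end
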